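(* Assume that either $d>2$ or $s>0$. Then the problem: find $\mathcal{U}\in H^1_\rho(y^\alpha,\mathbb{R}^d\times\mathbb{R}^+)$ with $$A(\mathcal{U},\mathcal{V})=d_\beta\,(f,\mathrm{tr}_0\mathcal{V})_{L^2(\mathbb{R}^d)}\qquad\text{for all }\mathcal{V}\in H^1_\rho(y^\alpha,\mathbb{R}^d\times\mathbb{R}^+)$$ has a unique solution $\mathcal{U}$, and there is a constant $C>0$ such that $$\|\mathcal{U}\|_{\mathbb{H}}\le C\min(1,s^{-1})\,\|f\|_{L^2(\Omega)}.$$ Fix $\mathcal{Y}\in(0,\infty)$. Then the truncated problem: find $\mathcal{U}^{\mathcal{Y}}\in H^1_\rho(y^\alpha,\mathbb{R}^d\times(0,\mathcal{Y}))$ with $$A^{\mathcal{Y}}(\mathcal{U}^{\mathcal{Y}},\mathcal{V})=d_\beta\,(f,\mathrm{tr}_0\mathcal{V})_{L^2(\mathbb{R}^d)}\qquad\text{for all }\mathcal{V}\in H^1_\rho(y^\alpha,\mathbb{R}^d\times(0,\mathcal{Y}))$$ has a unique solution $\mathcal{U}^{\mathcal{Y}}$, and it satisfies $$\|\mathcal{U}^{\mathcal{Y}}\|_{\mathbb{H}^{\mathcal{Y}}}\le C\Big(1+\frac1{\mathcal{Y}}\Big)\min(1,s^{-1})\,\|f\|_{L^2(\Omega)}$$ with a constant $C>0$ independent of $\mathcal{Y}$. Moreover, the bilinear forms $A$ and $A^{\mathcal{Y}}$ are coercive (with respect to $\|\cdot\|_{\mathbb{H}}$ and $\|\cdot\|_{\mathbb{H}^{\mathcal{Y}}}$,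 respectively).
   Context: Data: $d\in\{2,3\}$, $\beta\in(0,1)$, $\alpha:=1-2\beta\in(-1,1)$, $d_\beta:=2^{1-2\beta}\Gamma(1-\beta)/\Gamma(\beta)$, $s\ge0$; in the case $d=2$ it is assumed that $s\ge\sigma_0>0$. $\Omega\subseteq\mathbb{R}^d$ is a bounded Lipschitz domain. $\mathfrak{A}:\mathbb{R}^d\to\mathbb{R}^{d\times d}$ is smooth, pointwise symmetric, positive definite in the sense that $\mathfrak{A}(x)\eta\cdot\eta\ge\mathfrak{A}_0|\eta|^2$ for all $x,\eta\in\mathbb{R}^d$ with some $\mathfrak{A}_0>0$, and $\mathfrak{A}\equiv I$ on $\mathbb{R}^d\setminus\overline\Omega$. $f\in L^2(\mathbb{R}^d)$ with $\operatorname{supp}f\subseteq\Omega$. Put $\mathfrak{A}_x:=\begin{pmatrix}\mathfrak{A}&0\\0&1\end{pmatrix}\in\mathbb{R}^{(d+1)\times(d+1)}$. For $s=0$, $\min(1,s^{-1})$ is read as $1$. Spaces: $\rho(x,y):=(1+|x|^2+|y|^2)^{1/2}$. For $D\subset\mathbb{R}^d\times\mathbb{R}^+$, $H^1_\rho(y^\alpha,D)$ is the space of functions $\mathcal{U}$ with finite norm $\|\mathcal{U}\|^2_{H^1_\rho(y^\alpha,D)}:=\int\int_D y^\alpha(|\nabla\mathcal{U}|^2+\rho^{-2}|\mathcal{U}|^2)\,dx\,dy$, where $\nabla=(\nabla_x,\partial_y)$. $\mathrm{tr}_0\mathcal{U}$ denotes the trace at $y=0$. Norms: $\|\mathcal{U}\|_{\mathbb{H}}^2:=\|\mathcal{U}\|^2_{H^1_\rho(y^\alpha,\mathbb{R}^d\times\mathbb{R}^+)}+s\|\mathrm{tr}_0\mathcal{U}\|^2_{L^2(\mathbb{R}^d)}$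 and $\|\mathcal{U}\|_{\mathbb{H}^{\mathcal{Y}}}^2:=\|\mathcal{U}\|^2_{H^1_\rho(y^\alpha,\mathbb{R}^d\times(0,\mathcal{Y}))}+s\|\mathrm{tr}_0\mathcal{U}\|^2_{L^2(\mathbb{R}^d)}$. If $s>0$, trial and test functions in the variational problems are understood to have trace in $L^2(\mathbb{R}^d)$, i.e. finite $\mathbb{H}$- resp. $\mathbb{H}^{\mathcal{Y}}$-norm. Bilinear forms: for $\mathcal{Y}\in(0,\infty)$, $A^{\mathcal{Y}}(\mathcal{U},\mathcal{V}):=\int_0^{\mathcal{Y}}y^\alpha\int_{\mathbb{R}^d}\mathfrak{A}_x\nabla\mathcal{U}\cdot\nabla\mathcal{V}\,dx\,dy+s\,d_\beta\int_{\mathbb{R}^d}\mathrm{tr}_0\mathcal{U}\,\mathrm{tr}_0\mathcal{V}\,dx$, and $A$ is the same expression with $\mathcal{Y}=\infty$. *)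

theory Defs
  imports "HOL-Analysis.Analysis"
begin

text \<open>
  Functions are Borel measurable representatives; equality of elements of the function spaces is
  equality almost everywhere. A point of \<open>\<real>\<^sup>d \<times> \<real>\<close> is a pair \<open>(x, y)\<close> of type
  \<open>(real ^ 'd) \<times> real\<close>, whose library norm and inner product are the Euclidean ones; the extended
  gradient \<open>(\<nabla>\<^sub>x U, \<partial>\<^sub>y U)\<close> has values in the same type.
\<close>

section \<open>Smooth functions and domains\<close>

primrec Ck :: "nat \<Rightarrow> ('a::real_normed_vector \<Rightarrow> 'b::real_normed_vector) \<Rightarrow> bool" where
  "Ck 0 f \<longleftrightarrow> continuous_on UNIV f"
| "Ck (Suc k) f \<longleftrightarrow>
     (\<forall>x. f differentiable (at x)) \<and> (\<forall>v. Ck k (\<lambda>x. frechet_derivative f (at x) v))"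

definition smooth :: "('a::real_normed_vector \<Rightarrow> 'b::real_normed_vector) \<Rightarrow> bool" where
  "smooth f \<longleftrightarrow> (\<forall>k. Ck k f)"

definition test_function :: "'a::euclidean_space set \<Rightarrow> ('a \<Rightarrow> real) \<Rightarrow> bool" where
  "test_function D \<phi> \<longleftrightarrow>
     smooth \<phi> \<and> compact (closure {z. \<phi> z \<noteq> 0}) \<and> closure {z. \<phi> z \<noteq> 0} \<subseteq> D"

text \<open>
  Near each boundary point the set is the strict epigraph, in the direction of a unit vector
  \<open>\<nu>\<close>, of a Lipschitz function of the component orthogonal to \<open>\<nu>\<close>. Taking \<open>\<gamma>\<close> to be
  defined on the whole space rather than on the hyperplane orthogonal to \<open>\<nu>\<close> is harmless, as
  \<open>\<gamma>\<close> is only evaluated on that hyperplane.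
\<close>

definition bounded_lipschitz_domain :: "'a::euclidean_space set \<Rightarrow> bool" where
  "bounded_lipschitz_domain \<Omega> \<longleftrightarrow>
     open \<Omega> \<and> connected \<Omega> \<and> \<Omega> \<noteq> {} \<and> bounded \<Omega> \<and>
     (\<forall>p\<in>frontier \<Omega>. \<exists>\<nu> (\<gamma> :: 'a \<Rightarrow> real) L r.
        norm \<nu> = 1 \<and> r > 0 \<and> L-lipschitz_on UNIV \<gamma> \<and>
        \<Omega> \<inter> ball p r = {x \<in> ball p r. \<gamma> (x - (x \<bullet> \<nu>) *\<^sub>R \<nu>) < x \<bullet> \<nu>})"

section \<open>Square integrable functions\<close>

definition L2 :: "('a::euclidean_space \<Rightarrow> real) set" where
  "L2 = {f. f \<in> borel_measurable lborel \<and> integrable lborel (\<lambda>x. (f x)\<^sup>2)}"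

definition L2_norm_on :: "'a::euclidean_space set \<Rightarrow> ('a \<Rightarrow> real) \<Rightarrow> real" where
  "L2_norm_on S f = sqrt (LINT x:S|lborel. (f x)\<^sup>2)"

text \<open>The complement of the largest open set on which the function vanishes almost everywhere.\<close>

definition ess_support :: "('a::euclidean_space \<Rightarrow> real) \<Rightarrow> 'a set" where
  "ess_support f = {x. \<forall>r>0. \<not> (AE z in lborel. z \<in> ball x r \<longrightarrow> f z = 0)}"

section \<open>Weighted Sobolev spaces on half space and truncated half space\<close>

definition half_space :: "((real ^ 'd) \<times> real) set" where
  "half_space = UNIV \<times> {0<..}"

definition slab :: "real \<Rightarrow> ((real ^ 'd) \<times> real) set" where
  "slab Y = UNIV \<times> {0<..<Y}"

definition locally_integrable :: "'a::euclidean_space set \<Rightarrow> ('a \<Rightarrow> 'b::euclidean_space) \<Rightarrow> bool"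
  where "locally_integrable D f \<longleftrightarrow> (\<forall>K. compact K \<and> K \<subseteq> D \<longrightarrow> set_integrable lborel K f)"

definition has_weak_gradient ::
  "'a::euclidean_space set \<Rightarrow> ('a \<Rightarrow> real) \<Rightarrow> ('a \<Rightarrow> 'a) \<Rightarrow> bool" where
  "has_weak_gradient D U G \<longleftrightarrow>
     locally_integrable D U \<and> locally_integrable D G \<and>
     (\<forall>\<phi>. test_function D \<phi> \<longrightarrow>
        (\<forall>b\<in>Basis. (LINT z:D|lborel. U z * frechet_derivative \<phi> (at z) b)
                  = - (LINT z:D|lborel. (G z \<bullet> b) * \<phi> z)))"

definition weak_grad :: "'a::euclidean_space set \<Rightarrow> ('a \<Rightarrow> real) \<Rightarrow> 'a \<Rightarrow> 'a" where
  "weak_grad D U = (SOME G. has_weak_gradient D U G)"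

definition rho :: "(real ^ 'd) \<times> real \<Rightarrow> real" where
  "rho z = sqrt (1 + (norm (fst z))\<^sup>2 + (snd z)\<^sup>2)"

definition H1rho_density ::
  "real \<Rightarrow> ((real ^ 'd) \<times> real) set \<Rightarrow> ((real ^ 'd) \<times> real \<Rightarrow> real) \<Rightarrow> (real ^ 'd) \<times> real \<Rightarrow> real"
  where
  "H1rho_density \<alpha> D U z =
     snd z powr \<alpha> * ((norm (weak_grad D U z))\<^sup>2 + (U z)\<^sup>2 / (rho z)\<^sup>2)"

definition H1rho :: "real \<Rightarrow> ((real ^ 'd) \<times> real) set \<Rightarrow> ((real ^ 'd) \<times> real \<Rightarrow> real) set" where
  "H1rho \<alpha> D = {U. (\<exists>G. has_weak_gradient D U G) \<and> set_integrable lborel D (H1rho_density \<alpha> D U)}"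

definition H1rho_norm ::
  "real \<Rightarrow> ((real ^ 'd) \<times> real) set \<Rightarrow> ((real ^ 'd) \<times> real \<Rightarrow> real) \<Rightarrow> real" where
  "H1rho_norm \<alpha> D U = sqrt (LINT z:D|lborel. H1rho_density \<alpha> D U z)"

text \<open>
  The trace at \<open>y = 0\<close> is the limit of the slices \<open>U(\<cdot>, y)\<close> in \<open>L\<^sup>2\<^sub>l\<^sub>o\<^sub>c(\<real>\<^sup>d)\<close> as \<open>y\<close> tends to
  0 from above. Since \<open>U\<close> is determined only almost everywhere, the limit is an essential one:
  null sets of heights \<open>y\<close> are disregarded.
\<close>

definition is_trace0 :: "((real ^ 'd) \<times> real \<Rightarrow> real) \<Rightarrow> (real ^ 'd \<Rightarrow> real) \<Rightarrow> bool" where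
  "is_trace0 U g \<longleftrightarrow> g \<in> borel_measurable lborel \<and>
     (\<forall>R>0. \<forall>\<epsilon>>0. \<exists>\<delta>>0. AE y in lborel. 0 < y \<and> y < \<delta> \<longrightarrow>
        (\<integral>\<^sup>+x\<in>ball 0 R. ennreal ((U (x, y) - g x)\<^sup>2) \<partial>lborel) < ennreal \<epsilon>)"

definition trace0 :: "((real ^ 'd) \<times> real \<Rightarrow> real) \<Rightarrow> real ^ 'd \<Rightarrow> real" where
  "trace0 U = (SOME g. is_trace0 U g)"

text \<open>
  For \<open>s = 0\<close> no square integrability of the trace is required, and the trace term of the norm
  and of the bilinear form below vanishes because of the factor \<open>s\<close>.
\<close>

definition energy_space ::
  "real \<Rightarrow> real \<Rightarrow> ((real ^ 'd) \<times> real) set \<Rightarrow> ((real ^ 'd) \<times> real \<Rightarrow> real) set" where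
  "energy_space \<alpha> s D = {U \<in> H1rho \<alpha> D. s > 0 \<longrightarrow> trace0 U \<in> L2}"

definition energy_norm ::
  "real \<Rightarrow> real \<Rightarrow> ((real ^ 'd) \<times> real) set \<Rightarrow> ((real ^ 'd) \<times> real \<Rightarrow> real) \<Rightarrow> real" where
  "energy_norm \<alpha> s D U = sqrt ((H1rho_norm \<alpha> D U)\<^sup>2 + s * (L2_norm_on UNIV (trace0 U))\<^sup>2)"

section \<open>Variational problem\<close>

definition d_const :: "real \<Rightarrow> real" where
  "d_const \<beta> = 2 powr (1 - 2 * \<beta>) * Gamma (1 - \<beta>) / Gamma \<beta>"

text \<open>Multiplication by the block diagonal matrix with blocks \<open>M\<close> and \<open>1\<close>.\<close>

definition ext_mult :: "real ^ 'd ^ 'd \<Rightarrow> (real ^ 'd) \<times> real \<Rightarrow> (real ^ 'd) \<times> real" where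
  "ext_mult M w = (M *v fst w, snd w)"

definition bilinear_form ::
  "real \<Rightarrow> real \<Rightarrow> (real ^ 'd \<Rightarrow> real ^ 'd ^ 'd) \<Rightarrow> ((real ^ 'd) \<times> real) set \<Rightarrow>
   ((real ^ 'd) \<times> real \<Rightarrow> real) \<Rightarrow> ((real ^ 'd) \<times> real \<Rightarrow> real) \<Rightarrow> real" where
  "bilinear_form \<beta> s \<AA> D U V =
     (LINT z:D|lborel. snd z powr (1 - 2 * \<beta>) *
        (ext_mult (\<AA> (fst z)) (weak_grad D U z) \<bullet> weak_grad D V z))
     + s * d_const \<beta> * (LINT x|lborel. trace0 U x * trace0 V x)"

definition is_solution ::
  "real \<Rightarrow> real \<Rightarrow> (real ^ 'd \<Rightarrow> real ^ 'd ^ 'd) \<Rightarrow> ((real ^ 'd) \<times> real) set \<Rightarrow>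
   (real ^ 'd \<Rightarrow> real) \<Rightarrow> ((real ^ 'd) \<times> real \<Rightarrow> real) \<Rightarrow> bool" where
  "is_solution \<beta> s \<AA> D f U \<longleftrightarrow>
     U \<in> energy_space (1 - 2 * \<beta>) s D \<and>
     (\<forall>V\<in>energy_space (1 - 2 * \<beta>) s D.
        bilinear_form \<beta> s \<AA> D U V = d_const \<beta> * (LINT x|lborel. f x * trace0 V x))"

definition unique_solution ::
  "real \<Rightarrow> real \<Rightarrow> (real ^ 'd \<Rightarrow> real ^ 'd ^ 'd) \<Rightarrow> ((real ^ 'd) \<times> real) set \<Rightarrow>
   (real ^ 'd \<Rightarrow> real) \<Rightarrow> ((real ^ 'd) \<times> real \<Rightarrow> real) \<Rightarrow> bool" where
  "unique_solution \<beta> s \<AA> D f U \<longleftrightarrow>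
     is_solution \<beta> s \<AA> D f U \<and>
     (\<forall>W. is_solution \<beta> s \<AA> D f W \<longrightarrow> (AE z in lborel. z \<in> D \<longrightarrow> W z = U z))"

definition coercive ::
  "real \<Rightarrow> real \<Rightarrow> (real ^ 'd \<Rightarrow> real ^ 'd ^ 'd) \<Rightarrow> ((real ^ 'd) \<times> real) set \<Rightarrow> bool" where
  "coercive \<beta> s \<AA> D \<longleftrightarrow>
     (\<exists>c>0. \<forall>U\<in>energy_space (1 - 2 * \<beta>) s D.
        bilinear_form \<beta> s \<AA> D U U \<ge> c * (energy_norm (1 - 2 * \<beta>) s D U)\<^sup>2)"

definition min1_inv :: "real \<Rightarrow> real" where
  "min1_inv s = (if s = 0 then 1 else min 1 (1 / s))"

end

theory Submission
  imports Defs "HOL-Computational_Algebra.Polynomial"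
begin

text \<open>
  The truncated and the full problem live on cylinders \<open>\<real>\<^sup>d \<times> I\<close> whose set \<open>I\<close> of heights is stable
  under contractions, and they are treated together. Given completeness of the energy space, the
  minimization argument of Riesz yields existence, and everything else comes down to two estimates:
  coercivity of the form, with a constant that is the same for all cylinders, and boundedness of
  the load \<open>V \<mapsto> (f, tr V)\<close>, whose norm is allowed to grow like \<open>1 + 1 / h\<close> if the cylinder has height
  \<open>h\<close>. Since \<open>s\<close> is given before the constants are chosen, the factor \<open>min1_inv s\<close> can be absorbed in
  them.

  Both estimates rest on one identity. For a function with weak gradient \<open>G\<close> and for dilations \<open>T\<^sub>m\<close>
  of some of the coordinates, \<open>U (T\<^sub>b z) - U (T\<^sub>a z)\<close> is the integral over \<open>m\<close> between \<open>a\<close> and \<open>b\<close> of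
  \<open>G (T\<^sub>m z) \<bullet> P z\<close>, for almost all \<open>z\<close>, where \<open>P z\<close> is the derivative of \<open>T\<^sub>m z\<close> with respect to \<open>m\<close>
  (\<open>weak_gradient_along_dilations\<close>). Its proof differentiates the dilated test functions, which are
  smooth, rather than \<open>U\<close>.

  Dilating the height between 0 and 1 writes \<open>U\<close> as its trace plus \<open>y\<close> times a mean of \<open>\<partial>\<^sub>y U\<close>
  (\<open>trace_representation\<close>). The Cauchy--Schwarz inequality with a power weight turns this into
  Hardy's inequality for \<open>U - tr U\<close> and into the convergence of the slices that defines the trace
  (\<open>trace_bounds\<close>). Two consequences follow. The weighted mass of \<open>U\<close> is bounded by its gradient and
  the \<open>L\<^sup>2\<close> norm of its trace (\<open>mass_le_trace\<close>), which gives coercivity if \<open>s > 0\<close>. The trace on a ball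
  is bounded by the energy (\<open>local_trace_bound\<close>), which gives boundedness of the load.

  If \<open>s = 0\<close>, then \<open>d = 3\<close>, and the mass has to be bounded by the gradient alone. Dilating the
  horizontal coordinates by 4 costs at most a factor \<open>16\<close> in the weight \<open>\<rho>\<^sup>-\<^sup>2\<close> but gains \<open>4\<^sup>-\<^sup>3\<close> from
  the volume, so that the dilated function has at most a quarter of the mass; the gradient controls
  the difference of the two functions, and the finite mass can be absorbed (\<open>mass_le_gradient\<close>).

  Completeness of the energy space follows from completeness of \<open>L\<^sup>2\<close> for the vector
  \<open>(U / \<rho>, \<nabla> U)\<close>, because weak gradients pass to limits (\<open>H1rho_complete\<close>); the \<open>L\<^sup>2\<close> limit of the
  traces is identified with the trace of the limit by the local trace estimate (\<open>trace_limit\<close>).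
\<close>

section \<open>Smooth bump functions\<close>

lemma Ck_SucI:
  assumes "\<And>x. (f has_derivative f' x) (at x)" "\<And>v. Ck k (\<lambda>x. f' x v)"
  shows "Ck (Suc k) f"
proof -
  have "frechet_derivative f (at x) = f' x" for x
    using frechet_derivative_at[OF assms(1)] by simp
  then show ?thesis using assms by (auto simp: differentiable_def)
qed

lemma Ck_Suc_imp: "Ck (Suc k) f \<Longrightarrow> Ck k f"
proof (induction k arbitrary: f)
  case 0
  then show ?case
    by (auto intro!: continuous_at_imp_continuous_on differentiable_imp_continuous_within)
next
  case (Suc k)
  then show ?case by (metis Ck.simps(2))
qed

lemma Ck_const: "Ck k (\<lambda>x. c)"
proof (induction k arbitrary: c)
  case (Suc k)
  show ?case by (rule Ck_SucI[where f'="\<lambda>_ _. 0"]) (auto intro: Suc)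
qed simp

lemma Ck_has_derivative:
  "Ck (Suc k) f \<Longrightarrow> (f has_derivative frechet_derivative f (at x)) (at x)"
  by (simp add: frechet_derivative_works)

lemma Ck_add: "Ck k f \<Longrightarrow> Ck k g \<Longrightarrow> Ck k (\<lambda>x. f x + g x)"
proof (induction k arbitrary: f g)
  case (Suc k)
  show ?case
    by (rule Ck_SucI[where f'="\<lambda>x v. frechet_derivative f (at x) v + frechet_derivative g (at x) v"])
      (use Suc in \<open>auto intro!: has_derivative_add Ck_has_derivative Suc.IH\<close>)
qed (auto intro: continuous_intros)

lemma Ck_mult:
  fixes f g :: "'a::real_normed_vector \<Rightarrow> real"
  shows "Ck k f \<Longrightarrow> Ck k g \<Longrightarrow> Ck k (\<lambda>x. f x * g x)"
proof (induction k arbitrary: f g)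
  case (Suc k)
  have fg: "Ck k f" "Ck k g" using Suc.prems by (blast intro: Ck_Suc_imp)+
  show ?case
    by (rule Ck_SucI[where f'="\<lambda>x v. f x * frechet_derivative g (at x) v
          + frechet_derivative f (at x) v * g x"])
      (use Suc.prems fg in \<open>auto intro!: has_derivative_mult Ck_has_derivative Suc.IH Ck_add\<close>)
qed (auto intro: continuous_intros)

lemma Ck_prod:
  fixes f :: "'i \<Rightarrow> 'a::real_normed_vector \<Rightarrow> real"
  shows "(\<And>i. i \<in> A \<Longrightarrow> Ck k (f i)) \<Longrightarrow> Ck k (\<lambda>x. \<Prod>i\<in>A. f i x)"
  by (induction A rule: infinite_finite_induct) (auto intro: Ck_const Ck_mult)

lemma Ck_linear: "bounded_linear l \<Longrightarrow> Ck k l"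
proof (cases k)
  case (Suc j)
  assume l: "bounded_linear l"
  show ?thesis unfolding Suc
    by (rule Ck_SucI[where f'="\<lambda>x. l"])
      (use l in \<open>auto intro: bounded_linear_imp_has_derivative Ck_const\<close>)
qed (auto intro: linear_continuous_on)

lemma Ck_compose_linear:
  "Ck k f \<Longrightarrow> bounded_linear l \<Longrightarrow> Ck k (\<lambda>x. f (l x))"
proof (induction k arbitrary: f)
  case 0
  then show ?case
    by (auto intro: continuous_on_compose2[of UNIV f] linear_continuous_on)
next
  case (Suc k)
  have "((\<lambda>x. f (l x)) has_derivative (\<lambda>v. frechet_derivative f (at (l x)) (l v))) (at x)" for x
    using Suc.prems
    by (auto intro!: has_derivative_compose[OF _ Ck_has_derivative, of l] bounded_linear_imp_has_derivative)
  then show ?case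
    by (rule Ck_SucI) (use Suc in auto)
qed

text \<open>Functions of this shape are closed under differentiation, which is why the polynomial factor
  is there; with \<open>p = 1\<close> it is the classical flat function.\<close>

definition flat :: "real poly \<Rightarrow> real \<Rightarrow> real" where
  "flat p t = (if t > 0 then poly p (1 / t) * exp (- (1 / t)) else 0)"

lemma poly_times_exp_tendsto_0: "((\<lambda>x. poly p x * exp (- x)) \<longlongrightarrow> (0::real)) at_top"
proof -
  have "((\<lambda>x. \<Sum>i\<le>degree p. coeff p i * (x ^ i / exp x)) \<longlongrightarrow> (\<Sum>i\<le>degree p. coeff p i * 0)) at_top"
    by (intro tendsto_intros tendsto_power_div_exp_0)
  then show ?thesis
    by (simp add: poly_altdef sum_distrib_right exp_minus divide_inverse mult.assoc)
qed

text \<open>At 0 the difference quotient \<open>flat p t / t\<close> is, from the right, again a polynomial in \<open>1 / t\<close> times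
  \<open>exp (- (1 / t))\<close>, which decays faster than any power. This is what makes the bumps smooth.\<close>

lemma flat_has_derivative:
  "(flat p has_real_derivative flat (monom 1 2 * (p - pderiv p)) t) (at t)"
proof -
  consider "t > 0" | "t < 0" | "t = 0" by linarith
  then show ?thesis
  proof cases
    case 1
    have "((\<lambda>t. poly p (1 / t) * exp (- (1 / t))) has_real_derivative
        flat (monom 1 2 * (p - pderiv p)) t) (at t)"
      using 1 unfolding flat_def
      by (auto intro!: derivative_eq_intros DERIV_chain2[OF poly_DERIV]
          simp: poly_monom power2_eq_square field_simps)
    then show ?thesis
      by (rule has_field_derivative_transform_within_open[where S="{0<..}"]) (use 1 in \<open>auto simp: flat_def\<close>)
  next
    case 2
    have "((\<lambda>t. 0) has_real_derivative flat (monom 1 2 * (p - pderiv p)) t) (at t)"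
      using 2 unfolding flat_def by auto
    then show ?thesis
      by (rule has_field_derivative_transform_within_open[where S="{..<0}"]) (use 2 in \<open>auto simp: flat_def\<close>)
  next
    case 3
    have "((\<lambda>h. poly (pCons 0 p) (inverse h) * exp (- inverse h)) \<longlongrightarrow> 0) (at_right 0)"
      using filterlim_compose[OF poly_times_exp_tendsto_0 filterlim_inverse_at_top_right] .
    then have r: "((\<lambda>h. flat p h / h) \<longlongrightarrow> 0) (at_right 0)"
      by (rule Lim_transform_eventually)
        (auto simp: flat_def eventually_at_right_less field_simps eventually_at_topological intro!: exI[of _ UNIV])
    have l: "((\<lambda>h. flat p h / h) \<longlongrightarrow> 0) (at_left 0)"
      by (rule Lim_transform_eventually[OF tendsto_const])
        (auto simp: flat_def eventually_at_topological intro!: exI[of _ UNIV])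
    have "((\<lambda>h. flat p h / h) \<longlongrightarrow> 0) (at 0)"
      using l r by (simp add: filterlim_at_split)
    then show ?thesis using 3 by (simp add: DERIV_def flat_def)
  qed
qed

lemma Ck_flat: "Ck k (flat p)"
proof (induction k arbitrary: p)
  case 0
  show ?case
    by (auto intro!: continuous_at_imp_continuous_on DERIV_isCont flat_has_derivative)
next
  case (Suc k)
  show ?case
    by (rule Ck_SucI[OF flat_has_derivative[unfolded has_field_derivative_def]])
      (auto intro: Ck_mult Ck_const Suc)
qed

lemma Ck_compose_shift: "Ck k f \<Longrightarrow> Ck k (\<lambda>x. f (x + c))"
proof (induction k arbitrary: f)
  case 0
  then show ?case
    by (auto intro!: continuous_on_compose2[of UNIV f] continuous_intros)
next
  case (Suc k)
  have "((\<lambda>x. f (x + c)) has_derivative frechet_derivative f (at (x + c))) (at x)" for x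
    by (rule has_derivative_compose[of "\<lambda>x. x + c" "\<lambda>v. v" x UNIV f])
      (auto intro!: derivative_eq_intros Ck_has_derivative[OF Suc.prems])
  then show ?case
    by (rule Ck_SucI) (use Suc in auto)
qed

text \<open>Smooth functions vanishing off the box with corners \<open>a\<close> and \<open>b\<close>, increasing to the indicator
  of its interior as \<open>k\<close> grows.\<close>

definition box_bump :: "'a::euclidean_space \<Rightarrow> 'a \<Rightarrow> nat \<Rightarrow> 'a \<Rightarrow> real" where
  "box_bump a b k z = (\<Prod>i\<in>Basis. flat 1 (real k * (z \<bullet> i - a \<bullet> i)) * flat 1 (real k * (b \<bullet> i - z \<bullet> i)))"

lemma flat_1_bounds: "0 \<le> flat 1 t" "flat 1 t \<le> 1"
  by (auto simp: flat_def)

lemma box_bump_bounds: "0 \<le> box_bump a b k z" "box_bump a b k z \<le> 1"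
  unfolding box_bump_def
  by (auto intro!: prod_nonneg prod_le_1 mult_nonneg_nonneg mult_le_one simp: flat_1_bounds)

lemma smooth_box_bump: "smooth (box_bump a b k)"
  unfolding smooth_def
proof
  fix n
  have "Ck n (\<lambda>z. flat 1 (real k * (z \<bullet> i - a \<bullet> i)))" for i
    using Ck_compose_linear[OF Ck_compose_shift[OF Ck_flat[of n 1], of "- real k * (a \<bullet> i)"],
        of "\<lambda>z. real k * (z \<bullet> i)"]
    by (simp add: algebra_simps bounded_linear_intros)
  moreover have "Ck n (\<lambda>z. flat 1 (real k * (b \<bullet> i - z \<bullet> i)))" for i
    using Ck_compose_linear[OF Ck_compose_shift[OF Ck_flat[of n 1], of "real k * (b \<bullet> i)"],
        of "\<lambda>z. - (real k * (z \<bullet> i))"]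
      bounded_linear_minus[OF bounded_linear_const_mult[OF bounded_linear_inner_left, of "real k" i]]
    by (simp add: algebra_simps)
  ultimately show "Ck n (box_bump a b k)"
    unfolding box_bump_def by (intro Ck_prod Ck_mult) auto
qed

lemma box_bump_eq_0:
  assumes "z \<notin> box a b" shows "box_bump a b k z = 0"
proof -
  obtain i where "i \<in> Basis" "z \<bullet> i \<le> a \<bullet> i \<or> b \<bullet> i \<le> z \<bullet> i"
    using assms by (auto simp: mem_box not_less)
  then have "flat 1 (real k * (z \<bullet> i - a \<bullet> i)) * flat 1 (real k * (b \<bullet> i - z \<bullet> i)) = 0"
    by (auto simp: flat_def zero_less_mult_iff not_less)
  then show ?thesis
    unfolding box_bump_def using \<open>i \<in> Basis\<close> by (auto intro!: prod_zero)
qed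

lemma box_bump_tendsto: "(\<lambda>k. box_bump a b k z) \<longlonglongrightarrow> indicator (box a b) z"
proof (cases "z \<in> box a b")
  case False
  then show ?thesis by (simp add: box_bump_eq_0)
next
  case True
  have f: "(\<lambda>k. flat 1 (real k * t)) \<longlonglongrightarrow> 1" if "t > 0" for t
  proof -
    have "(\<lambda>k. exp (- (inverse (real k) * (1 / t)))) \<longlonglongrightarrow> exp (- (0 * (1 / t)))"
      by (intro tendsto_intros LIMSEQ_inverse_real_of_nat lim_inverse_n)
    moreover have "\<forall>\<^sub>F k in sequentially. exp (- (inverse (real k) * (1 / t))) = flat 1 (real k * t)"
      using eventually_gt_at_top[of 0] by eventually_elim (use that in \<open>auto simp: flat_def field_simps\<close>)
    ultimately show ?thesis by (auto intro: Lim_transform_eventually)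
  qed
  have "(\<lambda>k. box_bump a b k z) \<longlonglongrightarrow> (\<Prod>i\<in>(Basis::'a set). 1 * 1)"
    unfolding box_bump_def
    by (intro tendsto_prod tendsto_mult f) (use True in \<open>auto simp: mem_box\<close>)
  then show ?thesis using True by simp
qed

lemma test_function_box_bump:
  assumes "cbox a b \<subseteq> D" shows "test_function D (box_bump a b k)"
proof -
  have "{z. box_bump a b k z \<noteq> 0} \<subseteq> cbox a b"
    using box_bump_eq_0 box_subset_cbox by blast
  then have "closure {z. box_bump a b k z \<noteq> 0} \<subseteq> cbox a b"
    by (intro closure_minimal) auto
  then show ?thesis
    unfolding test_function_def using assms smooth_box_bump
    by (metis bounded_cbox bounded_subset closed_closure compact_eq_bounded_closed order_trans)
qed

section \<open>Weak gradients\<close>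

lemma locally_integrable_measurable:
  fixes f :: "'a::euclidean_space \<Rightarrow> 'b::euclidean_space"
  assumes "open D" "locally_integrable D f"
  shows "(\<lambda>x. indicator D x *\<^sub>R f x) \<in> borel_measurable borel"
proof -
  obtain C where C: "\<And>n. compact (C n)" "\<And>n. C n \<subseteq> D" "\<And>n. C n \<subseteq> interior(C(Suc n))" "\<Union>(range C) = D"
      "\<And>K. compact K \<Longrightarrow> K \<subseteq> D \<Longrightarrow> \<exists>N. \<forall>n\<ge>N. K \<subseteq> (C n :: 'a set)"
    using open_Union_compact_subsets[OF assms(1)] by blast
  have "(\<lambda>x. indicator (C n) x *\<^sub>R f x) \<in> borel_measurable borel" for n
  proof -
    have "set_integrable lborel (C n) f" using assms(2) C(1,2) by (auto simp: locally_integrable_def)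
    then show ?thesis unfolding set_integrable_def using borel_measurable_integrable by force
  qed
  then show ?thesis
  proof (rule borel_measurable_LIMSEQ_metric)
    fix x :: 'a
    have "\<forall>\<^sub>F n in sequentially. indicator (C n) x *\<^sub>R f x = indicator D x *\<^sub>R f x"
    proof (cases "x \<in> D")
      case True
      then obtain N where "\<forall>n\<ge>N. {x} \<subseteq> C n" using C(5)[of "{x}"] by auto
      then have "indicator (C n) x = (indicator D x :: real)" if "n \<ge> N" for n
        using True that by simp
      then show ?thesis unfolding eventually_sequentially by metis
    next
      case False
      then have "x \<notin> C n" for n using C(2) by blast
      then show ?thesis using False by simp
    qed
    then show "(\<lambda>n. indicator (C n) x *\<^sub>R f x) \<longlonglongrightarrow> indicator D x *\<^sub>R f x"
      by (rule tendsto_eventually)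
  qed
qed

lemma locally_integrable_add:
  "locally_integrable D f \<Longrightarrow> locally_integrable D g \<Longrightarrow> locally_integrable D (\<lambda>x. f x + g x)"
  unfolding locally_integrable_def by (blast intro: set_integral_add(1))

lemma locally_integrable_scaleR:
  "locally_integrable D f \<Longrightarrow> locally_integrable D (\<lambda>x. c *\<^sub>R f x)"
  unfolding locally_integrable_def by (blast intro: set_integrable_scaleR_right)

lemma locally_integrable_inner:
  assumes "locally_integrable D f" shows "locally_integrable D (\<lambda>x. f x \<bullet> b)"
  unfolding locally_integrable_def
proof safe
  fix K assume "compact K" "K \<subseteq> D"
  then have "integrable lborel (\<lambda>x. (indicator K x *\<^sub>R f x) \<bullet> b)"
    using assms unfolding locally_integrable_def set_integrable_def
    by (intro integrable_inner_left) auto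
  then show "set_integrable lborel K (\<lambda>x. f x \<bullet> b)"
    by (simp add: set_integrable_def)
qed

text \<open>The sets on which \<open>h\<close> integrates to zero form a Dynkin system, and the boxes are a generator of
  the Borel sets that is stable under intersections.\<close>

lemma AE_zero_if_box_integrals_zero:
  fixes h :: "'a::euclidean_space \<Rightarrow> real"
  assumes h: "integrable lborel h" and tot: "(LINT z|lborel. h z) = 0"
    and box: "\<And>a b. (LINT z:box a b|lborel. h z) = 0"
  shows "AE z in lborel. h z = 0"
proof -
  let ?G = "range (\<lambda>(a, b). box a b :: 'a set)"
  have Gs: "Int_stable ?G" by (auto simp: Int_stable_def box_Int_box)
  have Gp: "?G \<subseteq> Pow UNIV" by simp
  have sets_eq: "sets borel = sigma_sets UNIV ?G"
    by (simp add: borel_eq_box)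
  have si: "set_integrable lborel A h" if "A \<in> sets borel" for A
    unfolding set_integrable_def using h that by (intro integrable_mult_indicator) auto
  have zero: "(LINT z:A|lborel. h z) = 0" if "A \<in> sigma_sets UNIV ?G" for A
    using Gs Gp that
  proof (induction rule: sigma_sets_induct_disjoint)
    case (compl A)
    have A: "A \<in> sets borel" using compl(1) sets_eq by simp
    have "(LINT z:A \<union> (UNIV - A)|lborel. h z) = (LINT z:A|lborel. h z) + (LINT z:UNIV - A|lborel. h z)"
      using A by (intro set_integral_Un si) auto
    then show ?case using compl(2) tot by (simp add: set_lebesgue_integral_def)
  next
    case (union A)
    have "(LINT z:(\<Union>i. A i)|lborel. h z) = (\<Sum>i. (LINT z:(A i)|lborel. h z))"
    proof (rule lebesgue_integral_countable_add)
      show "A i \<in> sets lborel" for i using union(2) sets_eq by auto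
      then show "set_integrable lborel (\<Union>i. A i) h" by (intro si) auto
      show "i \<noteq> j \<Longrightarrow> A i \<inter> A j = {}" for i j using union(1) by (auto simp: disjoint_family_on_def)
    qed
    then show ?case using union(3) by simp
  qed (use box in \<open>auto simp: set_lebesgue_integral_def\<close>)
  show ?thesis
    by (rule density_unique_real[OF h integrable_zero])
      (use zero sets_eq in \<open>auto simp: set_lebesgue_integral_def\<close>)
qed

lemma AE_not_in_cbox_minus_box: "AE z in lborel. z \<notin> cbox a b - (box a b :: 'a::euclidean_space set)"
proof -
  have "cbox a b - box a b \<in> null_sets lborel"
    using negligible_frontier_interval[of a b]
    by (subst null_sets_completion_iff[symmetric]) (auto simp: negligible_iff_null_sets)
  then show ?thesis by (rule AE_not_in)
qed

lemma test_function_imp_continuous: "test_function D \<phi> \<Longrightarrow> continuous_on UNIV \<phi>"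
proof -
  assume "test_function D \<phi>"
  then have "Ck 0 \<phi>" unfolding test_function_def smooth_def by blast
  then show ?thesis by simp
qed

text \<open>Box bumps increase to the indicator of a box, so that dominated convergence passes from test
  functions to integrals over boxes, and countably many closed boxes cover the open set.\<close>

lemma fundamental_lemma_calculus_of_variations:
  fixes h :: "'a::euclidean_space \<Rightarrow> real"
  assumes D: "open D" and h: "locally_integrable D h"
    and zero: "\<And>\<phi>. test_function D \<phi> \<Longrightarrow> (LINT z:D|lborel. h z * \<phi> z) = 0"
  shows "AE z in lborel. z \<in> D \<longrightarrow> h z = 0"
proof -
  have box0: "(LINT z:box a b|lborel. h z) = 0" if ab: "cbox a b \<subseteq> D" for a b
  proof -
    have hi: "integrable lborel (\<lambda>z. indicator (cbox a b) z * h z)"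
      using h ab by (auto simp: locally_integrable_def set_integrable_def)
    then have hm: "(\<lambda>z. indicator (cbox a b) z * h z) \<in> borel_measurable borel" by auto
    have eq: "indicator D z * (h z * box_bump a b k z)
        = indicator (cbox a b) z * h z * box_bump a b k z" for z k
      using ab box_bump_eq_0[of z a b k] box_subset_cbox[of a b]
      by (auto simp: indicator_def)
    have [measurable]: "box_bump a b k \<in> borel_measurable borel" for k
      using test_function_imp_continuous[OF test_function_box_bump[OF ab]]
      by (rule borel_measurable_continuous_onI)
    have "(\<lambda>k. LINT z|lborel. indicator (cbox a b) z * h z * box_bump a b k z)
        \<longlonglongrightarrow> (LINT z|lborel. indicator (cbox a b) z * h z * indicator (box a b) z)"
    proof (rule integral_dominated_convergence[where w="\<lambda>z. \<bar>indicator (cbox a b) z * h z\<bar>"])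
      show "AE z in lborel. norm (indicator (cbox a b) z * h z * box_bump a b k z)
          \<le> \<bar>indicator (cbox a b) z * h z\<bar>" for k
        using box_bump_bounds[of a b k] by (auto simp: abs_mult intro!: mult_left_le)
      show "AE z in lborel. (\<lambda>k. indicator (cbox a b) z * h z * box_bump a b k z)
          \<longlonglongrightarrow> indicator (cbox a b) z * h z * indicator (box a b) z"
        by (intro AE_I2 tendsto_intros box_bump_tendsto)
    qed (use hi hm in auto)
    moreover have "(LINT z|lborel. indicator (cbox a b) z * h z * box_bump a b k z) = 0" for k
      using zero[OF test_function_box_bump[OF ab], of k] by (simp add: set_lebesgue_integral_def eq)
    ultimately have "(LINT z|lborel. indicator (cbox a b) z * h z * indicator (box a b) z) = 0"
      by (simp add: LIMSEQ_const_iff)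
    moreover have "indicator (cbox a b) z * h z * indicator (box a b) z = indicator (box a b) z * h z" for z
      using box_subset_cbox[of a b] by (auto simp: indicator_def)
    ultimately show ?thesis by (simp add: set_lebesgue_integral_def)
  qed
  have local: "AE z in lborel. z \<in> cbox c d \<longrightarrow> h z = 0" if cd: "cbox c d \<subseteq> D" for c d
  proof -
    have hi: "integrable lborel (\<lambda>z. indicator (cbox c d) z * h z)"
      using h cd by (auto simp: locally_integrable_def set_integrable_def)
    have hm: "(\<lambda>z. indicator (cbox c d) z * h z) \<in> borel_measurable lborel"
      using hi by (rule borel_measurable_integrable)
    have int0: "(LINT z|lborel. indicator A z * (indicator (cbox c d) z * h z)) = 0"
      if A: "A \<inter> box c d = box a' b'" "(LINT z:box a' b'|lborel. h z) = 0" "A \<in> sets borel" for A a' b'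
    proof -
      have hm2: "(\<lambda>z. indicator (box c d) z * (indicator (cbox c d) z * h z)) \<in> borel_measurable lborel"
        by (intro borel_measurable_times borel_measurable_indicator hm) simp
      have A': "A \<in> sets lborel" using A(3) by simp
      have "(LINT z|lborel. indicator A z * (indicator (cbox c d) z * h z))
          = (LINT z|lborel. indicator A z * (indicator (box c d) z * (indicator (cbox c d) z * h z)))"
      proof (rule integral_cong_AE)
        show "AE z in lborel. indicator A z * (indicator (cbox c d) z * h z)
            = indicator A z * (indicator (box c d) z * (indicator (cbox c d) z * h z))"
          using AE_not_in_cbox_minus_box[of c d] by eventually_elim (auto simp: indicator_def)
      qed (intro borel_measurable_times borel_measurable_indicator hm hm2 A')+
      also have "\<dots> = (LINT z|lborel. indicator (box a' b') z * h z)"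
        unfolding A(1)[symmetric]
        by (rule Bochner_Integration.integral_cong) (use box_subset_cbox[of c d] in \<open>auto simp: indicator_def\<close>)
      finally show ?thesis using A(2) by (simp add: set_lebesgue_integral_def)
    qed
    have "AE z in lborel. indicator (cbox c d) z * h z = 0"
    proof (rule AE_zero_if_box_integrals_zero[OF hi])
      show "(LINT z|lborel. indicator (cbox c d) z * h z) = 0"
        using int0[of UNIV c d] box0[OF cd] by simp
      show "(LINT z:box a b|lborel. indicator (cbox c d) z * h z) = 0" for a b
      proof -
        obtain a' b' where ab': "box a b \<inter> box c d = box a' b'" using box_Int_box[of a b c d] by blast
        have "(LINT z:box a' b'|lborel. h z) = 0"
        proof (cases "box a' b' = {}")
          case True
          then show ?thesis by (simp add: set_lebesgue_integral_def)
        next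
          case False
          then have "cbox a' b' = closure (box a' b')" by (rule closure_box[symmetric])
          also have "\<dots> \<subseteq> cbox c d"
            using ab' box_subset_cbox[of c d] by (intro closure_minimal closed_cbox) blast
          finally show ?thesis using cd by (intro box0) blast
        qed
        then show ?thesis
          using int0[OF ab'] by (simp add: set_lebesgue_integral_def)
      qed
    qed
    then show ?thesis by eventually_elim (auto simp: indicator_def split: if_splits)
  qed
  obtain \<D> where \<D>: "countable \<D>" "\<D> \<subseteq> Pow D" "\<And>X. X \<in> \<D> \<Longrightarrow> \<exists>a b. X = cbox a b" "\<Union>\<D> = D"
    using open_countable_Union_open_cbox[OF D] by blast
  have "AE z in lborel. \<forall>X\<in>\<D>. z \<in> X \<longrightarrow> h z = 0"
    unfolding AE_ball_countable[OF \<D>(1)] using \<D>(2,3) local by blast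
  then show ?thesis by eventually_elim (use \<D>(4) in auto)
qed

lemma test_function_supportE:
  assumes "test_function D \<phi>"
  obtains K where "compact K" "K \<subseteq> D" "\<And>z. z \<notin> K \<Longrightarrow> \<phi> z = 0"
    "\<And>z v. z \<notin> K \<Longrightarrow> frechet_derivative \<phi> (at z) v = 0"
proof -
  define K where "K = closure {z. \<phi> z \<noteq> 0}"
  have K: "compact K" "K \<subseteq> D" using assms by (auto simp: test_function_def K_def)
  have zero: "\<phi> z = 0" if "z \<notin> K" for z
    using that closure_subset[of "{z. \<phi> z \<noteq> 0}"] unfolding K_def by blast
  have "frechet_derivative \<phi> (at z) v = 0" if z: "z \<notin> K" for z v
  proof -
    have "(\<phi> has_derivative (\<lambda>v. 0)) (at z)"
    proof (rule has_derivative_transform_within_open)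
      show "((\<lambda>_. 0) has_derivative (\<lambda>v. 0)) (at z)" by simp
      show "open (- K)" using K(1) by (simp add: compact_imp_closed open_Compl)
      show "z \<in> - K" using z by simp
      show "0 = \<phi> y" if "y \<in> - K" for y using zero[of y] that by simp
    qed
    from frechet_derivative_at[OF this] show ?thesis by metis
  qed
  then show ?thesis using K zero that by blast
qed

lemma test_function_has_derivative:
  "test_function D \<phi> \<Longrightarrow> (\<phi> has_derivative frechet_derivative \<phi> (at z)) (at z)"
proof -
  assume "test_function D \<phi>"
  then have "Ck (Suc 0) \<phi>" unfolding test_function_def smooth_def by blast
  then show ?thesis by (rule Ck_has_derivative)
qed

lemma test_function_continuous_derivative:
  assumes "test_function D \<phi>" shows "continuous_on UNIV (\<lambda>z. frechet_derivative \<phi> (at z) v)"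
proof -
  have "Ck (Suc 0) \<phi>" using assms by (simp add: test_function_def smooth_def del: Ck.simps)
  then show ?thesis by simp
qed

text \<open>Integrals against continuous functions of compact support are insensitive to the values off
  the support, and continuous for convergence in \<open>L\<^sup>1\<close> on compact sets.\<close>

lemma set_integrable_times_compact_support:
  fixes f :: "'a::euclidean_space \<Rightarrow> real"
  assumes f: "locally_integrable D f" and K: "compact K" "K \<subseteq> D"
    and \<psi>: "continuous_on UNIV \<psi>" "\<And>z. z \<notin> K \<Longrightarrow> \<psi> z = 0"
  shows "set_integrable lborel D (\<lambda>z. f z * \<psi> z)"
proof -
  have "bounded (\<psi> ` K)"
    by (intro compact_imp_bounded compact_continuous_image continuous_on_subset[OF \<psi>(1)] K(1)) simp
  then obtain M where "\<forall>x\<in>\<psi> ` K. norm x \<le> M" unfolding bounded_iff by blast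
  then have M: "norm (\<psi> z) \<le> \<bar>M\<bar>" if "z \<in> K" for z using that by force
  have fi: "integrable lborel (\<lambda>z. indicator K z * f z)"
    using f K by (auto simp: locally_integrable_def set_integrable_def)
  have [measurable]: "\<psi> \<in> borel_measurable borel" using \<psi>(1) by (rule borel_measurable_continuous_onI)
  have "integrable lborel (\<lambda>z. indicator K z * f z * \<psi> z)"
  proof (rule Bochner_Integration.integrable_bound[OF integrable_mult_left[OF fi, of M]])
    show "AE z in lborel. norm (indicator K z * f z * \<psi> z) \<le> norm (indicator K z * f z * M)"
      using M by (intro AE_I2) (auto simp: abs_mult indicator_def intro!: mult_left_mono)
  qed (use fi in auto)
  moreover have "indicator K z * f z * \<psi> z = indicator D z * (f z * \<psi> z)" for z
    using K(2) \<psi>(2) by (auto simp: indicator_def)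
  ultimately show ?thesis by (simp add: set_integrable_def)
qed

lemma set_integral_times_compact_support_tendsto:
  fixes f :: "'a::euclidean_space \<Rightarrow> real"
  assumes f: "\<And>n. locally_integrable D (F n)" "locally_integrable D f" and K: "compact K" "K \<subseteq> D"
    and \<psi>: "continuous_on UNIV \<psi>" "\<And>z. z \<notin> K \<Longrightarrow> \<psi> z = 0"
    and lim: "(\<lambda>n. \<integral>\<^sup>+z\<in>K. ennreal \<bar>F n z - f z\<bar> \<partial>lborel) \<longlonglongrightarrow> 0"
  shows "(\<lambda>n. LINT z:D|lborel. F n z * \<psi> z) \<longlonglongrightarrow> (LINT z:D|lborel. f z * \<psi> z)"
  unfolding set_lebesgue_integral_def
proof (rule tendsto_L1_int)
  show "integrable lborel (\<lambda>z. indicator D z *\<^sub>R (F n z * \<psi> z))" for n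
    using set_integrable_times_compact_support[OF f(1) K \<psi>] by (simp add: set_integrable_def)
  show "integrable lborel (\<lambda>z. indicator D z *\<^sub>R (f z * \<psi> z))"
    using set_integrable_times_compact_support[OF f(2) K \<psi>] by (simp add: set_integrable_def)
  have "bounded (\<psi> ` K)"
    by (intro compact_imp_bounded compact_continuous_image continuous_on_subset[OF \<psi>(1)] K(1)) simp
  then obtain M where "\<forall>x\<in>\<psi> ` K. norm x \<le> M" unfolding bounded_iff by blast
  then have M: "norm (\<psi> z) \<le> \<bar>M\<bar>" if "z \<in> K" for z using that by force
  have m: "(\<lambda>z. ennreal \<bar>F n z - f z\<bar> * indicator K z) \<in> borel_measurable lborel" for n
  proof -
    have "set_integrable lborel K (F n)" "set_integrable lborel K f"
      using f K by (auto simp: locally_integrable_def)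
    then have "integrable lborel (\<lambda>z. \<bar>indicator K z *\<^sub>R F n z - indicator K z *\<^sub>R f z\<bar>)"
      by (intro integrable_abs Bochner_Integration.integrable_diff) (auto simp: set_integrable_def)
    then have "(\<lambda>z. ennreal \<bar>indicator K z *\<^sub>R F n z - indicator K z *\<^sub>R f z\<bar>) \<in> borel_measurable lborel"
      by auto
    moreover have "ennreal \<bar>indicator K z *\<^sub>R F n z - indicator K z *\<^sub>R f z\<bar>
        = ennreal \<bar>F n z - f z\<bar> * indicator K z" for z
      by (auto simp: indicator_def)
    ultimately show ?thesis by (simp only:)
  qed
  have "(\<integral>\<^sup>+z. ennreal (norm (indicator D z *\<^sub>R (F n z * \<psi> z) - indicator D z *\<^sub>R (f z * \<psi> z))) \<partial>lborel)
      \<le> ennreal \<bar>M\<bar> * (\<integral>\<^sup>+z\<in>K. ennreal \<bar>F n z - f z\<bar> \<partial>lborel)" for n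
  proof -
    have "ennreal (norm (indicator D z *\<^sub>R (F n z * \<psi> z) - indicator D z *\<^sub>R (f z * \<psi> z)))
        \<le> ennreal \<bar>M\<bar> * (ennreal \<bar>F n z - f z\<bar> * indicator K z)" for z
    proof (cases "z \<in> K")
      case True
      have "norm (F n z * \<psi> z - f z * \<psi> z) = \<bar>F n z - f z\<bar> * norm (\<psi> z)"
        by (simp add: left_diff_distrib[symmetric] abs_mult)
      also have "\<dots> \<le> \<bar>M\<bar> * \<bar>F n z - f z\<bar>"
        using mult_left_mono[OF M[OF True], of "\<bar>F n z - f z\<bar>"] by (simp add: mult.commute)
      finally show ?thesis
        using True K(2) M[OF True] by (auto simp: indicator_def ennreal_mult'[symmetric] ennreal_leI)
    qed (use \<psi>(2) in auto)
    then show ?thesis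
      by (subst nn_integral_cmult[OF m, symmetric]) (rule nn_integral_mono)
  qed
  note bound = this
  have "(\<lambda>n. ennreal \<bar>M\<bar> * (\<integral>\<^sup>+z\<in>K. ennreal \<bar>F n z - f z\<bar> \<partial>lborel)) \<longlonglongrightarrow> ennreal \<bar>M\<bar> * 0"
    using lim by (intro ennreal_tendsto_cmult) auto
  then have "(\<lambda>n. ennreal \<bar>M\<bar> * (\<integral>\<^sup>+z\<in>K. ennreal \<bar>F n z - f z\<bar> \<partial>lborel)) \<longlonglongrightarrow> 0" by simp
  from always_eventually[OF allI[OF zero_le]] always_eventually[OF allI[OF bound]] tendsto_const this
  show "(\<lambda>n. \<integral>\<^sup>+z. ennreal (norm (indicator D z *\<^sub>R (F n z * \<psi> z)
      - indicator D z *\<^sub>R (f z * \<psi> z))) \<partial>lborel) \<longlonglongrightarrow> 0"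
    by (rule tendsto_sandwich)
qed

lemma has_weak_gradient_integrable:
  assumes "has_weak_gradient D U G" "test_function D \<phi>"
  shows "set_integrable lborel D (\<lambda>z. (G z \<bullet> b) * \<phi> z)"
    and "set_integrable lborel D (\<lambda>z. U z * frechet_derivative \<phi> (at z) b)"
proof -
  obtain K where K: "compact K" "K \<subseteq> D" "\<And>z. z \<notin> K \<Longrightarrow> \<phi> z = 0"
    "\<And>z v. z \<notin> K \<Longrightarrow> frechet_derivative \<phi> (at z) v = 0"
    using test_function_supportE[OF assms(2)] by (metis (no_types, lifting))
  have l: "locally_integrable D U" "locally_integrable D G"
    using assms(1) by (auto simp: has_weak_gradient_def)
  show "set_integrable lborel D (\<lambda>z. (G z \<bullet> b) * \<phi> z)"
    by (rule set_integrable_times_compact_support[OF locally_integrable_inner[OF l(2)] K(1,2)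
          test_function_imp_continuous[OF assms(2)] K(3)])
  show "set_integrable lborel D (\<lambda>z. U z * frechet_derivative \<phi> (at z) b)"
    by (rule set_integrable_times_compact_support[OF l(1) K(1,2)
          test_function_continuous_derivative[OF assms(2)] K(4)])
qed

lemma has_weak_gradient_unique:
  assumes D: "open D" and G: "has_weak_gradient D U G" and G': "has_weak_gradient D U' G'"
    and U: "AE z in lborel. z \<in> D \<longrightarrow> U z = U' z"
  shows "AE z in lborel. z \<in> D \<longrightarrow> G z = G' z"
proof -
  have int: "set_integrable lborel D (\<lambda>z. (H z \<bullet> b) * \<phi> z)"
    if "has_weak_gradient D V H" "test_function D \<phi>" for V H b \<phi>
    by (rule has_weak_gradient_integrable(1)[OF that])
  have "AE z in lborel. z \<in> D \<longrightarrow> G z \<bullet> b + - (G' z \<bullet> b) = 0" if b: "b \<in> Basis" for b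
  proof (rule fundamental_lemma_calculus_of_variations[OF D])
    show "locally_integrable D (\<lambda>z. G z \<bullet> b + - (G' z \<bullet> b))"
      using G G' locally_integrable_scaleR[of D "\<lambda>z. G' z \<bullet> b" "-1"]
      by (intro locally_integrable_add locally_integrable_inner)
        (auto simp: has_weak_gradient_def locally_integrable_inner)
    fix \<phi> assume \<phi>: "test_function D \<phi>"
    have "(LINT z:D|lborel. (G z \<bullet> b) * \<phi> z) = - (LINT z:D|lborel. U z * frechet_derivative \<phi> (at z) b)"
      using G \<phi> b by (simp add: has_weak_gradient_def)
    also have "(LINT z:D|lborel. U z * frechet_derivative \<phi> (at z) b)
        = (LINT z:D|lborel. U' z * frechet_derivative \<phi> (at z) b)"
      unfolding set_lebesgue_integral_def
    proof (rule integral_cong_AE)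
      show "(\<lambda>z. indicator D z *\<^sub>R (U z * frechet_derivative \<phi> (at z) b)) \<in> borel_measurable lborel"
        "(\<lambda>z. indicator D z *\<^sub>R (U' z * frechet_derivative \<phi> (at z) b)) \<in> borel_measurable lborel"
        using has_weak_gradient_integrable(2)[OF G \<phi>] has_weak_gradient_integrable(2)[OF G' \<phi>]
        unfolding set_integrable_def by blast+
    qed (use U in \<open>auto elim!: AE_mp simp: indicator_def\<close>)
    also have "- \<dots> = (LINT z:D|lborel. (G' z \<bullet> b) * \<phi> z)"
      using G' \<phi> b by (simp add: has_weak_gradient_def)
    finally show "(LINT z:D|lborel. (G z \<bullet> b + - (G' z \<bullet> b)) * \<phi> z) = 0"
      using set_integral_diff(2)[OF int[OF G \<phi>, of b] int[OF G' \<phi>, of b]]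
      by (simp add: left_diff_distrib)
  qed
  then have "AE z in lborel. \<forall>b\<in>Basis. z \<in> D \<longrightarrow> G z \<bullet> b + - (G' z \<bullet> b) = 0"
    by (subst AE_ball_countable) (auto intro: countable_finite)
  then show ?thesis by eventually_elim (auto intro: euclidean_eqI)
qed

lemma has_weak_gradient_weak_grad:
  "has_weak_gradient D U G \<Longrightarrow> has_weak_gradient D U (weak_grad D U)"
  unfolding weak_grad_def by (rule someI[of "has_weak_gradient D U"])

lemma has_weak_gradient_linear:
  assumes U: "has_weak_gradient D U G" and V: "has_weak_gradient D V H"
  shows "has_weak_gradient D (\<lambda>z. U z + t * V z) (\<lambda>z. G z + t *\<^sub>R H z)"
  unfolding has_weak_gradient_def
proof (intro conjI allI impI ballI)
  show "locally_integrable D (\<lambda>z. U z + t * V z)" "locally_integrable D (\<lambda>z. G z + t *\<^sub>R H z)"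
    using U V locally_integrable_scaleR[of D V t] locally_integrable_scaleR[of D H t]
    by (auto simp: has_weak_gradient_def intro!: locally_integrable_add)
  fix \<phi> and b :: 'a assume \<phi>: "test_function D \<phi>" and b: "b \<in> Basis"
  have int: "set_integrable lborel D (\<lambda>z. (H z \<bullet> b) * \<phi> z)"
    "set_integrable lborel D (\<lambda>z. V z * frechet_derivative \<phi> (at z) b)"
    if "has_weak_gradient D V H" for V H
    by (rule has_weak_gradient_integrable[OF that \<phi>])+
  have "(LINT z:D|lborel. (U z + t * V z) * frechet_derivative \<phi> (at z) b)
      = (LINT z:D|lborel. U z * frechet_derivative \<phi> (at z) b + t * (V z * frechet_derivative \<phi> (at z) b))"
    by (simp add: algebra_simps)
  also have "\<dots> = - (LINT z:D|lborel. (G z \<bullet> b) * \<phi> z) + t * - (LINT z:D|lborel. (H z \<bullet> b) * \<phi> z)"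
    using U V \<phi> b by (subst set_integral_add) (auto simp: int[OF U] int[OF V] has_weak_gradient_def)
  also have "\<dots> = - ((LINT z:D|lborel. (G z \<bullet> b) * \<phi> z) + (LINT z:D|lborel. t * ((H z \<bullet> b) * \<phi> z)))"
    by simp
  also have "\<dots> = - (LINT z:D|lborel. ((G z + t *\<^sub>R H z) \<bullet> b) * \<phi> z)"
    by (subst set_integral_add(2)[symmetric]) (auto simp: int[OF U] int[OF V] inner_add_left distrib_right mult.assoc)
  finally show "(LINT z:D|lborel. (U z + t * V z) * frechet_derivative \<phi> (at z) b)
      = - (LINT z:D|lborel. ((G z + t *\<^sub>R H z) \<bullet> b) * \<phi> z)" .
qed

text \<open>Weak gradients are closed under \<open>L\<^sup>1\<close> convergence on compact sets, since the defining identity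
  only involves integrals against continuous functions of compact support.\<close>

lemma has_weak_gradient_limit:
  assumes n: "\<And>n. has_weak_gradient D (U n) (G n)"
    and lim: "locally_integrable D V" "locally_integrable D H"
    and U: "\<And>K. compact K \<Longrightarrow> K \<subseteq> D \<Longrightarrow> (\<lambda>n. \<integral>\<^sup>+z\<in>K. ennreal \<bar>U n z - V z\<bar> \<partial>lborel) \<longlonglongrightarrow> 0"
    and G: "\<And>K b. compact K \<Longrightarrow> K \<subseteq> D \<Longrightarrow> b \<in> Basis \<Longrightarrow>
      (\<lambda>n. \<integral>\<^sup>+z\<in>K. ennreal \<bar>G n z \<bullet> b - H z \<bullet> b\<bar> \<partial>lborel) \<longlonglongrightarrow> 0"
  shows "has_weak_gradient D V H"
  unfolding has_weak_gradient_def
proof (intro conjI allI impI ballI lim)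
  fix \<phi> and b :: 'a assume \<phi>: "test_function D \<phi>" and b: "b \<in> Basis"
  obtain K where K: "compact K" "K \<subseteq> D" "\<And>z. z \<notin> K \<Longrightarrow> \<phi> z = 0"
    "\<And>z v. z \<notin> K \<Longrightarrow> frechet_derivative \<phi> (at z) v = 0"
    using test_function_supportE[OF \<phi>] by (metis (no_types, lifting))
  have "(\<lambda>n. LINT z:D|lborel. U n z * frechet_derivative \<phi> (at z) b)
      \<longlonglongrightarrow> (LINT z:D|lborel. V z * frechet_derivative \<phi> (at z) b)"
    using n by (intro set_integral_times_compact_support_tendsto[OF _ lim(1) K(1,2)
        test_function_continuous_derivative[OF \<phi>] K(4) U[OF K(1,2)]]) (auto simp: has_weak_gradient_def)
  moreover have "(\<lambda>n. - (LINT z:D|lborel. (G n z \<bullet> b) * \<phi> z)) \<longlonglongrightarrow> - (LINT z:D|lborel. (H z \<bullet> b) * \<phi> z)"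
    using n by (intro tendsto_minus set_integral_times_compact_support_tendsto[OF _
        locally_integrable_inner[OF lim(2)] K(1,2)
        test_function_imp_continuous[OF \<phi>] K(3) G[OF K(1,2) b]] locally_integrable_inner)
      (auto simp: has_weak_gradient_def)
  moreover have "(LINT z:D|lborel. U n z * frechet_derivative \<phi> (at z) b)
      = - (LINT z:D|lborel. (G n z \<bullet> b) * \<phi> z)" for n
    using n \<phi> b by (auto simp: has_weak_gradient_def)
  ultimately show "(LINT z:D|lborel. V z * frechet_derivative \<phi> (at z) b)
      = - (LINT z:D|lborel. (H z \<bullet> b) * \<phi> z)"
    using LIMSEQ_unique by auto
qed

section \<open>Weak gradients along dilations\<close>

text \<open>The identity of this section replaces the fundamental theorem of calculus on lines. Dilating
  the coordinates in \<open>B\<close> is a linear map of \<open>z\<close> for each factor \<open>m\<close>, and \<open>axis_proj B z\<close> is the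
  velocity of the dilated point as \<open>m\<close> varies.\<close>

definition axis_proj :: "'a::euclidean_space set \<Rightarrow> 'a \<Rightarrow> 'a" where
  "axis_proj B z = (\<Sum>b\<in>B. (z \<bullet> b) *\<^sub>R b)"

definition dilate :: "'a::euclidean_space set \<Rightarrow> real \<Rightarrow> 'a \<Rightarrow> 'a" where
  "dilate B m z = z + (m - 1) *\<^sub>R axis_proj B z"

lemma bounded_linear_axis_proj: "bounded_linear (axis_proj B)"
  unfolding axis_proj_def[abs_def]
  by (intro bounded_linear_sum bounded_linear_scaleR_const bounded_linear_inner_left)

lemma bounded_linear_dilate: "bounded_linear (dilate B m)"
  unfolding dilate_def[abs_def]
  by (rule bounded_linear_add[OF bounded_linear_ident
        bounded_linear_const_scaleR[OF bounded_linear_axis_proj]])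

lemma continuous_axis_proj [continuous_intros]:
  "continuous_on S g \<Longrightarrow> continuous_on S (\<lambda>x. axis_proj B (g x))"
  by (rule bounded_linear.continuous_on[OF bounded_linear_axis_proj])

lemma continuous_dilate [continuous_intros]:
  assumes "continuous_on S f" "continuous_on S g"
  shows "continuous_on S (\<lambda>x. dilate B (f x) (g x))"
  unfolding dilate_def
  by (intro continuous_intros assms)

lemma measurable_axis_proj [measurable (raw)]:
  assumes [measurable]: "g \<in> borel_measurable M"
  shows "(\<lambda>x. axis_proj B (g x)) \<in> borel_measurable M"
  unfolding axis_proj_def by measurable

lemma measurable_dilate [measurable (raw)]:
  assumes [measurable]: "f \<in> borel_measurable M" "g \<in> borel_measurable M"
  shows "(\<lambda>x. dilate B (f x) (g x)) \<in> borel_measurable M"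
  unfolding dilate_def by measurable

context
  fixes B :: "'a::euclidean_space set"
  assumes B: "B \<subseteq> Basis"
begin

lemma axis_proj_inner: "b \<in> Basis \<Longrightarrow> axis_proj B z \<bullet> b = (if b \<in> B then z \<bullet> b else 0)"
proof -
  assume b: "b \<in> Basis"
  have fin: "finite B" by (rule finite_subset[OF B finite_Basis])
  have "axis_proj B z \<bullet> b = (\<Sum>i\<in>B. if i = b then z \<bullet> b else 0)"
    unfolding axis_proj_def inner_sum_left
    by (rule sum.cong) (use B b in \<open>auto simp: inner_Basis\<close>)
  then show ?thesis using fin by simp
qed

lemma dilate_inner: "b \<in> Basis \<Longrightarrow> dilate B m z \<bullet> b = (if b \<in> B then m else 1) * (z \<bullet> b)"
  by (simp add: dilate_def axis_proj_inner inner_add_left algebra_simps)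

lemma dilate_dilate: "dilate B m (dilate B m' z) = dilate B (m * m') z"
  by (rule euclidean_eqI) (simp add: dilate_inner)

lemma dilate_1: "dilate B 1 z = z"
  by (simp add: dilate_def)

lemma axis_proj_dilate: "axis_proj B (dilate B m z) = m *\<^sub>R axis_proj B z"
  by (rule euclidean_eqI) (simp add: dilate_inner axis_proj_inner)

lemma lborel_dilate:
  assumes "m > 0"
  shows "lborel = density (distr lborel borel (dilate B m)) (\<lambda>_. ennreal (m ^ card B))"
proof -
  have fin: "finite B" by (rule finite_subset[OF B finite_Basis])
  have "(0 + (\<Sum>j\<in>Basis. ((if j \<in> B then m else 1) * (z \<bullet> j)) *\<^sub>R j)) = dilate B m z" for z
    by (rule euclidean_eqI) (simp add: dilate_inner inner_sum_left inner_Basis if_distrib cong: if_cong)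
  moreover have "(\<Prod>j\<in>Basis. \<bar>if j \<in> B then m else 1\<bar>) = m ^ card B"
    using assms fin B by (simp add: if_distrib[of abs] prod.If_cases Int_absorb1 cong: if_cong)
  ultimately show ?thesis
    using lborel_affine_euclidean[of "\<lambda>j. if j \<in> B then m else 1" 0] assms by (simp cong: if_cong)
qed

lemma nn_integral_dilate:
  assumes "m > 0" and [measurable]: "f \<in> borel_measurable borel"
  shows "(\<integral>\<^sup>+z. f z \<partial>lborel) = ennreal (m ^ card B) * (\<integral>\<^sup>+z. f (dilate B m z) \<partial>lborel)"
  by (subst lborel_dilate[OF assms(1)])
    (simp add: nn_integral_density nn_integral_distr nn_integral_cmult)

lemma integrable_dilate:
  fixes f :: "'a \<Rightarrow> real"
  assumes "m > 0" and f: "integrable lborel f"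
  shows "integrable lborel (\<lambda>z. f (dilate B m z))"
proof -
  have [measurable]: "f \<in> borel_measurable borel" using f by auto
  have "(\<integral>\<^sup>+z. ennreal \<bar>f z\<bar> \<partial>lborel) < \<infinity>"
    using f by (auto simp: integrable_iff_bounded)
  then have "(\<integral>\<^sup>+z. ennreal \<bar>f (dilate B m z)\<bar> \<partial>lborel) < \<infinity>"
    using assms(1) by (subst (asm) nn_integral_dilate[OF assms(1)]) (auto simp: ennreal_mult_less_top)
  then show ?thesis by (intro integrableI_bounded) auto
qed

lemma integral_dilate:
  fixes f :: "'a \<Rightarrow> real"
  assumes "m > 0" and [measurable]: "f \<in> borel_measurable borel"
  shows "(LINT z|lborel. f z) = m ^ card B * (LINT z|lborel. f (dilate B m z))"
proof -
  have "(LINT z|lborel. f z) = (LINT z|density (distr lborel borel (dilate B m)) (\<lambda>_. ennreal (m ^ card B)). f z)"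
    using lborel_dilate[OF assms(1)] by simp
  also have "\<dots> = m ^ card B * (LINT z|lborel. f (dilate B m z))"
    using assms(1) by (subst integral_density) (auto simp: integral_distr)
  finally show ?thesis .
qed

end

lemma test_functionI:
  assumes "smooth \<phi>" "compact K" "K \<subseteq> D" "\<And>z. z \<notin> K \<Longrightarrow> \<phi> z = 0"
  shows "test_function D \<phi>"
proof -
  have "{z. \<phi> z \<noteq> 0} \<subseteq> K" using assms(4) by blast
  then have *: "closure {z. \<phi> z \<noteq> 0} \<subseteq> K"
    by (rule closure_minimal[OF _ compact_imp_closed[OF assms(2)]])
  have "compact (K \<inter> closure {z. \<phi> z \<noteq> 0})"
    by (rule compact_Int_closed[OF assms(2) closed_closure])
  then have "compact (closure {z. \<phi> z \<noteq> 0})"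
    using * by (simp only: Int_absorb1)
  then show ?thesis
    unfolding test_function_def using assms(1,3) * by blast
qed

lemma compact_dilate_image:
  assumes "compact K" shows "compact ((\<lambda>(m, z). dilate B m z) ` ({a..b} \<times> K))"
  by (intro compact_continuous_image compact_Times assms compact_Icc)
    (auto simp: case_prod_beta intro!: continuous_intros)

lemma nn_integral_compose_dilate_le:
  assumes B: "B \<subseteq> Basis" and m: "0 < a" "a \<le> m" and f: "f \<in> borel_measurable borel"
  shows "(\<integral>\<^sup>+z. f (dilate B m z) \<partial>lborel) \<le> ennreal (1 / a ^ card B) * (\<integral>\<^sup>+z. f z \<partial>lborel)"
proof -
  have m0: "m > 0" using m by linarith
  have "(\<integral>\<^sup>+z. f (dilate B m z) \<partial>lborel)
      = ennreal (1 / m ^ card B) * (ennreal (m ^ card B) * (\<integral>\<^sup>+z. f (dilate B m z) \<partial>lborel))"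
    using m0 by (simp add: mult.assoc[symmetric] ennreal_mult[symmetric])
  also have "\<dots> = ennreal (1 / m ^ card B) * (\<integral>\<^sup>+z. f z \<partial>lborel)"
    by (simp only: nn_integral_dilate[OF B m0 f])
  also have "\<dots> \<le> ennreal (1 / a ^ card B) * (\<integral>\<^sup>+z. f z \<partial>lborel)"
    using m m0 by (intro mult_right_mono ennreal_leI divide_left_mono power_mono) auto
  finally show ?thesis .
qed

text \<open>Fubini's theorem for the integrand of the dilation identity.\<close>

lemma integrable_along_dilations:
  fixes G :: "'a::euclidean_space \<Rightarrow> 'a"
  assumes D: "open D" and G: "locally_integrable D G" and B: "B \<subseteq> Basis" and ab: "0 < a" "a \<le> b"
    and inv: "\<And>m z. m \<in> {a..b} \<Longrightarrow> z \<in> D \<Longrightarrow> dilate B m z \<in> D"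
    and K: "compact K" "K \<subseteq> D"
  shows "integrable (lborel \<Otimes>\<^sub>M lborel) (\<lambda>(z, m). indicator K z * (indicator {a..b} m *
      ((indicator D (dilate B m z) *\<^sub>R G (dilate B m z)) \<bullet> axis_proj B z)))"
proof -
  define G0 where "G0 z = indicator D z *\<^sub>R G z" for z
  have [measurable]: "G0 \<in> borel_measurable borel"
    unfolding G0_def by (rule locally_integrable_measurable[OF D G])
  define K' where "K' = (\<lambda>(m, z). dilate B m z) ` ({a..b} \<times> K)"
  have K': "compact K'" "K' \<subseteq> D"
    unfolding K'_def using compact_dilate_image[OF K(1)] inv K(2) by auto
  have [measurable]: "K \<in> sets borel" "K' \<in> sets borel"
    using K(1) K'(1) by (simp_all add: borel_closed compact_imp_closed)
  have "bounded (axis_proj B ` K)"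
    by (intro compact_imp_bounded compact_continuous_image K(1) continuous_intros)
  then obtain M where "\<forall>x\<in>axis_proj B ` K. norm x \<le> M" unfolding bounded_iff by blast
  then have M: "norm (axis_proj B z) \<le> \<bar>M\<bar>" if "z \<in> K" for z using that by force
  have fin: "(\<integral>\<^sup>+z. ennreal (indicator K' z * norm (G0 z)) \<partial>lborel) < \<infinity>"
  proof -
    have "integrable lborel (\<lambda>z. norm (indicator K' z *\<^sub>R G z))"
      using G K' by (intro integrable_norm) (auto simp: locally_integrable_def set_integrable_def)
    moreover have "norm (indicator K' z *\<^sub>R G z) = indicator K' z * norm (G0 z)" for z
      using K'(2) by (auto simp: G0_def indicator_def)
    ultimately have "integrable lborel (\<lambda>z. indicator K' z * norm (G0 z))" by (simp only:)
    then show ?thesis by (simp add: integrable_iff_bounded)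
  qed
  define f where "f = (\<lambda>(z, m). indicator K z * (indicator {a..b} m * (G0 (dilate B m z) \<bullet> axis_proj B z)))"
  have [measurable]: "f \<in> borel_measurable (lborel \<Otimes>\<^sub>M lborel)" unfolding f_def by measurable
  have bound: "(\<integral>\<^sup>+z. ennreal (norm (f (z, m))) \<partial>lborel)
      \<le> ennreal \<bar>M\<bar> * ennreal (1 / a ^ card B) * (\<integral>\<^sup>+z. ennreal (indicator K' z * norm (G0 z)) \<partial>lborel)
        * indicator {a..b} m" for m
  proof (cases "m \<in> {a..b}")
    case True
    have "ennreal (norm (f (z, m))) \<le> ennreal \<bar>M\<bar> *
        ennreal (indicator K' (dilate B m z) * norm (G0 (dilate B m z)))" for z
    proof (cases "z \<in> K")
      case z: True
      have "dilate B m z \<in> K'" using True z by (force simp: K'_def)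
      moreover have "\<bar>G0 (dilate B m z) \<bullet> axis_proj B z\<bar> \<le> \<bar>M\<bar> * norm (G0 (dilate B m z))"
        by (rule order_trans[OF Cauchy_Schwarz_ineq2])
          (use M[OF z] in \<open>auto simp: mult.commute intro: mult_right_mono\<close>)
      ultimately show ?thesis
        using True z by (simp add: f_def ennreal_mult[symmetric] ennreal_leI)
    qed (simp add: f_def)
    then have "(\<integral>\<^sup>+z. ennreal (norm (f (z, m))) \<partial>lborel)
        \<le> (\<integral>\<^sup>+z. ennreal \<bar>M\<bar> * ennreal (indicator K' (dilate B m z) * norm (G0 (dilate B m z))) \<partial>lborel)"
      by (intro nn_integral_mono)
    also have "\<dots> = ennreal \<bar>M\<bar> * (\<integral>\<^sup>+z. ennreal (indicator K' (dilate B m z) * norm (G0 (dilate B m z))) \<partial>lborel)"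
      by (rule nn_integral_cmult) measurable
    also have "\<dots> \<le> ennreal \<bar>M\<bar> * (ennreal (1 / a ^ card B) *
        (\<integral>\<^sup>+z. ennreal (indicator K' z * norm (G0 z)) \<partial>lborel))"
      by (intro mult_left_mono nn_integral_compose_dilate_le[OF B ab(1),
            where f="\<lambda>z. ennreal (indicator K' z * norm (G0 z))"]) (use True in auto)
    finally show ?thesis using True by (simp add: mult.assoc)
  qed (simp add: f_def)
  have "(\<integral>\<^sup>+p. ennreal (norm (f p)) \<partial>(lborel \<Otimes>\<^sub>M lborel))
      = (\<integral>\<^sup>+m. \<integral>\<^sup>+z. ennreal (norm (f (z, m))) \<partial>lborel \<partial>lborel)"
    by (rule lborel_pair.nn_integral_snd[symmetric]) measurable
  also have "\<dots> \<le> (\<integral>\<^sup>+m. ennreal \<bar>M\<bar> * ennreal (1 / a ^ card B) *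
      (\<integral>\<^sup>+z. ennreal (indicator K' z * norm (G0 z)) \<partial>lborel) * indicator {a..b} m \<partial>lborel)"
    by (intro nn_integral_mono bound)
  also have "\<dots> < \<infinity>"
    using fin ab by (auto simp: nn_integral_cmult_indicator ennreal_mult_less_top)
  finally have "integrable (lborel \<Otimes>\<^sub>M lborel) f" by (intro integrableI_bounded) auto
  then show ?thesis by (simp add: f_def G0_def)
qed

text \<open>A rescaled test function, as a function of the dilation factor. The factor \<open>m\<close> is moved from
  the dilated function to the test function by the change of variables \<open>z \<mapsto> dilate B m z\<close>.\<close>

definition dilated_test :: "'a::euclidean_space set \<Rightarrow> ('a \<Rightarrow> real) \<Rightarrow> real \<Rightarrow> 'a \<Rightarrow> real" where
  "dilated_test B \<phi> m z = inverse m ^ card B * \<phi> (dilate B (inverse m) z)"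

definition dilated_test_deriv :: "'a::euclidean_space set \<Rightarrow> ('a \<Rightarrow> real) \<Rightarrow> real \<Rightarrow> 'a \<Rightarrow> real" where
  "dilated_test_deriv B \<phi> m z = - (inverse m ^ Suc (card B) *
     (real (card B) * \<phi> (dilate B (inverse m) z) + inverse m *
       (\<Sum>b\<in>B. (z \<bullet> b) * frechet_derivative \<phi> (at (dilate B (inverse m) z)) b)))"

lemma dilated_test_has_derivative:
  assumes \<phi>: "test_function D \<phi>" and m: "m > 0"
  shows "((\<lambda>m. dilated_test B \<phi> m z) has_real_derivative dilated_test_deriv B \<phi> m z) (at m)"
proof -
  let ?w = "dilate B (inverse m) z"
  let ?d = "frechet_derivative \<phi> (at ?w)"
  have lin: "linear ?d"
    using test_function_has_derivative[OF \<phi>] by (rule has_derivative_linear)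
  have "((\<lambda>m. dilate B (inverse m) z) has_derivative
      (\<lambda>h. (h * - (inverse m ^ 2)) *\<^sub>R axis_proj B z)) (at m)"
    unfolding dilate_def using m
    by (auto intro!: derivative_eq_intros simp: power2_eq_square divide_inverse)
  from has_derivative_compose[OF this test_function_has_derivative[OF \<phi>]]
  have "((\<lambda>m. \<phi> (dilate B (inverse m) z)) has_derivative
      (\<lambda>h. ?d ((h * - (inverse m ^ 2)) *\<^sub>R axis_proj B z))) (at m)" .
  moreover have "?d ((h * - (inverse m ^ 2)) *\<^sub>R axis_proj B z)
      = (- (inverse m ^ 2) * (\<Sum>b\<in>B. (z \<bullet> b) * ?d b)) * h" for h
    unfolding axis_proj_def linear_cmul[OF lin] linear_sum[OF lin] by (simp add: linear_cmul[OF lin])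
  ultimately have 1: "((\<lambda>m. \<phi> (dilate B (inverse m) z)) has_real_derivative
      - (inverse m ^ 2) * (\<Sum>b\<in>B. (z \<bullet> b) * ?d b)) (at m)"
    unfolding has_field_derivative_def by (simp only:)
  have 2: "((\<lambda>m. inverse m ^ card B) has_real_derivative
      - (real (card B) * inverse m ^ Suc (card B))) (at m)"
  proof (cases "card B")
    case (Suc k)
    show ?thesis unfolding Suc using m
      by (intro DERIV_cong[OF DERIV_power_Suc[OF DERIV_inverse]]) (auto simp: mult_ac)
  qed simp
  show ?thesis
    unfolding dilated_test_def dilated_test_deriv_def
    by (rule DERIV_cong[OF DERIV_mult[OF 2 1]]) (simp add: power2_eq_square algebra_simps)
qed

text \<open>The key step of the dilation identity. The derivative of the rescaled test function with respect
  to \<open>m\<close> is, up to the sign and a power of \<open>m\<close>, the divergence of the vector field with components \<open>(z \<bullet> b) * \<phi> (dilate B (inverse m) z)\<close>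
  for \<open>b \<in> B\<close>. Each component is a test function, so that the definition of the
  weak gradient applies, and a change of variables undoes the dilation.\<close>

lemma integral_dilated_test_deriv:
  fixes U :: "'a::euclidean_space \<Rightarrow> real"
  assumes D: "open D" and G: "has_weak_gradient D U G" and B: "B \<subseteq> Basis" and m: "0 < m"
    and inv: "\<And>z. z \<in> D \<Longrightarrow> dilate B m z \<in> D"
    and \<phi>: "test_function D \<phi>"
  shows "(LINT z|lborel. indicator D z * U z * dilated_test_deriv B \<phi> m z)
      = (LINT z|lborel. ((indicator D (dilate B m z) *\<^sub>R G (dilate B m z)) \<bullet> axis_proj B z) * \<phi> z)"
proof -
  let ?r = "inverse m"
  have fin: "finite B" by (rule finite_subset[OF B finite_Basis])
  define G0 where "G0 z = indicator D z *\<^sub>R G z" for z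
  have [measurable]: "G0 \<in> borel_measurable borel"
    unfolding G0_def using G by (intro locally_integrable_measurable[OF D]) (simp add: has_weak_gradient_def)
  have [measurable]: "\<phi> \<in> borel_measurable borel"
    using test_function_imp_continuous[OF \<phi>] by (rule borel_measurable_continuous_onI)
  obtain K where K: "compact K" "K \<subseteq> D" "\<And>z. z \<notin> K \<Longrightarrow> \<phi> z = 0"
    using test_function_supportE[OF \<phi>] by (metis (no_types, lifting))
  define \<eta> where "\<eta> b z = (z \<bullet> b) * \<phi> (dilate B ?r z)" for b z
  have \<eta>: "test_function D (\<eta> b)" for b
  proof (rule test_functionI)
    show "smooth (\<eta> b)"
      unfolding smooth_def \<eta>_def using \<phi>
      by (intro allI Ck_mult[OF Ck_linear[OF bounded_linear_inner_left]
            Ck_compose_linear[OF _ bounded_linear_dilate]])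
        (simp add: test_function_def smooth_def)
    show "compact (dilate B m ` K)"
      using K(1) by (intro compact_continuous_image continuous_intros)
    show "dilate B m ` K \<subseteq> D" using K(2) inv by blast
    show "\<eta> b z = 0" if "z \<notin> dilate B m ` K" for z
    proof -
      have "dilate B m (dilate B ?r z) = z" using m by (simp add: dilate_dilate[OF B] dilate_1[OF B])
      then have "dilate B ?r z \<notin> K" using that by (metis imageI)
      then show ?thesis using K(3) by (simp add: \<eta>_def)
    qed
  qed
  have D\<eta>: "frechet_derivative (\<eta> b) (at z) b
      = \<phi> (dilate B ?r z) + (z \<bullet> b) * (?r * frechet_derivative \<phi> (at (dilate B ?r z)) b)" if b: "b \<in> B" for b z
  proof -
    let ?d = "frechet_derivative \<phi> (at (dilate B ?r z))"
    have lin: "linear ?d"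
      using test_function_has_derivative[OF \<phi>] by (rule has_derivative_linear)
    have "((\<lambda>z. \<phi> (dilate B ?r z)) has_derivative (\<lambda>v. ?d (dilate B ?r v))) (at z)"
      by (rule has_derivative_compose[OF bounded_linear_imp_has_derivative[OF bounded_linear_dilate]
            test_function_has_derivative[OF \<phi>]])
    then have "(\<eta> b has_derivative (\<lambda>v. (z \<bullet> b) * ?d (dilate B ?r v) + (v \<bullet> b) * \<phi> (dilate B ?r z))) (at z)"
      unfolding \<eta>_def
      by (rule has_derivative_mult[OF bounded_linear_imp_has_derivative[OF bounded_linear_inner_left]])
    from frechet_derivative_at[OF this] have "frechet_derivative (\<eta> b) (at z) b
      = (z \<bullet> b) * ?d (dilate B ?r b) + (b \<bullet> b) * \<phi> (dilate B ?r z)" by metis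
    moreover have bB: "b \<in> Basis" by (rule subsetD[OF B b])
    have "dilate B ?r b \<bullet> i = (?r *\<^sub>R b) \<bullet> i" if i: "i \<in> Basis" for i
      using b by (cases "i = b") (simp_all add: dilate_inner[OF B i] dilate_inner[OF B bB] inner_not_same_Basis[OF bB i])
    then have "dilate B ?r b = ?r *\<^sub>R b" by (rule euclidean_eqI)
    moreover have "b \<bullet> b = 1" by (rule inner_same_Basis[OF bB])
    ultimately show ?thesis by (simp add: linear_cmul[OF lin])
  qed
  have deriv: "dilated_test_deriv B \<phi> m z = - (?r ^ Suc (card B)) * (\<Sum>b\<in>B. frechet_derivative (\<eta> b) (at z) b)" for z
    unfolding dilated_test_deriv_def
    by (simp add: D\<eta> sum.distrib sum_distrib_left mult.left_commute cong: sum.cong)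
  have int: "integrable lborel (\<lambda>z. indicator D z * U z * frechet_derivative (\<eta> b) (at z) b)"
      "integrable lborel (\<lambda>z. (G0 z \<bullet> b) * \<eta> b z)" for b
    using has_weak_gradient_integrable[OF G \<eta>, of b b]
    by (simp_all add: set_integrable_def G0_def mult.assoc)
  have "(LINT z|lborel. indicator D z * U z * dilated_test_deriv B \<phi> m z)
      = (LINT z|lborel. - (?r ^ Suc (card B)) * (\<Sum>b\<in>B. indicator D z * U z * frechet_derivative (\<eta> b) (at z) b))"
    unfolding deriv by (simp add: sum_distrib_left mult_ac)
  also have "\<dots> = - (?r ^ Suc (card B)) * (\<Sum>b\<in>B. LINT z|lborel. indicator D z * U z * frechet_derivative (\<eta> b) (at z) b)"
    by (simp add: int)
  also have "\<dots> = - (?r ^ Suc (card B)) * (\<Sum>b\<in>B. - (LINT z|lborel. (G0 z \<bullet> b) * \<eta> b z))"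
    using G B \<eta> by (auto simp: has_weak_gradient_def set_lebesgue_integral_def G0_def mult.assoc subset_iff
        intro!: sum.cong)
  also have "\<dots> = (LINT z|lborel. ?r ^ Suc (card B) * (\<Sum>b\<in>B. (G0 z \<bullet> b) * \<eta> b z))"
    by (simp add: int sum_negf)
  also have "\<dots> = (LINT z|lborel. ?r ^ Suc (card B) * (G0 z \<bullet> axis_proj B z) * \<phi> (dilate B ?r z))"
    by (simp add: axis_proj_def inner_sum_right \<eta>_def sum_distrib_left sum_distrib_right mult_ac)
  also have "\<dots> = m ^ card B * (LINT z|lborel. ?r ^ Suc (card B) * (G0 (dilate B m z) \<bullet> axis_proj B (dilate B m z))
      * \<phi> (dilate B ?r (dilate B m z)))"
    by (rule integral_dilate[OF B m]) measurable
  also have "\<dots> = (LINT z|lborel. m ^ card B * (?r ^ Suc (card B) * (G0 (dilate B m z) \<bullet> axis_proj B (dilate B m z))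
      * \<phi> (dilate B ?r (dilate B m z))))" by simp
  also have "\<dots> = (LINT z|lborel. (G0 (dilate B m z) \<bullet> axis_proj B z) * \<phi> z)"
  proof (rule Bochner_Integration.integral_cong[OF refl])
    fix z
    have "dilate B ?r (dilate B m z) = z" using m by (simp add: dilate_dilate[OF B] dilate_1[OF B])
    moreover have "m ^ card B * (?r ^ Suc (card B) * (m * x) * y) = x * y" for x y :: real
      using m by (simp add: field_simps)
    ultimately show "m ^ card B * (?r ^ Suc (card B) * (G0 (dilate B m z) \<bullet> axis_proj B (dilate B m z))
      * \<phi> (dilate B ?r (dilate B m z))) = (G0 (dilate B m z) \<bullet> axis_proj B z) * \<phi> z"
      by (simp only: axis_proj_dilate[OF B] inner_scaleR_right)
  qed
  finally show ?thesis by (simp add: G0_def)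
qed

text \<open>Tested with \<open>\<phi>\<close>, the left hand side becomes the integral of \<open>U\<close> against the difference of
  two rescaled test functions. The fundamental theorem of calculus in \<open>m\<close> and Fubini's theorem turn
  it into the right hand side, and the fundamental lemma removes the test function.\<close>

lemma weak_gradient_along_dilations:
  fixes U :: "'a::euclidean_space \<Rightarrow> real"
  assumes D: "open D" and G: "has_weak_gradient D U G" and B: "B \<subseteq> Basis" and ab: "0 < a" "a \<le> b"
    and inv: "\<And>m z. m \<in> {a..b} \<Longrightarrow> z \<in> D \<Longrightarrow> dilate B m z \<in> D"
  shows "AE z in lborel. z \<in> D \<longrightarrow> U (dilate B b z) - U (dilate B a z)
      = (LINT m:{a..b}|lborel. G (dilate B m z) \<bullet> axis_proj B z)"
proof -
  have l: "locally_integrable D U" "locally_integrable D G"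
    using G by (auto simp: has_weak_gradient_def)
  have [measurable]: "D \<in> sets borel" using D by simp
  define U0 where "U0 z = indicator D z * U z" for z
  define q where "q z m = (indicator D (dilate B m z) *\<^sub>R G (dilate B m z)) \<bullet> axis_proj B z" for z m
  have U0m [measurable]: "U0 \<in> borel_measurable borel"
    using locally_integrable_measurable[OF D l(1)] by (simp add: U0_def[abs_def])
  have Iq: "integrable (lborel \<Otimes>\<^sub>M lborel) (\<lambda>(z, m). indicator K z * (indicator {a..b} m * q z m))"
    if "compact K" "K \<subseteq> D" for K
    using integrable_along_dilations[OF D l(2) B ab inv that] by (simp add: q_def)
  define h where "h z = U0 (dilate B b z) + (- 1) *\<^sub>R U0 (dilate B a z)
      + (- 1) *\<^sub>R (LINT m|lborel. indicator {a..b} m * q z m)" for z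
  have liU: "locally_integrable D (\<lambda>z. U0 (dilate B m z))" if m: "m \<in> {a..b}" for m
    unfolding locally_integrable_def
  proof safe
    fix K assume K: "compact K" "K \<subseteq> D"
    have m0: "m > 0" using m ab by auto
    have K': "compact (dilate B m ` K)" "dilate B m ` K \<subseteq> D"
      using K inv[OF m] by (auto intro!: compact_continuous_image continuous_intros)
    have Ks: "K \<in> sets lborel" using K(1) by (simp add: borel_closed compact_imp_closed)
    have "integrable lborel (\<lambda>z. indicator (dilate B m ` K) z * U0 z)"
    proof -
      have e: "(\<lambda>z. indicator (dilate B m ` K) z * U0 z) = (\<lambda>z. indicator (dilate B m ` K) z *\<^sub>R U z)"
        using K'(2) by (auto simp: U0_def indicator_def fun_eq_iff)
      show ?thesis
        unfolding e set_integrable_def[symmetric]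
        using l(1) K' by (simp add: locally_integrable_def)
    qed
    from integrable_mult_indicator[OF Ks integrable_dilate[OF B m0 this]]
    show "set_integrable lborel K (\<lambda>z. U0 (dilate B m z))"
      unfolding set_integrable_def
      by (rule Bochner_Integration.integrable_cong[THEN iffD1, rotated 2]) (auto simp: indicator_def)
  qed
  have lih: "locally_integrable D h"
    unfolding h_def
  proof (intro locally_integrable_add locally_integrable_scaleR liU)
    show "locally_integrable D (\<lambda>z. LINT m|lborel. indicator {a..b} m * q z m)"
      unfolding locally_integrable_def
    proof safe
      fix K assume "compact K" "K \<subseteq> D"
      from lborel_pair.integrable_fst[OF Iq[OF this]]
      show "set_integrable lborel K (\<lambda>z. LINT m|lborel. indicator {a..b} m * q z m)"
        by (simp add: set_integrable_def)
    qed
  qed (use ab in auto)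
  have "AE z in lborel. z \<in> D \<longrightarrow> h z = 0"
  proof (rule fundamental_lemma_calculus_of_variations[OF D lih])
    fix \<phi> assume \<phi>: "test_function D \<phi>"
    obtain K where K: "compact K" "K \<subseteq> D" "\<And>z. z \<notin> K \<Longrightarrow> \<phi> z = 0"
      "\<And>z v. z \<notin> K \<Longrightarrow> frechet_derivative \<phi> (at z) v = 0"
      using test_function_supportE[OF \<phi>] by (metis (no_types, lifting))
    have c\<phi>: "continuous_on UNIV \<phi>" by (rule test_function_imp_continuous[OF \<phi>])
    have [measurable]: "\<phi> \<in> borel_measurable borel"
      using c\<phi> by (rule borel_measurable_continuous_onI)
    define K' where "K' = (\<lambda>(m, z). dilate B m z) ` ({a..b} \<times> K)"
    have K': "compact K'" "K' \<subseteq> D"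
      unfolding K'_def using compact_dilate_image[OF K(1)] inv K(2) by auto
    have [measurable]: "K' \<in> sets borel" using K'(1) by (simp add: borel_closed compact_imp_closed)
    have offK: "dilate B (inverse m) z \<notin> K" if "m \<in> {a..b}" "z \<notin> K'" for m z
    proof
      assume "dilate B (inverse m) z \<in> K"
      then have "dilate B m (dilate B (inverse m) z) \<in> K'" using that(1) by (force simp: K'_def)
      then show False using that ab by (simp add: dilate_dilate[OF B] dilate_1[OF B])
    qed
    let ?\<psi> = "dilated_test B \<phi>" and ?\<psi>' = "dilated_test_deriv B \<phi>"
    have \<psi>0: "?\<psi> m z = 0" "?\<psi>' m z = 0" if "m \<in> {a..b}" "z \<notin> K'" for m z
      using offK[OF that] K(3,4) by (simp_all add: dilated_test_def dilated_test_deriv_def)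
    have c\<psi>': "continuous_on ({a..b} \<times> UNIV) (\<lambda>(m, z). ?\<psi>' m z)"
    proof -
      have c: "continuous_on ({a..b} \<times> UNIV) (\<lambda>p. f (dilate B (inverse (fst p)) (snd p)))"
        if "continuous_on UNIV f" for f :: "'a \<Rightarrow> real"
        by (rule continuous_on_compose2[OF that]) (use ab in \<open>auto intro!: continuous_intros\<close>)
      show ?thesis
        unfolding dilated_test_deriv_def case_prod_beta
        using ab by (intro continuous_intros c[OF c\<phi>] c[OF test_function_continuous_derivative[OF \<phi>]]) auto
    qed
    have "bounded ((\<lambda>(m, z). ?\<psi>' m z) ` ({a..b} \<times> K'))"
      by (intro compact_imp_bounded compact_continuous_image continuous_on_subset[OF c\<psi>']
          compact_Times K'(1)) auto
    then obtain M where "\<forall>x\<in>(\<lambda>(m, z). ?\<psi>' m z) ` ({a..b} \<times> K'). norm x \<le> M"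
      unfolding bounded_iff by blast
    then have M: "norm (?\<psi>' m z) \<le> \<bar>M\<bar>" if "m \<in> {a..b}" "z \<in> K'" for m z
      using that by force
    have ftc: "(LINT m|lborel. indicator {a..b} m * ?\<psi>' m z) = ?\<psi> b z - ?\<psi> a z" for z
    proof -
      have "(LINT m|lborel. indicator {a..b} m *\<^sub>R ?\<psi>' m z) = ?\<psi> b z - ?\<psi> a z"
      proof (rule integral_FTC_atLeastAtMost[OF ab(2)])
        show "((\<lambda>m. ?\<psi> m z) has_vector_derivative ?\<psi>' m z) (at m within {a..b})" if "a \<le> m" "m \<le> b" for m
          using dilated_test_has_derivative[OF \<phi>, of m B z] ab that
          by (auto simp: has_real_derivative_iff_has_vector_derivative intro: has_vector_derivative_at_within)
        have "continuous_on {a..b} (\<lambda>m. (\<lambda>(m, z). ?\<psi>' m z) (m, z))"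
          by (rule continuous_on_compose2[OF c\<psi>']) (auto intro!: continuous_intros)
        then show "continuous_on {a..b} (\<lambda>m. ?\<psi>' m z)" by simp
      qed
      then show ?thesis by simp
    qed
    have I1: "integrable (lborel \<Otimes>\<^sub>M lborel) (\<lambda>(z, m). U0 z * (indicator {a..b} m * ?\<psi>' m z))"
    proof -
      define d where "d b w = frechet_derivative \<phi> (at w) b" for b w
      have [measurable]: "d b \<in> borel_measurable borel" for b
        unfolding d_def
        by (rule borel_measurable_continuous_onI[OF test_function_continuous_derivative[OF \<phi>]])
      have \<psi>'m: "(\<lambda>(z, m). U0 z * (indicator {a..b} m * ?\<psi>' m z)) \<in> borel_measurable (lborel \<Otimes>\<^sub>M lborel)"
        unfolding dilated_test_deriv_def d_def[symmetric] by measurable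
      have iU: "integrable lborel (\<lambda>z. indicator K' z * U z)"
        using l(1) K' by (auto simp: locally_integrable_def set_integrable_def)
      have [measurable]: "(\<lambda>z. indicator K' z * U z) \<in> borel_measurable borel"
        using borel_measurable_integrable[OF iU] by simp
      have iab: "integrable lborel (\<lambda>m. indicator {a..b} m * M)"
        using ab by (intro integrable_mult_left integrable_real_indicator) auto
      have "integrable (lborel \<Otimes>\<^sub>M lborel) (\<lambda>(z, m). (indicator K' z * U z) * (indicator {a..b} m * M))"
      proof (rule lborel_pair.Fubini_integrable)
        have "integrable lborel (\<lambda>z. norm (indicator K' z * U z) * (LINT m|lborel. norm (indicator {a..b} m * M)))"
          by (intro integrable_mult_left integrable_norm iU)
        then show "integrable lborel (\<lambda>z. LINT m|lborel.
            norm (case (z, m) of (z, m) \<Rightarrow> (indicator K' z * U z) * (indicator {a..b} m * M)))"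
          by (simp only: prod.case norm_mult[of "indicator K' _ * U _"] integral_mult_right_zero)
        show "AE z in lborel. integrable lborel (\<lambda>m. case (z, m) of (z, m) \<Rightarrow>
            (indicator K' z * U z) * (indicator {a..b} m * M))"
          by (simp only: prod.case) (intro AE_I2 integrable_mult_right iab)
      qed measurable
      then show ?thesis
      proof (rule Bochner_Integration.integrable_bound[OF _ \<psi>'m], intro AE_I2, clarify)
        fix z m
        show "norm (U0 z * (indicator {a..b} m * ?\<psi>' m z)) \<le> norm ((indicator K' z * U z) * (indicator {a..b} m * M))"
        proof (cases "m \<in> {a..b} \<and> z \<in> K'")
          case True
          then have "U0 z = U z" using K'(2) by (auto simp: U0_def)
          then show ?thesis
            using True mult_left_mono[OF M[of m z], of "\<bar>U z\<bar>"] by (simp add: abs_mult)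
        next
          case False
          then show ?thesis using \<psi>0(2)[of m z] by (auto simp: indicator_def)
        qed
      qed
    qed
    have U\<psi>: "integrable lborel (\<lambda>z. U0 z * ?\<psi> m z)"
      "(LINT z|lborel. U0 z * ?\<psi> m z) = (LINT z|lborel. U0 (dilate B m z) * \<phi> z)" if m: "m \<in> {a..b}" for m
    proof -
      have m0: "m > 0" using m ab by auto
      have c: "continuous_on UNIV (?\<psi> m)"
        unfolding dilated_test_def
        by (intro continuous_intros continuous_on_compose2[OF c\<phi>]) auto
      show "integrable lborel (\<lambda>z. U0 z * ?\<psi> m z)"
        using set_integrable_times_compact_support[OF l(1) K' c \<psi>0(1)[OF m]]
        by (simp add: set_integrable_def U0_def mult.assoc)
      have [measurable]: "?\<psi> m \<in> borel_measurable borel"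
        using c by (rule borel_measurable_continuous_onI)
      have "(LINT z|lborel. U0 z * ?\<psi> m z)
          = m ^ card B * (LINT z|lborel. U0 (dilate B m z) * ?\<psi> m (dilate B m z))"
        by (rule integral_dilate[OF B m0]) measurable
      also have "\<dots> = (LINT z|lborel. m ^ card B * (U0 (dilate B m z) * ?\<psi> m (dilate B m z)))" by simp
      also have "\<dots> = (LINT z|lborel. U0 (dilate B m z) * \<phi> z)"
      proof (rule Bochner_Integration.integral_cong[OF refl])
        fix z
        have "dilate B (inverse m) (dilate B m z) = z"
          using m0 by (simp add: dilate_dilate[OF B] dilate_1[OF B])
        then show "m ^ card B * (U0 (dilate B m z) * ?\<psi> m (dilate B m z)) = U0 (dilate B m z) * \<phi> z"
          using m0 by (simp add: dilated_test_def field_simps)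
      qed
      finally show "(LINT z|lborel. U0 z * ?\<psi> m z) = (LINT z|lborel. U0 (dilate B m z) * \<phi> z)" .
    qed
    have I2: "integrable (lborel \<Otimes>\<^sub>M lborel) (\<lambda>(z, m). \<phi> z * (indicator {a..b} m * q z m))"
    proof -
      have "bounded (\<phi> ` K)"
        by (intro compact_imp_bounded compact_continuous_image continuous_on_subset[OF c\<phi>] K(1)) simp
      then obtain N where "\<forall>x\<in>\<phi> ` K. norm x \<le> N" unfolding bounded_iff by blast
      then have N: "\<bar>\<phi> z\<bar> \<le> \<bar>N\<bar>" if "z \<in> K" for z using that by force
      show ?thesis
      proof (rule Bochner_Integration.integrable_bound[OF integrable_mult_right[OF Iq[OF K(1,2)], of "\<bar>N\<bar>"]])
        have "(\<lambda>p. \<phi> (fst p) * (\<lambda>(z, m). indicator K z * (indicator {a..b} m * q z m)) p)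
            \<in> borel_measurable (lborel \<Otimes>\<^sub>M lborel)"
          using Iq[OF K(1,2)] by (intro borel_measurable_times) auto
        moreover have "(\<lambda>p. \<phi> (fst p) * (\<lambda>(z, m). indicator K z * (indicator {a..b} m * q z m)) p)
          = (\<lambda>(z, m). \<phi> z * (indicator {a..b} m * q z m))"
          using K(3) by (auto simp: fun_eq_iff indicator_def)
        ultimately show "(\<lambda>(z, m). \<phi> z * (indicator {a..b} m * q z m)) \<in> borel_measurable (lborel \<Otimes>\<^sub>M lborel)"
          by simp
        show "AE p in lborel \<Otimes>\<^sub>M lborel. norm (case p of (z, m) \<Rightarrow> \<phi> z * (indicator {a..b} m * q z m))
            \<le> norm (\<bar>N\<bar> * (case p of (z, m) \<Rightarrow> indicator K z * (indicator {a..b} m * q z m)))"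
        proof (intro AE_I2, clarify)
          fix z m
          show "norm (\<phi> z * (indicator {a..b} m * q z m)) \<le> norm (\<bar>N\<bar> * (indicator K z * (indicator {a..b} m * q z m)))"
            using N[of z] K(3)[of z] by (cases "z \<in> K") (auto simp: abs_mult intro!: mult_right_mono)
        qed
      qed
    qed
    have eq: "(LINT z|lborel. U0 (dilate B b z) * \<phi> z) - (LINT z|lborel. U0 (dilate B a z) * \<phi> z)
        = (LINT z|lborel. \<phi> z * (LINT m|lborel. indicator {a..b} m * q z m))"
    proof -
      have "(LINT z|lborel. U0 (dilate B b z) * \<phi> z) - (LINT z|lborel. U0 (dilate B a z) * \<phi> z)
          = (LINT z|lborel. U0 z * (?\<psi> b z - ?\<psi> a z))"
        using ab by (simp add: U\<psi> right_diff_distrib flip: U\<psi>(2))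
      also have "\<dots> = (LINT z|lborel. LINT m|lborel. U0 z * (indicator {a..b} m * ?\<psi>' m z))"
        by (simp add: ftc)
      also have "\<dots> = (LINT m|lborel. LINT z|lborel. U0 z * (indicator {a..b} m * ?\<psi>' m z))"
        by (rule lborel_pair.Fubini_integral[OF I1, symmetric])
      also have "\<dots> = (LINT m|lborel. LINT z|lborel. \<phi> z * (indicator {a..b} m * q z m))"
      proof (rule Bochner_Integration.integral_cong[OF refl])
        fix m :: real
        show "(LINT z|lborel. U0 z * (indicator {a..b} m * ?\<psi>' m z))
            = (LINT z|lborel. \<phi> z * (indicator {a..b} m * q z m))"
        proof (cases "m \<in> {a..b}")
          case True
          then show ?thesis
            using integral_dilated_test_deriv[OF D G B _ inv[OF True] \<phi>] ab
            by (simp add: U0_def q_def mult.commute)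
        qed simp
      qed
      also have "\<dots> = (LINT z|lborel. LINT m|lborel. \<phi> z * (indicator {a..b} m * q z m))"
        by (rule lborel_pair.Fubini_integral[OF I2])
      finally show ?thesis by simp
    qed
    have i1: "integrable lborel (\<lambda>z. U0 (dilate B m z) * \<phi> z)" if "m \<in> {a..b}" for m
    proof -
      have "set_integrable lborel D (\<lambda>z. U0 (dilate B m z) * \<phi> z)"
        by (rule set_integrable_times_compact_support[OF liU[OF that] K(1,2) c\<phi> K(3)])
      moreover have "(\<lambda>z. indicator D z *\<^sub>R (U0 (dilate B m z) * \<phi> z)) = (\<lambda>z. U0 (dilate B m z) * \<phi> z)"
        using K(2,3) by (auto simp: indicator_def fun_eq_iff)
      ultimately show ?thesis by (simp only: set_integrable_def)
    qed
    have i2: "integrable lborel (\<lambda>z. \<phi> z * (LINT m|lborel. indicator {a..b} m * q z m))"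
      using lborel_pair.integrable_fst[OF I2] by simp
    have "(LINT z:D|lborel. h z * \<phi> z) = (LINT z|lborel. h z * \<phi> z)"
      unfolding set_lebesgue_integral_def
      by (rule Bochner_Integration.integral_cong) (use K(2,3) in \<open>auto simp: indicator_def\<close>)
    also have "\<dots> = (LINT z|lborel. U0 (dilate B b z) * \<phi> z - U0 (dilate B a z) * \<phi> z
        - \<phi> z * (LINT m|lborel. indicator {a..b} m * q z m))"
      by (simp add: h_def algebra_simps)
    also have "\<dots> = 0"
      using eq ab by (simp add: i1 i2)
    finally show "(LINT z:D|lborel. h z * \<phi> z) = 0" .
  qed
  then show ?thesis
  proof eventually_elim
    case (elim z)
    show ?case
    proof
      assume z: "z \<in> D"
      have "U (dilate B b z) - U (dilate B a z) = (LINT m|lborel. indicator {a..b} m * q z m)"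
        using elim z inv[of a z] inv[of b z] ab by (simp add: h_def U0_def)
      also have "\<dots> = (LINT m:{a..b}|lborel. G (dilate B m z) \<bullet> axis_proj B z)"
        unfolding set_lebesgue_integral_def
        by (rule Bochner_Integration.integral_cong) (use inv[OF _ z] in \<open>auto simp: q_def indicator_def\<close>)
      finally show "U (dilate B b z) - U (dilate B a z)
        = (LINT m:{a..b}|lborel. G (dilate B m z) \<bullet> axis_proj B z)" .
    qed
  qed
qed

section \<open>Hardy inequality and traces on cylinders\<close>

lemma measurable_fst_borel [measurable (raw)]:
  fixes f :: "_ \<Rightarrow> 'a::topological_space \<times> 'b::topological_space"
  assumes "f \<in> borel_measurable M" shows "(\<lambda>x. fst (f x)) \<in> borel_measurable M"
  by (rule measurable_compose[OF assms borel_measurable_continuous_onI]) (rule continuous_on_fst continuous_on_id)+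

lemma measurable_snd_borel [measurable (raw)]:
  fixes f :: "_ \<Rightarrow> 'a::topological_space \<times> 'b::topological_space"
  assumes "f \<in> borel_measurable M" shows "(\<lambda>x. snd (f x)) \<in> borel_measurable M"
  by (rule measurable_compose[OF assms borel_measurable_continuous_onI]) (rule continuous_on_snd continuous_on_id)+

lemma weighted_Cauchy_Schwarz:
  fixes w :: "'a \<Rightarrow> real" and f :: "'a \<Rightarrow> ennreal"
  assumes [measurable]: "w \<in> borel_measurable M" "f \<in> borel_measurable M" "A \<in> sets M"
    and pos: "\<And>x. x \<in> A \<Longrightarrow> w x > 0"
  shows "(\<integral>\<^sup>+x\<in>A. f x \<partial>M)\<^sup>2 \<le> (\<integral>\<^sup>+x\<in>A. ennreal (1 / w x) \<partial>M) * (\<integral>\<^sup>+x\<in>A. ennreal (w x) * (f x)\<^sup>2 \<partial>M)"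
proof -
  let ?F = "\<lambda>x. ennreal (sqrt (1 / w x)) * indicator A x"
  let ?G = "\<lambda>x. ennreal (sqrt (w x)) * f x * indicator A x"
  have 1: "?F x * ?G x = f x * indicator A x" for x
  proof (cases "x \<in> A")
    case True
    have "ennreal (sqrt (1 / w x)) * ennreal (sqrt (w x)) = 1"
      using pos[OF True] by (simp add: ennreal_mult[symmetric] real_sqrt_mult[symmetric])
    then show ?thesis using True by (simp add: mult.assoc[symmetric])
  qed simp
  have 2: "(?F x)\<^sup>2 = ennreal (1 / w x) * indicator A x" for x
    using pos[of x] by (cases "x \<in> A") (auto simp: ennreal_power)
  have 3: "(?G x)\<^sup>2 = ennreal (w x) * (f x)\<^sup>2 * indicator A x" for x
    using pos[of x] by (cases "x \<in> A") (auto simp: ennreal_power power_mult_distrib)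
  have "(\<integral>\<^sup>+x. ?F x * ?G x \<partial>M)\<^sup>2 \<le> (\<integral>\<^sup>+x. (?F x)\<^sup>2 \<partial>M) * (\<integral>\<^sup>+x. (?G x)\<^sup>2 \<partial>M)"
    by (rule Cauchy_Schwarz_nn_integral) measurable
  then show ?thesis unfolding 1 2 3 .
qed

lemma nn_integral_powr_Ioc:
  fixes p c :: real
  assumes "-1 < p" "0 \<le> c"
  shows "(\<integral>\<^sup>+x\<in>{0<..c}. ennreal (x powr p) \<partial>lborel) = ennreal (c powr (p + 1) / (p + 1))"
proof -
  have "(\<integral>\<^sup>+x\<in>{0<..c}. ennreal (x powr p) \<partial>lborel) = (\<integral>\<^sup>+x\<in>{0..c}. ennreal (x powr p) \<partial>lborel)"
    by (intro nn_integral_cong) (auto simp: indicator_def)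
  also have "\<dots> = ennreal (c powr (p + 1) / (p + 1))"
    by (rule nn_integral_has_integral_lebesgue'[OF _ has_integral_powr_from_0[OF assms]]) simp
  finally show ?thesis .
qed

lemma nn_integral_powr_Ici:
  fixes p :: real
  assumes "p < -1"
  shows "(\<integral>\<^sup>+x\<in>{1..}. ennreal (x powr p) \<partial>lborel) = ennreal (- 1 / (p + 1))"
  using nn_integral_has_integral_lebesgue'[OF _ has_integral_powr_to_inf[OF assms, of 1]] by simp

lemma norm_integral_le_nn_integral:
  fixes f :: "'a \<Rightarrow> 'b::{banach, second_countable_topology}"
  shows "ennreal (norm (LINT x|M. f x)) \<le> (\<integral>\<^sup>+x. ennreal (norm (f x)) \<partial>M)"
  by (cases "integrable M f") (auto intro: integral_norm_bound_ennreal simp: not_integrable_integral_eq)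

lemma AE_lborel_Ioo_obtains:
  fixes a b :: real
  assumes "AE y in lborel. P y" "a < b"
  obtains y where "a < y" "y < b" "P y"
proof -
  have "\<exists>y\<in>{a<..<b}. P y"
  proof (rule ccontr)
    assume nex: "\<not> (\<exists>y\<in>{a<..<b}. P y)"
    have "AE y in lborel. y \<notin> {a<..<b}"
      using assms(1) by eventually_elim (use nex in auto)
    then have "emeasure lborel {y \<in> space lborel. y \<in> {a<..<b}} = 0" by (rule emeasure_eq_0_AE)
    then have "emeasure lborel {a<..<b} = 0" by (simp add: greaterThanLessThan_def greaterThan_def lessThan_def Collect_conj_eq)
    then show False using assms(2) by simp
  qed
  then show ?thesis using that by auto
qed

text \<open>If \<open>c\<close> agrees with \<open>c y\<close> almost everywhere below almost every height \<open>y\<close>, then any two such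
  heights are compared through a common point below both of them.\<close>

lemma constant_if_dilation_invariant:
  fixes c :: "real \<Rightarrow> real"
  assumes c[measurable]: "c \<in> borel_measurable borel" and I: "{0<..<h} \<subseteq> I" "0 < h" "I \<subseteq> {0<..}"
    and inv: "AE y in lborel. y \<in> I \<longrightarrow> (AE m in lborel. 0 < m \<and> m < 1 \<longrightarrow> c (m * y) = c y)"
  shows "\<exists>k. AE y in lborel. y \<in> I \<longrightarrow> c y = k"
proof -
  have scale: "AE t in lborel. 0 < t \<and> t < y \<longrightarrow> c t = c y"
    if "0 < y" "AE m in lborel. 0 < m \<and> m < 1 \<longrightarrow> c (m * y) = c y" for y
  proof -
    have "AE t in lborel. (0 < 0 + (1 / y) * t \<and> 0 + (1 / y) * t < 1 \<longrightarrow> c ((0 + (1 / y) * t) * y) = c y)"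
      by (rule AE_borel_affine[OF _ _ that(2)]) (use that(1) in auto)
    then show ?thesis by eventually_elim (use that(1) in \<open>auto simp: field_simps\<close>)
  qed
  obtain y1 where y1: "0 < y1" "y1 < h" "y1 \<in> I \<longrightarrow> (AE m in lborel. 0 < m \<and> m < 1 \<longrightarrow> c (m * y1) = c y1)"
    using AE_lborel_Ioo_obtains[OF inv I(2)] by blast
  then have s1: "AE t in lborel. 0 < t \<and> t < y1 \<longrightarrow> c t = c y1"
    using I(1) by (intro scale) auto
  have "AE y in lborel. y \<in> I \<longrightarrow> c y = c y1"
    using inv
  proof eventually_elim
    case (elim y)
    show ?case
    proof
      assume y: "y \<in> I"
      then have y0: "0 < y" using I(3) by auto
      have "AE t in lborel. (0 < t \<and> t < y \<longrightarrow> c t = c y) \<and> (0 < t \<and> t < y1 \<longrightarrow> c t = c y1)"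
        using scale[OF y0] elim y s1 by auto
      from AE_lborel_Ioo_obtains[OF this, of 0 "min y y1"] y0 y1(1)
      obtain t where "0 < t" "t < min y y1"
          "(0 < t \<and> t < y \<longrightarrow> c t = c y) \<and> (0 < t \<and> t < y1 \<longrightarrow> c t = c y1)"
        by (metis (no_types, lifting) min_less_iff_conj)
      then show "c y = c y1" by auto
    qed
  qed
  then show ?thesis by blast
qed

lemma vertical_in_Basis: "(0, 1) \<in> (Basis :: ('a::euclidean_space \<times> real) set)"
  by (simp add: Basis_prod_def)

lemma axis_proj_vertical: "axis_proj {(0, 1)} z = (0, snd z)" for z :: "'a::euclidean_space \<times> real"
  by (simp add: axis_proj_def inner_prod_def)

lemma dilate_vertical: "dilate {(0, 1)} m z = (fst z, m * snd z)" for z :: "'a::euclidean_space \<times> real"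
  by (simp add: dilate_def axis_proj_vertical prod_eq_iff algebra_simps)

text \<open>The heights of the half space and of the slabs: open intervals from 0, infinite or not, that
  are stable under contractions. The bounds below depend on the interval through \<open>h\<close> only.\<close>

locale heights =
  fixes I :: "real set" and h :: real
  assumes open_I: "open I" and I_pos: "I \<subseteq> {0<..}" and h_pos: "0 < h" and h_I: "{0<..<h} \<subseteq> I"
    and contract: "\<And>y m. y \<in> I \<Longrightarrow> 0 < m \<Longrightarrow> m \<le> 1 \<Longrightarrow> m * y \<in> I"
begin

lemma measurable_I [measurable]: "I \<in> sets borel"
  using open_I by simp

lemma open_cylinder: "open (UNIV \<times> I)"
  using open_I by (simp add: open_Times)

text \<open>Contracting the height by \<open>m\<close> costs \<open>m powr (- \<alpha>)\<close> from the weight and \<open>1 / m\<close> from the volume;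
  the contracted cylinder stays inside the cylinder.\<close>

lemma vertical_scaling:
  fixes F :: "'a::euclidean_space \<times> real \<Rightarrow> ennreal"
  assumes [measurable]: "F \<in> borel_measurable borel" and m: "0 < m" "m \<le> 1"
  shows "(\<integral>\<^sup>+z\<in>UNIV \<times> I. ennreal (snd z powr \<alpha>) * F (fst z, m * snd z) \<partial>lborel)
    \<le> ennreal (m powr (- 1 - \<alpha>)) * (\<integral>\<^sup>+z\<in>UNIV \<times> I. ennreal (snd z powr \<alpha>) * F z \<partial>lborel)"
proof -
  have [measurable]: "UNIV \<times> I \<in> sets (borel :: ('a \<times> real) measure)" by (rule borel_open[OF open_cylinder])
  define H where "H z = ennreal (snd z powr \<alpha>) * F z * indicator (UNIV \<times> I) z" for z
  have [measurable]: "H \<in> borel_measurable borel" unfolding H_def by measurable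
  have "ennreal (snd z powr \<alpha>) * F (fst z, m * snd z) * indicator (UNIV \<times> I) z
      \<le> ennreal (m powr - \<alpha>) * H (dilate {(0, 1)} m z)" for z
  proof (cases "snd z \<in> I")
    case True
    then have y: "snd z > 0" "m * snd z \<in> I" using I_pos contract m by auto
    have "ennreal (snd z powr \<alpha>) = ennreal (m powr - \<alpha>) * ennreal ((m * snd z) powr \<alpha>)"
      using m y by (simp add: ennreal_mult[symmetric] powr_mult powr_minus field_simps)
    then show ?thesis using True y by (simp add: H_def dilate_vertical mult.assoc indicator_def)
  qed (auto simp: indicator_def)
  then have "(\<integral>\<^sup>+z\<in>UNIV \<times> I. ennreal (snd z powr \<alpha>) * F (fst z, m * snd z) \<partial>lborel)
      \<le> (\<integral>\<^sup>+z. ennreal (m powr - \<alpha>) * H (dilate {(0, 1)} m z) \<partial>lborel)"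
    by (intro nn_integral_mono)
  also have "\<dots> = ennreal (m powr - \<alpha>) * (\<integral>\<^sup>+z. H (dilate {(0, 1)} m z) \<partial>lborel)"
    by (rule nn_integral_cmult) measurable
  also have "\<dots> \<le> ennreal (m powr - \<alpha>) * (ennreal (1 / m ^ card {(0::'a, 1::real)}) * (\<integral>\<^sup>+z. H z \<partial>lborel))"
    using m by (intro mult_left_mono nn_integral_compose_dilate_le) (auto simp: vertical_in_Basis)
  also have "\<dots> = ennreal (m powr (- 1 - \<alpha>)) * (\<integral>\<^sup>+z. H z \<partial>lborel)"
  proof -
    have "m powr - \<alpha> * (1 / m) = m powr (- 1 - \<alpha>)"
      using m powr_add[of m "- 1" "- \<alpha>"] by (simp add: powr_minus_divide[of m 1])
    then show ?thesis
      using m by (simp add: mult.assoc[symmetric] ennreal_mult[symmetric])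
  qed
  finally show ?thesis by (simp add: H_def)
qed

text \<open>Hardy's inequality in the vertical direction: the weight \<open>m powr ((1 + \<alpha>) / 2)\<close> in the
  Cauchy--Schwarz inequality makes both of the remaining integrals over \<open>m\<close> converge.\<close>

lemma vertical_mean_bound:
  fixes f :: "'a::euclidean_space \<times> real \<Rightarrow> real"
  assumes [measurable]: "f \<in> borel_measurable borel" and \<alpha>: "-1 < \<alpha>" "\<alpha> < 1"
  shows "(\<integral>\<^sup>+z\<in>UNIV \<times> I. ennreal (snd z powr \<alpha>) * (\<integral>\<^sup>+m\<in>{0<..1}. ennreal \<bar>f (fst z, m * snd z)\<bar> \<partial>lborel)\<^sup>2 \<partial>lborel)
    \<le> ennreal (4 / (1 - \<alpha>)\<^sup>2) * (\<integral>\<^sup>+z\<in>UNIV \<times> I. ennreal (snd z powr \<alpha>) * ennreal ((f z)\<^sup>2) \<partial>lborel)"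
    (is "?L \<le> _ * ?E")
proof -
  have [measurable]: "UNIV \<times> I \<in> sets (borel :: ('a \<times> real) measure)" by (rule borel_open[OF open_cylinder])
  \<comment> \<open>the exponent half way between \<open>\<alpha>\<close> and 1; both \<open>- \<gamma>\<close> and \<open>\<gamma> - 1 - \<alpha>\<close> are then equal and above \<open>-1\<close>\<close>
  define \<gamma> where "\<gamma> = (1 + \<alpha>) / 2"
  define c where "c = 2 / (1 - \<alpha>)"
  have c0: "c \<ge> 0" using \<alpha> by (simp add: c_def)
  have i1: "(\<integral>\<^sup>+m\<in>{0<..1::real}. ennreal (1 / m powr \<gamma>) \<partial>lborel) = ennreal c"
  proof -
    have "(\<integral>\<^sup>+m\<in>{0<..1::real}. ennreal (1 / m powr \<gamma>) \<partial>lborel) = (\<integral>\<^sup>+m\<in>{0<..1::real}. ennreal (m powr - \<gamma>) \<partial>lborel)"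
      by (simp add: powr_minus_divide)
    also have "\<dots> = ennreal c"
      using \<alpha> by (subst nn_integral_powr_Ioc) (auto simp: \<gamma>_def c_def field_simps)
    finally show ?thesis .
  qed
  have i2: "(\<integral>\<^sup>+m\<in>{0<..1::real}. ennreal (m powr (\<gamma> - 1 - \<alpha>)) \<partial>lborel) = ennreal c"
    using \<alpha> by (subst nn_integral_powr_Ioc) (auto simp: \<gamma>_def c_def field_simps)
  define S where "S m z = ennreal (m powr \<gamma>) * (ennreal (snd z powr \<alpha>) * ennreal ((f (fst z, m * snd z))\<^sup>2)
      * indicator (UNIV \<times> I) z) * indicator {0<..1} m" for m z
  have Sm: "case_prod S \<in> borel_measurable (lborel \<Otimes>\<^sub>M lborel)" unfolding S_def by measurable
  have Sm2: "(\<lambda>z. \<integral>\<^sup>+m. S m z \<partial>lborel) \<in> borel_measurable lborel" unfolding S_def by measurable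
  have Sm': "S m \<in> borel_measurable lborel" for m unfolding S_def by measurable
  have Sm'': "(\<lambda>m. S m z) \<in> borel_measurable lborel" for z unfolding S_def by measurable
  have "?L \<le> (\<integral>\<^sup>+z. ennreal c * (\<integral>\<^sup>+m. S m z \<partial>lborel) \<partial>lborel)"
  proof (rule nn_integral_mono)
    fix z :: "'a \<times> real"
    have "(\<integral>\<^sup>+m\<in>{0<..1}. ennreal \<bar>f (fst z, m * snd z)\<bar> \<partial>lborel)\<^sup>2
        \<le> (\<integral>\<^sup>+m\<in>{0<..1::real}. ennreal (1 / m powr \<gamma>) \<partial>lborel) *
          (\<integral>\<^sup>+m\<in>{0<..1}. ennreal (m powr \<gamma>) * (ennreal \<bar>f (fst z, m * snd z)\<bar>)\<^sup>2 \<partial>lborel)"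
      by (rule weighted_Cauchy_Schwarz) auto
    then have "ennreal (snd z powr \<alpha>) * (\<integral>\<^sup>+m\<in>{0<..1}. ennreal \<bar>f (fst z, m * snd z)\<bar> \<partial>lborel)\<^sup>2 * indicator (UNIV \<times> I) z
        \<le> ennreal (snd z powr \<alpha>) * (ennreal c *
          (\<integral>\<^sup>+m\<in>{0<..1}. ennreal (m powr \<gamma>) * (ennreal \<bar>f (fst z, m * snd z)\<bar>)\<^sup>2 \<partial>lborel)) * indicator (UNIV \<times> I) z"
      unfolding i1 by (intro mult_mono) auto
    also have "\<dots> = ennreal c * ((ennreal (snd z powr \<alpha>) * indicator (UNIV \<times> I) z) *
        (\<integral>\<^sup>+m\<in>{0<..1}. ennreal (m powr \<gamma>) * (ennreal \<bar>f (fst z, m * snd z)\<bar>)\<^sup>2 \<partial>lborel))"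
      by (simp add: mult_ac)
    also have "\<dots> = ennreal c * (\<integral>\<^sup>+m. S m z \<partial>lborel)"
      unfolding S_def
      by (subst nn_integral_cmult[symmetric]) (auto simp: mult_ac ennreal_power)
    finally show "ennreal (snd z powr \<alpha>) * (\<integral>\<^sup>+m\<in>{0<..1}. ennreal \<bar>f (fst z, m * snd z)\<bar> \<partial>lborel)\<^sup>2
        * indicator (UNIV \<times> I) z \<le> ennreal c * (\<integral>\<^sup>+m. S m z \<partial>lborel)" .
  qed
  also have "\<dots> = ennreal c * (\<integral>\<^sup>+z. \<integral>\<^sup>+m. S m z \<partial>lborel \<partial>lborel)"
    using Sm2 by (intro nn_integral_cmult) (simp add: case_prod_beta')
  also have "(\<integral>\<^sup>+z. \<integral>\<^sup>+m. S m z \<partial>lborel \<partial>lborel) = (\<integral>\<^sup>+m. \<integral>\<^sup>+z. S m z \<partial>lborel \<partial>lborel)"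
    by (rule lborel_pair.Fubini'[OF Sm])
  also have "\<dots> \<le> (\<integral>\<^sup>+m. ?E * (ennreal (m powr (\<gamma> - 1 - \<alpha>)) * indicator {0<..1} m) \<partial>lborel)"
  proof (rule nn_integral_mono)
    fix m :: real
    show "(\<integral>\<^sup>+z. S m z \<partial>lborel) \<le> ?E * (ennreal (m powr (\<gamma> - 1 - \<alpha>)) * indicator {0<..1} m)"
    proof (cases "m \<in> {0<..1}")
      case True
      then have "(\<integral>\<^sup>+z. S m z \<partial>lborel) = ennreal (m powr \<gamma>) *
          (\<integral>\<^sup>+z\<in>UNIV \<times> I. ennreal (snd z powr \<alpha>) * ennreal ((f (fst z, m * snd z))\<^sup>2) \<partial>lborel)"
        unfolding S_def by (simp add: nn_integral_cmult)
      also have "\<dots> \<le> ennreal (m powr \<gamma>) * (ennreal (m powr (- 1 - \<alpha>)) * ?E)"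
        using True by (intro mult_left_mono vertical_scaling[where F="\<lambda>z. ennreal ((f z)\<^sup>2)"]) auto
      also have "\<dots> = ?E * ennreal (m powr \<gamma> * m powr (- 1 - \<alpha>))"
        by (simp add: mult_ac ennreal_mult)
      also have "m powr \<gamma> * m powr (- 1 - \<alpha>) = m powr (\<gamma> - 1 - \<alpha>)"
        by (simp add: powr_add[symmetric] algebra_simps)
      finally show ?thesis using True by simp
    qed (simp add: S_def)
  qed
  also have "\<dots> = ?E * ennreal c"
    by (subst nn_integral_cmult) (auto simp: i2)
  finally have "?L \<le> ennreal c * (?E * ennreal c)"
    by (simp add: mult_left_mono)
  also have "\<dots> = ennreal (c * c) * ?E"
    using c0 by (simp add: ennreal_mult mult_ac)
  also have "c * c = 4 / (1 - \<alpha>)\<^sup>2"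
    by (simp add: c_def power2_eq_square)
  finally show ?thesis .
qed

lemma measurable_cylinder [measurable]:
  "UNIV \<times> I \<in> sets (borel :: ('a::euclidean_space \<times> real) measure)"
  by (rule borel_open[OF open_cylinder])

lemma AE_vertically_integrable:
  fixes f :: "'a::euclidean_space \<times> real \<Rightarrow> real"
  assumes [measurable]: "f \<in> borel_measurable borel" and \<alpha>: "-1 < \<alpha>" "\<alpha> < 1"
    and fin: "(\<integral>\<^sup>+z\<in>UNIV \<times> I. ennreal (snd z powr \<alpha>) * ennreal ((f z)\<^sup>2) \<partial>lborel) < \<infinity>"
  shows "AE z in lborel. z \<in> UNIV \<times> I \<longrightarrow> set_integrable lborel {0<..1} (\<lambda>m. f (fst z, m * snd z))"
proof -
  have "(\<integral>\<^sup>+z\<in>UNIV \<times> I. ennreal (snd z powr \<alpha>) * (\<integral>\<^sup>+m\<in>{0<..1}. ennreal \<bar>f (fst z, m * snd z)\<bar> \<partial>lborel)\<^sup>2 \<partial>lborel) < \<infinity>"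
    using vertical_mean_bound[of f, OF _ \<alpha>] fin
    by (auto intro!: le_less_trans[OF vertical_mean_bound[of f, OF _ \<alpha>]] simp: ennreal_mult_less_top)
  then have "AE z in lborel. ennreal (snd z powr \<alpha>) * (\<integral>\<^sup>+m\<in>{0<..1}. ennreal \<bar>f (fst z, m * snd z)\<bar> \<partial>lborel)\<^sup>2
      * indicator (UNIV \<times> I) z \<noteq> \<infinity>"
    by (intro nn_integral_PInf_AE) auto
  then show ?thesis
  proof eventually_elim
    case (elim z)
    show ?case
    proof
      assume z: "z \<in> UNIV \<times> I"
      then have "snd z > 0" using I_pos by auto
      then have "(\<integral>\<^sup>+m\<in>{0<..1}. ennreal \<bar>f (fst z, m * snd z)\<bar> \<partial>lborel) < \<infinity>"
        using elim z by (auto simp: power2_eq_square ennreal_mult_eq_top_iff less_top)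
      moreover have "(\<integral>\<^sup>+m\<in>{0<..1}. ennreal \<bar>f (fst z, m * snd z)\<bar> \<partial>lborel)
          = (\<integral>\<^sup>+m. ennreal (norm (indicator {0<..1} m *\<^sub>R f (fst z, m * snd z))) \<partial>lborel)"
        by (intro nn_integral_cong) (auto simp: indicator_def)
      ultimately show "set_integrable lborel {0<..1} (\<lambda>m. f (fst z, m * snd z))"
        unfolding set_integrable_def by (intro integrableI_bounded) auto
    qed
  qed
qed

text \<open>The candidate \<open>c\<close> for the trace is \<open>U\<close> minus \<open>y\<close> times the mean of its vertical derivative below
  \<open>y\<close>. By the dilation identity it is invariant under vertical contractions, hence independent of
  the height, and averaging over the heights below \<open>h\<close> makes it a measurable function of \<open>x\<close>.\<close>

lemma trace_representation:
  fixes U :: "'a::euclidean_space \<times> real \<Rightarrow> real"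
  assumes G: "has_weak_gradient (UNIV \<times> I) U G" and \<alpha>: "-1 < \<alpha>" "\<alpha> < 1"
    and fin: "(\<integral>\<^sup>+z\<in>UNIV \<times> I. ennreal (snd z powr \<alpha>) * ennreal ((snd (G z))\<^sup>2) \<partial>lborel) < \<infinity>"
  obtains g where "g \<in> borel_measurable borel"
    "AE z in lborel. z \<in> UNIV \<times> I \<longrightarrow>
       U z = g (fst z) + snd z * (LINT m:{0<..1}|lborel. snd (G (fst z, m * snd z)))"
proof -
  let ?D = "UNIV \<times> I :: ('a \<times> real) set"
  have l: "locally_integrable ?D U" "locally_integrable ?D G"
    using G by (auto simp: has_weak_gradient_def)
  define U0 where "U0 z = indicator ?D z * U z" for z
  define f where "f z = snd (indicator ?D z *\<^sub>R G z)" for z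
  have [measurable]: "U0 \<in> borel_measurable borel"
    using locally_integrable_measurable[OF open_cylinder l(1)] by (simp add: U0_def[abs_def])
  have [measurable]: "f \<in> borel_measurable borel"
    unfolding f_def by (intro measurable_snd_borel locally_integrable_measurable[OF open_cylinder l(2)])
  have f_eq: "f (x, m * y) = snd (G (x, m * y))" if "y \<in> I" "0 < m" "m \<le> 1" for x m y
    using contract[OF that] by (simp add: f_def indicator_def)
  define c where "c z = U0 z - snd z * (LINT m|lborel. indicator {0<..1} m * f (fst z, m * snd z))" for z
  have [measurable]: "c \<in> borel_measurable borel" unfolding c_def by measurable
  have "(\<integral>\<^sup>+z\<in>?D. ennreal (snd z powr \<alpha>) * ennreal ((f z)\<^sup>2) \<partial>lborel) < \<infinity>"
  proof -
    have "(\<integral>\<^sup>+z\<in>?D. ennreal (snd z powr \<alpha>) * ennreal ((f z)\<^sup>2) \<partial>lborel)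
        = (\<integral>\<^sup>+z\<in>?D. ennreal (snd z powr \<alpha>) * ennreal ((snd (G z))\<^sup>2) \<partial>lborel)"
      by (intro nn_integral_cong) (auto simp: f_def indicator_def)
    then show ?thesis using fin by simp
  qed
  from AE_vertically_integrable[OF _ \<alpha> this]
  have int: "AE z in lborel. z \<in> ?D \<longrightarrow> set_integrable lborel {0<..1} (\<lambda>m. f (fst z, m * snd z))"
    by simp
  have inv1: "AE z in lborel. 0 < r \<and> r < 1 \<and> z \<in> ?D \<longrightarrow> c (fst z, r * snd z) = c z" for r :: real
  proof (cases "0 < r \<and> r < 1")
    case True
    have "AE z in lborel. z \<in> ?D \<longrightarrow> U (dilate {(0, 1)} 1 z) - U (dilate {(0, 1)} r z)
      = (LINT m:{r..1}|lborel. G (dilate {(0, 1)} m z) \<bullet> axis_proj {(0, 1)} z)"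
      by (rule weak_gradient_along_dilations[OF open_cylinder G])
        (use True contract in \<open>auto simp: vertical_in_Basis dilate_vertical\<close>)
    then show ?thesis
      using int
    proof eventually_elim
      case (elim z)
      show ?case
      proof
        assume "0 < r \<and> r < 1 \<and> z \<in> ?D"
        then have z': "z \<in> ?D" by blast
        obtain x y where z: "z = (x, y)" by (cases z)
        have y: "y \<in> I" "r * y \<in> I" using z' contract True by (auto simp: z)
        let ?J = "\<lambda>A. LINT m|lborel. indicator A m * f (x, m * y)"
        have i: "set_integrable lborel A (\<lambda>m. f (x, m * y))" if "A \<in> sets borel" "A \<subseteq> {0<..1}" for A
          using elim(2) z' that by (auto simp: z intro: set_integrable_subset)
        have diff: "U (x, y) - U (x, r * y) = y * ?J {r<..1}"
        proof -
          have "U (x, y) - U (x, r * y) = (LINT m:{r..1}|lborel. snd (G (x, m * y)) * y)"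
            using elim(1) z' by (simp add: z dilate_vertical axis_proj_vertical inner_prod_def)
          also have "\<dots> = (LINT m|lborel. y * (indicator {r..1} m * f (x, m * y)))"
            unfolding set_lebesgue_integral_def
            by (rule Bochner_Integration.integral_cong) (use True f_eq[OF y(1)] in \<open>auto simp: indicator_def\<close>)
          also have "\<dots> = (LINT m|lborel. y * (indicator {r<..1} m * f (x, m * y)))"
          proof (rule integral_cong_AE)
            show "AE m in lborel. y * (indicator {r..1} m * f (x, m * y)) = y * (indicator {r<..1} m * f (x, m * y))"
              using AE_lborel_singleton[of r] by eventually_elim (auto simp: indicator_def)
          qed measurable
          finally show ?thesis by simp
        qed
        have split: "?J {0<..1} = ?J {0<..r} + ?J {r<..1}"
        proof -
          have "{0<..1} = {0<..r} \<union> {r<..1}" using True by auto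
          then show ?thesis
            using set_integral_Un[of "{0<..r}" "{r<..1}" lborel "\<lambda>m. f (x, m * y)"] True
            by (simp add: i set_lebesgue_integral_def)
        qed
        have "?J {0<..r} = r * (LINT m|lborel. indicator {0<..r} (0 + r * m) * f (x, (0 + r * m) * y))"
          using True lborel_integral_real_affine[of r "\<lambda>m. indicator {0<..r} m * f (x, m * y)" 0] by simp
        also have "(LINT m|lborel. indicator {0<..r} (0 + r * m) * f (x, (0 + r * m) * y))
            = (LINT m|lborel. indicator {0<..1} m * f (x, m * (r * y)))"
          by (rule Bochner_Integration.integral_cong)
            (use True in \<open>auto simp: indicator_def zero_less_mult_iff mult_ac\<close>)
        finally show "c (fst z, r * snd z) = c z"
          using diff split y by (simp add: c_def z U0_def algebra_simps)
      qed
    qed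
  qed auto
  define P where "P z r \<longleftrightarrow> (0 < r \<and> r < 1 \<and> z \<in> ?D \<longrightarrow> c (fst z, r * snd z) = c z)" for z r
  have "{p \<in> space (lborel \<Otimes>\<^sub>M lborel). P (fst p) (snd p)} \<in> sets (lborel \<Otimes>\<^sub>M lborel)"
    unfolding P_def by measurable
  from lborel_pair.AE_commute[OF this]
  have "AE z in lborel. AE r in lborel. 0 < r \<and> r < 1 \<and> z \<in> ?D \<longrightarrow> c (fst z, r * snd z) = c z"
    using inv1 unfolding P_def by blast
  then have "AE z in lborel \<Otimes>\<^sub>M lborel. AE r in lborel. 0 < r \<and> r < 1 \<and> z \<in> ?D \<longrightarrow> c (fst z, r * snd z) = c z"
    unfolding lborel_prod .
  from lborel_pair.AE_pair[OF this]
  have inv2: "AE x in lborel. AE y in lborel. AE r in lborel. 0 < r \<and> r < 1 \<and> y \<in> I \<longrightarrow> c (x, r * y) = c (x, y)"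
    by simp
  define g where "g x = (LINT t|lborel. indicator {0<..<h} t * c (x, t)) / h" for x
  have [measurable]: "g \<in> borel_measurable borel" unfolding g_def by measurable
  have "AE x in lborel. AE y in lborel. y \<in> I \<longrightarrow> c (x, y) = g x"
    using inv2
  proof eventually_elim
    case (elim x)
    have "\<exists>k. AE y in lborel. y \<in> I \<longrightarrow> c (x, y) = k"
    proof (rule constant_if_dilation_invariant[OF _ h_I h_pos I_pos])
      show "AE y in lborel. y \<in> I \<longrightarrow> (AE m in lborel. 0 < m \<and> m < 1 \<longrightarrow> c (x, m * y) = c (x, y))"
        using elim by eventually_elim auto
    qed measurable
    then obtain k where k: "AE y in lborel. y \<in> I \<longrightarrow> c (x, y) = k" by blast
    have "(LINT t|lborel. indicator {0<..<h} t * c (x, t)) = (LINT t|lborel. indicator {0<..<h} t * k)"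
    proof (rule integral_cong_AE)
      show "AE t in lborel. indicator {0<..<h} t * c (x, t) = indicator {0<..<h} t * k"
        using k by eventually_elim (use h_I in \<open>auto simp: indicator_def\<close>)
    qed measurable
    also have "\<dots> = k * h" using h_pos by simp
    finally have "g x = k" using h_pos by (simp add: g_def)
    then show ?case using k by simp
  qed
  then have "AE z in lborel \<Otimes>\<^sub>M lborel. snd z \<in> I \<longrightarrow> c z = g (fst z)"
  proof (intro lborel_pair.AE_pair_measure)
    show "{z \<in> space (lborel \<Otimes>\<^sub>M lborel). snd z \<in> I \<longrightarrow> c z = g (fst z)} \<in> sets (lborel \<Otimes>\<^sub>M lborel)"
      unfolding lborel_prod by measurable
  qed auto
  then have "AE z in lborel. z \<in> ?D \<longrightarrow> c z = g (fst z)"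
    unfolding lborel_prod by eventually_elim auto
  then have "AE z in lborel. z \<in> ?D \<longrightarrow>
       U z = g (fst z) + snd z * (LINT m:{0<..1}|lborel. snd (G (fst z, m * snd z)))"
  proof eventually_elim
    case (elim z)
    show ?case
    proof
      assume z: "z \<in> ?D"
      have "(LINT m:{0<..1}|lborel. snd (G (fst z, m * snd z)))
          = (LINT m|lborel. indicator {0<..1} m * f (fst z, m * snd z))"
        unfolding set_lebesgue_integral_def
        by (rule Bochner_Integration.integral_cong) (use z f_eq in \<open>auto simp: indicator_def\<close>)
      then show "U z = g (fst z) + snd z * (LINT m:{0<..1}|lborel. snd (G (fst z, m * snd z)))"
        using elim z by (simp add: c_def U0_def)
    qed
  qed
  then show ?thesis using that[of g] by simp
qed

end

lemma AE_lborel_fst: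
  assumes "AE x in lborel. P x"
  shows "AE z in (lborel :: ('a::euclidean_space \<times> 'b::euclidean_space) measure). P (fst z)"
proof -
  obtain N where N: "{x \<in> space lborel. \<not> P x} \<subseteq> N" "emeasure lborel N = 0" "N \<in> sets lborel"
    using assms by (rule AE_E)
  have "AE z in (lborel \<Otimes>\<^sub>M lborel :: ('a \<times> 'b) measure). fst z \<notin> N"
  proof (rule lborel_pair.AE_pair_measure)
    show "{z \<in> space (lborel \<Otimes>\<^sub>M lborel). fst z \<notin> N} \<in> sets (lborel \<Otimes>\<^sub>M (lborel :: 'b measure))"
      using N(3) by measurable
    have "AE x in lborel. x \<notin> N" using N by (intro AE_not_in) auto
    then show "AE x in lborel. AE y in (lborel :: 'b measure). fst (x, y) \<notin> N" by eventually_elim auto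
  qed
  then show ?thesis unfolding lborel_prod by eventually_elim (use N(1) in auto)
qed

lemma square_add_le: "(a + b)\<^sup>2 \<le> 2 * a\<^sup>2 + 2 * (b::real)\<^sup>2"
  using zero_le_power2[of "a - b"] by (simp add: power2_eq_square algebra_simps)

context heights
begin

text \<open>Both bounds estimate the mean in the trace representation: the first, Hardy's inequality, by
  \<open>vertical_mean_bound\<close>; the second by Cauchy--Schwarz on a single slice with weight \<open>m powr \<alpha>\<close>,
  whose inverse is integrable at 0 because \<open>\<alpha> < 1\<close>. The second bound tends to 0 with \<open>y\<close>, so
  that \<open>g\<close> is the trace.\<close>

lemma trace_bounds:
  fixes U :: "'a::euclidean_space \<times> real \<Rightarrow> real"
  assumes G: "has_weak_gradient (UNIV \<times> I) U G" and \<alpha>: "-1 < \<alpha>" "\<alpha> < 1"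
    and fin: "(\<integral>\<^sup>+z\<in>UNIV \<times> I. ennreal (snd z powr \<alpha>) * ennreal ((snd (G z))\<^sup>2) \<partial>lborel) < \<infinity>"
      (is "?E < \<infinity>")
  obtains g where "g \<in> borel_measurable borel"
    "(\<integral>\<^sup>+z\<in>UNIV \<times> I. ennreal (snd z powr (\<alpha> - 2)) * ennreal ((U z - g (fst z))\<^sup>2) \<partial>lborel)
      \<le> ennreal (4 / (1 - \<alpha>)\<^sup>2) * ?E"
    "AE y in lborel. y \<in> I \<longrightarrow>
      (\<integral>\<^sup>+x. ennreal ((U (x, y) - g x)\<^sup>2) \<partial>lborel) \<le> ennreal (y powr (1 - \<alpha>) / (1 - \<alpha>)) * ?E"
proof -
  let ?D = "UNIV \<times> I :: ('a \<times> real) set"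
  have l: "locally_integrable ?D U" "locally_integrable ?D G"
    using G by (auto simp: has_weak_gradient_def)
  define f where "f z = snd (indicator ?D z *\<^sub>R G z)" for z
  have [measurable]: "f \<in> borel_measurable borel"
    unfolding f_def by (intro measurable_snd_borel locally_integrable_measurable[OF open_cylinder l(2)])
  have f_eq: "f (x, m * y) = snd (G (x, m * y))" if "y \<in> I" "0 < m" "m \<le> 1" for x m y
    using contract[OF that] by (simp add: f_def indicator_def)
  have E: "?E = (\<integral>\<^sup>+z\<in>?D. ennreal (snd z powr \<alpha>) * ennreal ((f z)\<^sup>2) \<partial>lborel)"
    by (intro nn_integral_cong) (auto simp: f_def indicator_def)
  obtain g where g[measurable]: "g \<in> borel_measurable borel"
    and eq: "AE z in lborel. z \<in> ?D \<longrightarrow>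
       U z = g (fst z) + snd z * (LINT m:{0<..1}|lborel. snd (G (fst z, m * snd z)))"
    by (rule trace_representation[OF G \<alpha> fin])
  let ?N = "\<lambda>z. \<integral>\<^sup>+m\<in>{0<..1}. ennreal \<bar>f (fst z, m * snd z)\<bar> \<partial>lborel"
  have diff: "AE z in lborel. z \<in> ?D \<longrightarrow> ennreal ((U z - g (fst z))\<^sup>2) \<le> ennreal ((snd z)\<^sup>2) * (?N z)\<^sup>2"
    using eq
  proof eventually_elim
    case (elim z)
    show ?case
    proof
      assume z: "z \<in> ?D"
      then have y: "snd z > 0" using I_pos by auto
      let ?L = "LINT m:{0<..1}|lborel. snd (G (fst z, m * snd z))"
      have "ennreal (norm ?L) \<le> (\<integral>\<^sup>+m. ennreal (norm (indicator {0<..1} m *\<^sub>R snd (G (fst z, m * snd z)))) \<partial>lborel)"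
        unfolding set_lebesgue_integral_def by (rule norm_integral_le_nn_integral)
      also have "\<dots> = ?N z"
        by (intro nn_integral_cong) (use z f_eq in \<open>auto simp: indicator_def\<close>)
      finally have "(ennreal (norm ?L))\<^sup>2 \<le> (?N z)\<^sup>2" by (simp add: power_mono)
      then have "ennreal ((snd z)\<^sup>2) * (ennreal (norm ?L))\<^sup>2 \<le> ennreal ((snd z)\<^sup>2) * (?N z)\<^sup>2"
        by (rule mult_left_mono) simp
      moreover have "(U z - g (fst z))\<^sup>2 = (snd z)\<^sup>2 * (norm ?L)\<^sup>2"
        using elim z by (simp add: power_mult_distrib)
      ultimately show "ennreal ((U z - g (fst z))\<^sup>2) \<le> ennreal ((snd z)\<^sup>2) * (?N z)\<^sup>2"
        by (simp add: ennreal_mult ennreal_power)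
    qed
  qed
  have "(\<integral>\<^sup>+z\<in>?D. ennreal (snd z powr (\<alpha> - 2)) * ennreal ((U z - g (fst z))\<^sup>2) \<partial>lborel)
      \<le> (\<integral>\<^sup>+z\<in>?D. ennreal (snd z powr \<alpha>) * (?N z)\<^sup>2 \<partial>lborel)"
  proof (rule nn_integral_mono_AE, use diff in eventually_elim)
    case (elim z)
    show ?case
    proof (cases "z \<in> ?D")
      case True
      then have y: "snd z > 0" using I_pos by auto
      have "ennreal (snd z powr (\<alpha> - 2)) * ennreal ((U z - g (fst z))\<^sup>2)
          \<le> ennreal (snd z powr (\<alpha> - 2)) * (ennreal ((snd z)\<^sup>2) * (?N z)\<^sup>2)"
        using elim True by (intro mult_left_mono) auto
      also have "\<dots> = ennreal (snd z powr (\<alpha> - 2) * (snd z)\<^sup>2) * (?N z)\<^sup>2"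
        by (simp add: ennreal_mult mult.assoc)
      also have "snd z powr (\<alpha> - 2) * (snd z)\<^sup>2 = snd z powr \<alpha>"
        using y by (simp add: powr_diff)
      finally show ?thesis using True by simp
    qed simp
  qed
  also have "\<dots> \<le> ennreal (4 / (1 - \<alpha>)\<^sup>2) * ?E"
    unfolding E by (rule vertical_mean_bound[OF _ \<alpha>]) measurable
  finally have 1: "(\<integral>\<^sup>+z\<in>?D. ennreal (snd z powr (\<alpha> - 2)) * ennreal ((U z - g (fst z))\<^sup>2) \<partial>lborel)
      \<le> ennreal (4 / (1 - \<alpha>)\<^sup>2) * ?E" .
  have c: "(\<integral>\<^sup>+m\<in>{0<..1::real}. ennreal (1 / m powr \<alpha>) \<partial>lborel) = ennreal (1 / (1 - \<alpha>))"
  proof -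
    have "(\<integral>\<^sup>+m\<in>{0<..1::real}. ennreal (1 / m powr \<alpha>) \<partial>lborel) = (\<integral>\<^sup>+m\<in>{0<..1::real}. ennreal (m powr - \<alpha>) \<partial>lborel)"
      by (simp add: powr_minus_divide)
    also have "\<dots> = ennreal (1 / (1 - \<alpha>))"
      using \<alpha> by (subst nn_integral_powr_Ioc) auto
    finally show ?thesis .
  qed
  define S where "S t = (\<integral>\<^sup>+x. ennreal ((f (x, t))\<^sup>2) \<partial>lborel)" for t
  have [measurable]: "S \<in> borel_measurable borel" unfolding S_def by measurable
  have E2: "?E = (\<integral>\<^sup>+t\<in>I. ennreal (t powr \<alpha>) * S t \<partial>lborel)"
  proof -
    have "?E = (\<integral>\<^sup>+z. ennreal (snd z powr \<alpha>) * ennreal ((f z)\<^sup>2) * indicator I (snd z) \<partial>(lborel \<Otimes>\<^sub>M lborel))"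
      unfolding E lborel_prod by (intro nn_integral_cong) (auto simp: indicator_def)
    also have "\<dots> = (\<integral>\<^sup>+t. \<integral>\<^sup>+x. ennreal (t powr \<alpha>) * ennreal ((f (x, t))\<^sup>2) * indicator I t \<partial>lborel \<partial>lborel)"
      by (subst lborel_pair.nn_integral_snd[symmetric]) (auto simp: lborel_prod)
    also have "\<dots> = (\<integral>\<^sup>+t\<in>I. ennreal (t powr \<alpha>) * S t \<partial>lborel)"
      unfolding S_def by (simp add: nn_integral_cmult nn_integral_multc)
    finally show ?thesis .
  qed
  have "AE y in lborel. AE x in lborel. y \<in> I \<longrightarrow> ennreal ((U (x, y) - g x)\<^sup>2) \<le> ennreal (y\<^sup>2) * (?N (x, y))\<^sup>2"
  proof -
    have "AE z in lborel \<Otimes>\<^sub>M lborel. z \<in> ?D \<longrightarrow> ennreal ((U z - g (fst z))\<^sup>2) \<le> ennreal ((snd z)\<^sup>2) * (?N z)\<^sup>2"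
      unfolding lborel_prod by (rule diff)
    then have "AE z in lborel \<Otimes>\<^sub>M lborel. (case z of (y, x) \<Rightarrow> y \<in> I \<longrightarrow>
        ennreal ((U (x, y) - g x)\<^sup>2) \<le> ennreal (y\<^sup>2) * (?N (x, y))\<^sup>2)"
      by (subst (asm) lborel_pair.distr_pair_swap) (auto dest!: AE_distrD[OF measurable_pair_swap'])
    from lborel_pair.AE_pair[OF this] show ?thesis by simp
  qed
  then have 2: "AE y in lborel. y \<in> I \<longrightarrow>
      (\<integral>\<^sup>+x. ennreal ((U (x, y) - g x)\<^sup>2) \<partial>lborel) \<le> ennreal (y powr (1 - \<alpha>) / (1 - \<alpha>)) * ?E"
  proof eventually_elim
    case (elim y)
    show ?case
    proof
      assume yI: "y \<in> I"
      then have y: "y > 0" using I_pos by auto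
      define Q where "Q m x = ennreal (m powr \<alpha>) * ennreal ((f (x, m * y))\<^sup>2) * indicator {0<..1} m" for m x
      have Qm: "case_prod Q \<in> borel_measurable (lborel \<Otimes>\<^sub>M lborel)" unfolding Q_def by measurable
      have Qm2: "(\<lambda>x. \<integral>\<^sup>+m. Q m x \<partial>lborel) \<in> borel_measurable lborel" unfolding Q_def by measurable
      have N2: "(?N (x, y))\<^sup>2 \<le> ennreal (1 / (1 - \<alpha>)) * (\<integral>\<^sup>+m. Q m x \<partial>lborel)" for x
      proof -
        have "(?N (x, y))\<^sup>2 \<le> (\<integral>\<^sup>+m\<in>{0<..1::real}. ennreal (1 / m powr \<alpha>) \<partial>lborel) *
          (\<integral>\<^sup>+m\<in>{0<..1}. ennreal (m powr \<alpha>) * (ennreal \<bar>f (fst (x, y), m * snd (x, y))\<bar>)\<^sup>2 \<partial>lborel)"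
          by (rule weighted_Cauchy_Schwarz) auto
        then show ?thesis unfolding c Q_def by (simp add: ennreal_power)
      qed
      have "(\<integral>\<^sup>+x. ennreal ((U (x, y) - g x)\<^sup>2) \<partial>lborel) \<le> (\<integral>\<^sup>+x. ennreal (y\<^sup>2 / (1 - \<alpha>)) * (\<integral>\<^sup>+m. Q m x \<partial>lborel) \<partial>lborel)"
      proof (rule nn_integral_mono_AE, use elim in eventually_elim)
        case (elim x)
        have "ennreal ((U (x, y) - g x)\<^sup>2) \<le> ennreal (y\<^sup>2) * (?N (x, y))\<^sup>2" using elim yI by blast
        also have "\<dots> \<le> ennreal (y\<^sup>2) * (ennreal (1 / (1 - \<alpha>)) * (\<integral>\<^sup>+m. Q m x \<partial>lborel))"
          by (rule mult_left_mono[OF N2]) simp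
        also have "\<dots> = ennreal (y\<^sup>2 / (1 - \<alpha>)) * (\<integral>\<^sup>+m. Q m x \<partial>lborel)"
          using \<alpha> by (simp add: mult.assoc[symmetric] ennreal_mult[symmetric])
        finally show ?case .
      qed
      also have "\<dots> = ennreal (y\<^sup>2 / (1 - \<alpha>)) * (\<integral>\<^sup>+x. \<integral>\<^sup>+m. Q m x \<partial>lborel \<partial>lborel)"
        by (rule nn_integral_cmult[OF Qm2])
      also have "(\<integral>\<^sup>+x. \<integral>\<^sup>+m. Q m x \<partial>lborel \<partial>lborel) = (\<integral>\<^sup>+m. \<integral>\<^sup>+x. Q m x \<partial>lborel \<partial>lborel)"
        by (rule lborel_pair.Fubini'[OF Qm])
      also have "\<dots> = (\<integral>\<^sup>+m\<in>{0<..1}. ennreal (m powr \<alpha>) * S (m * y) \<partial>lborel)"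
        unfolding Q_def S_def by (simp add: nn_integral_cmult nn_integral_multc)
      also have "\<dots> \<le> ennreal (y powr (- 1 - \<alpha>)) * ?E"
      proof -
        let ?q = "\<lambda>t. ennreal (t powr \<alpha>) * S t * indicator I t"
        have "(\<integral>\<^sup>+m\<in>{0<..1}. ennreal (m powr \<alpha>) * S (m * y) \<partial>lborel)
            \<le> (\<integral>\<^sup>+m. ennreal (y powr - \<alpha>) * ?q (0 + y * m) \<partial>lborel)"
        proof (rule nn_integral_mono)
          fix m :: real
          show "ennreal (m powr \<alpha>) * S (m * y) * indicator {0<..1} m \<le> ennreal (y powr - \<alpha>) * ?q (0 + y * m)"
          proof (cases "m \<in> {0<..1}")
            case True
            then have "m * y \<in> I" using contract[OF yI] by auto
            moreover have "ennreal (m powr \<alpha>) = ennreal (y powr - \<alpha>) * ennreal ((y * m) powr \<alpha>)"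
              using True y by (simp add: ennreal_mult[symmetric] powr_mult powr_minus field_simps)
            ultimately show ?thesis using True by (simp add: mult.assoc mult.commute[of y m])
          qed simp
        qed
        also have "\<dots> = ennreal (y powr - \<alpha>) * (\<integral>\<^sup>+m. ?q (0 + y * m) \<partial>lborel)"
          by (rule nn_integral_cmult) measurable
        also have "(\<integral>\<^sup>+m. ?q (0 + y * m) \<partial>lborel) = ennreal (1 / y) * (ennreal y * (\<integral>\<^sup>+m. ?q (0 + y * m) \<partial>lborel))"
          using y by (simp add: mult.assoc[symmetric] ennreal_mult[symmetric])
        also have "ennreal y * (\<integral>\<^sup>+m. ?q (0 + y * m) \<partial>lborel) = ?E"
          using nn_integral_real_affine[of ?q y 0] y unfolding E2 by simp
        also have "ennreal (y powr - \<alpha>) * (ennreal (1 / y) * ?E) = ennreal (y powr - \<alpha> * (1 / y)) * ?E"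
          by (subst mult.assoc[symmetric], subst ennreal_mult[symmetric]) (use y in auto)
        also have "y powr - \<alpha> * (1 / y) = y powr (- 1 - \<alpha>)"
          using y powr_add[of y "- 1" "- \<alpha>"] by (simp add: powr_minus_divide[of y 1])
        finally show ?thesis .
      qed
      finally have "(\<integral>\<^sup>+x. ennreal ((U (x, y) - g x)\<^sup>2) \<partial>lborel)
          \<le> ennreal (y\<^sup>2 / (1 - \<alpha>)) * (ennreal (y powr (- 1 - \<alpha>)) * ?E)"
        by (simp add: mult_left_mono)
      also have "\<dots> = ennreal (y\<^sup>2 / (1 - \<alpha>) * y powr (- 1 - \<alpha>)) * ?E"
        by (subst mult.assoc[symmetric], subst ennreal_mult[symmetric]) (use \<alpha> in auto)
      also have "y\<^sup>2 / (1 - \<alpha>) * y powr (- 1 - \<alpha>) = y powr (1 - \<alpha>) / (1 - \<alpha>)"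
        using y powr_add[of y 2 "- 1 - \<alpha>"] by simp
      finally show "(\<integral>\<^sup>+x. ennreal ((U (x, y) - g x)\<^sup>2) \<partial>lborel)
          \<le> ennreal (y powr (1 - \<alpha>) / (1 - \<alpha>)) * ?E" .
    qed
  qed
  show ?thesis by (rule that[OF g 1 2])
qed

end

section \<open>The energy space\<close>

text \<open>The two parts of the squared norm of \<open>H1rho\<close>, as extended nonnegative integrals: they are
  estimated separately, and without any regard to integrability.\<close>

definition grad_energy :: "real \<Rightarrow> ((real ^ 'd) \<times> real) set \<Rightarrow> ((real ^ 'd) \<times> real \<Rightarrow> real) \<Rightarrow> ennreal" where
  "grad_energy \<alpha> D U = (\<integral>\<^sup>+z\<in>D. ennreal (snd z powr \<alpha>) * ennreal ((norm (weak_grad D U z))\<^sup>2) \<partial>lborel)"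

definition mass_energy :: "real \<Rightarrow> ((real ^ 'd) \<times> real) set \<Rightarrow> ((real ^ 'd) \<times> real \<Rightarrow> real) \<Rightarrow> ennreal" where
  "mass_energy \<alpha> D U = (\<integral>\<^sup>+z\<in>D. ennreal (snd z powr \<alpha>) * ennreal ((U z)\<^sup>2 / (rho z)\<^sup>2) \<partial>lborel)"

lemma rho_squared: "(rho z)\<^sup>2 = 1 + (norm (fst z))\<^sup>2 + (snd z)\<^sup>2"
  unfolding rho_def by (simp add: add_nonneg_nonneg)

lemma rho_ge_1: "rho z \<ge> 1"
  unfolding rho_def by (simp add: add_nonneg_nonneg)

lemma measurable_rho [measurable]: "rho \<in> borel_measurable borel"
  unfolding rho_def[abs_def] by measurable

lemma nn_integral_linear:
  assumes [measurable]: "f \<in> borel_measurable M" "g \<in> borel_measurable M"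
  shows "(\<integral>\<^sup>+x. a * f x + b * g x \<partial>M) = a * (\<integral>\<^sup>+x. f x \<partial>M) + b * (\<integral>\<^sup>+x. g x \<partial>M)"
  by (subst nn_integral_add) (auto simp: nn_integral_cmult)

lemma sets_borel_ball [measurable]: "ball (x :: 'a::metric_space) r \<in> sets borel"
  by (simp add: borel_open)

lemma measurable_indicator_times:
  fixes f :: "'a::euclidean_space \<Rightarrow> real"
  assumes "open D" "locally_integrable D f"
  shows "(\<lambda>z. indicator D z * f z) \<in> borel_measurable borel"
  using locally_integrable_measurable[OF assms] by simp

context heights
begin

lemma measurable_H1rho:
  fixes U :: "(real ^ 'd) \<times> real \<Rightarrow> real"
  assumes "has_weak_gradient (UNIV \<times> I) U G"
  shows "(\<lambda>z. indicator (UNIV \<times> I) z * U z) \<in> borel_measurable borel"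
    and "(\<lambda>z. indicator (UNIV \<times> I) z *\<^sub>R G z) \<in> borel_measurable borel"
  using assms measurable_indicator_times[OF open_cylinder] locally_integrable_measurable[OF open_cylinder]
  by (auto simp: has_weak_gradient_def)

lemma measurable_slice:
  fixes U :: "(real ^ 'd) \<times> real \<Rightarrow> real"
  assumes U: "has_weak_gradient (UNIV \<times> I) U G" and y: "y \<in> I"
  shows "(\<lambda>x. U (x, y)) \<in> borel_measurable borel"
proof -
  have "(\<lambda>x. (x, y)) \<in> borel_measurable borel"
    by (rule borel_measurable_continuous_onI) (intro continuous_intros)
  from measurable_compose[OF this measurable_H1rho(1)[OF U]] show ?thesis
    using y by (simp add: indicator_def)
qed

lemma H1rho_weak_gradient:
  "U \<in> H1rho \<alpha> D \<Longrightarrow> has_weak_gradient D U (weak_grad D U)"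
  unfolding H1rho_def using has_weak_gradient_weak_grad by blast

lemma nn_integral_H1rho_density:
  fixes U :: "(real ^ 'd) \<times> real \<Rightarrow> real"
  assumes "has_weak_gradient (UNIV \<times> I) U (weak_grad (UNIV \<times> I) U)"
  shows "(\<lambda>z. indicator (UNIV \<times> I) z * H1rho_density \<alpha> (UNIV \<times> I) U z) \<in> borel_measurable borel"
    and "(\<integral>\<^sup>+z. ennreal (indicator (UNIV \<times> I) z * H1rho_density \<alpha> (UNIV \<times> I) U z) \<partial>lborel)
      = grad_energy \<alpha> (UNIV \<times> I) U + mass_energy \<alpha> (UNIV \<times> I) U"
proof -
  let ?D = "UNIV \<times> I :: ((real ^ 'd) \<times> real) set"
  let ?G = "weak_grad ?D U"
  note [measurable] = measurable_H1rho[OF assms]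
  have 1: "indicator ?D z * H1rho_density \<alpha> ?D U z = snd z powr \<alpha> * (norm (indicator ?D z *\<^sub>R ?G z))\<^sup>2
      + snd z powr \<alpha> * ((indicator ?D z * U z)\<^sup>2 / (rho z)\<^sup>2)" for z
    by (auto simp: H1rho_density_def indicator_def algebra_simps)
  show "(\<lambda>z. indicator ?D z * H1rho_density \<alpha> ?D U z) \<in> borel_measurable borel"
    unfolding 1 by measurable
  have "(\<integral>\<^sup>+z. ennreal (indicator ?D z * H1rho_density \<alpha> ?D U z) \<partial>lborel)
      = (\<integral>\<^sup>+z. ennreal (snd z powr \<alpha> * (norm (indicator ?D z *\<^sub>R ?G z))\<^sup>2) \<partial>lborel)
      + (\<integral>\<^sup>+z. ennreal (snd z powr \<alpha> * ((indicator ?D z * U z)\<^sup>2 / (rho z)\<^sup>2)) \<partial>lborel)"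
    unfolding 1
  proof (subst nn_integral_add[symmetric])
    show "(\<lambda>z. ennreal (snd z powr \<alpha> * (norm (indicator ?D z *\<^sub>R ?G z))\<^sup>2)) \<in> borel_measurable lborel"
      "(\<lambda>z. ennreal (snd z powr \<alpha> * ((indicator ?D z * U z)\<^sup>2 / (rho z)\<^sup>2))) \<in> borel_measurable lborel"
      by measurable
  qed (simp add: ennreal_plus)
  also have "(\<integral>\<^sup>+z. ennreal (snd z powr \<alpha> * (norm (indicator ?D z *\<^sub>R ?G z))\<^sup>2) \<partial>lborel) = grad_energy \<alpha> ?D U"
    unfolding grad_energy_def by (intro nn_integral_cong) (auto simp: indicator_def ennreal_mult)
  also have "(\<integral>\<^sup>+z. ennreal (snd z powr \<alpha> * ((indicator ?D z * U z)\<^sup>2 / (rho z)\<^sup>2)) \<partial>lborel) = mass_energy \<alpha> ?D U"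
    unfolding mass_energy_def
    by (intro nn_integral_cong) (auto simp: indicator_def ennreal_mult simp del: times_divide_eq_right)
  finally show "(\<integral>\<^sup>+z. ennreal (indicator ?D z * H1rho_density \<alpha> ?D U z) \<partial>lborel)
      = grad_energy \<alpha> ?D U + mass_energy \<alpha> ?D U" .
qed

lemma H1rho_density_nonneg: "0 \<le> H1rho_density \<alpha> D U z"
  by (simp add: H1rho_density_def)

lemma H1rho_iff:
  fixes U :: "(real ^ 'd) \<times> real \<Rightarrow> real"
  shows "U \<in> H1rho \<alpha> (UNIV \<times> I) \<longleftrightarrow> has_weak_gradient (UNIV \<times> I) U (weak_grad (UNIV \<times> I) U) \<and>
     grad_energy \<alpha> (UNIV \<times> I) U + mass_energy \<alpha> (UNIV \<times> I) U < \<infinity>" (is "_ \<longleftrightarrow> ?W \<and> ?F")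
proof -
  let ?D = "UNIV \<times> I :: ((real ^ 'd) \<times> real) set"
  have "set_integrable lborel ?D (H1rho_density \<alpha> ?D U) \<longleftrightarrow> ?F" if ?W
    unfolding set_integrable_def
    using nn_integral_H1rho_density[OF that, of \<alpha>] H1rho_density_nonneg[of \<alpha> ?D U]
    by (subst integrable_iff_bounded) (simp add: abs_mult)
  then show ?thesis
    unfolding H1rho_def using has_weak_gradient_weak_grad by blast
qed

lemma H1rho_norm_squared:
  fixes U :: "(real ^ 'd) \<times> real \<Rightarrow> real"
  assumes "U \<in> H1rho \<alpha> (UNIV \<times> I)"
  shows "ennreal ((H1rho_norm \<alpha> (UNIV \<times> I) U)\<^sup>2) = grad_energy \<alpha> (UNIV \<times> I) U + mass_energy \<alpha> (UNIV \<times> I) U"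
proof -
  let ?D = "UNIV \<times> I :: ((real ^ 'd) \<times> real) set"
  have i: "integrable lborel (\<lambda>z. indicator ?D z * H1rho_density \<alpha> ?D U z)"
    using assms by (simp add: H1rho_def set_integrable_def)
  have "0 \<le> (LINT z:?D|lborel. H1rho_density \<alpha> ?D U z)"
    unfolding set_lebesgue_integral_def by (simp add: H1rho_density_nonneg)
  then have "(H1rho_norm \<alpha> ?D U)\<^sup>2 = (LINT z|lborel. indicator ?D z * H1rho_density \<alpha> ?D U z)"
    by (simp add: H1rho_norm_def set_lebesgue_integral_def)
  then have "ennreal ((H1rho_norm \<alpha> ?D U)\<^sup>2) = (\<integral>\<^sup>+z. ennreal (indicator ?D z * H1rho_density \<alpha> ?D U z) \<partial>lborel)"
    using nn_integral_eq_integral[OF i] by (simp add: H1rho_density_nonneg)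
  then show ?thesis
    using nn_integral_H1rho_density(2)[OF H1rho_weak_gradient[OF assms]] by simp
qed

text \<open>Two traces are both close to one common slice of \<open>U\<close> on each ball, for a suitable small
  height outside the two exceptional null sets.\<close>

lemma is_trace0_unique:
  fixes U :: "(real ^ 'd) \<times> real \<Rightarrow> real"
  assumes U: "has_weak_gradient (UNIV \<times> I) U G" and g: "is_trace0 U g" and g': "is_trace0 U g'"
  shows "AE x in lborel. g x = g' x"
proof -
  have [measurable]: "g \<in> borel_measurable borel" "g' \<in> borel_measurable borel"
    using g g' by (auto simp: is_trace0_def)
  have "AE x in lborel. x \<in> ball 0 R \<longrightarrow> g x = g' x" if R: "R > 0" for R :: real
  proof -
    have small: "(\<integral>\<^sup>+x\<in>ball 0 R. ennreal ((g x - g' x)\<^sup>2) \<partial>lborel) \<le> 0 + ennreal e" if e: "e > 0" for e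
    proof -
      have "e / 4 > 0" using e by simp
      then obtain d d' where d: "d > 0" "AE y in lborel. 0 < y \<and> y < d \<longrightarrow>
            (\<integral>\<^sup>+x\<in>ball 0 R. ennreal ((U (x, y) - g x)\<^sup>2) \<partial>lborel) < ennreal (e / 4)"
          "d' > 0" "AE y in lborel. 0 < y \<and> y < d' \<longrightarrow>
            (\<integral>\<^sup>+x\<in>ball 0 R. ennreal ((U (x, y) - g' x)\<^sup>2) \<partial>lborel) < ennreal (e / 4)"
        using g g' R unfolding is_trace0_def by meson
      from d(2,4) have "AE y in lborel. (0 < y \<and> y < d \<longrightarrow>
            (\<integral>\<^sup>+x\<in>ball 0 R. ennreal ((U (x, y) - g x)\<^sup>2) \<partial>lborel) < ennreal (e / 4)) \<and>
          (0 < y \<and> y < d' \<longrightarrow>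
            (\<integral>\<^sup>+x\<in>ball 0 R. ennreal ((U (x, y) - g' x)\<^sup>2) \<partial>lborel) < ennreal (e / 4))"
        by eventually_elim blast
      then obtain y where "0 < y" "y < min h (min d d')" and "(0 < y \<and> y < d \<longrightarrow>
            (\<integral>\<^sup>+x\<in>ball 0 R. ennreal ((U (x, y) - g x)\<^sup>2) \<partial>lborel) < ennreal (e / 4)) \<and>
          (0 < y \<and> y < d' \<longrightarrow>
            (\<integral>\<^sup>+x\<in>ball 0 R. ennreal ((U (x, y) - g' x)\<^sup>2) \<partial>lborel) < ennreal (e / 4))"
        by (rule AE_lborel_Ioo_obtains[of _ 0 "min h (min d d')"]) (use d h_pos in auto)
      then have y: "y \<in> I" "(\<integral>\<^sup>+x\<in>ball 0 R. ennreal ((U (x, y) - g x)\<^sup>2) \<partial>lborel) < ennreal (e / 4)"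
          "(\<integral>\<^sup>+x\<in>ball 0 R. ennreal ((U (x, y) - g' x)\<^sup>2) \<partial>lborel) < ennreal (e / 4)"
        using h_I by auto
      note [measurable] = measurable_slice[OF U y(1)]
      have "(\<integral>\<^sup>+x\<in>ball 0 R. ennreal ((g x - g' x)\<^sup>2) \<partial>lborel)
          \<le> (\<integral>\<^sup>+x. 2 * (ennreal ((U (x, y) - g x)\<^sup>2) * indicator (ball 0 R) x)
            + 2 * (ennreal ((U (x, y) - g' x)\<^sup>2) * indicator (ball 0 R) x) \<partial>lborel)"
      proof (rule nn_integral_mono)
        fix x
        have "(g x - g' x)\<^sup>2 \<le> 2 * (U (x, y) - g x)\<^sup>2 + 2 * (U (x, y) - g' x)\<^sup>2"
          using square_add_le[of "- (U (x, y) - g x)" "U (x, y) - g' x"] by (simp add: power2_commute)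
        then have "ennreal ((g x - g' x)\<^sup>2) \<le> ennreal (2 * (U (x, y) - g x)\<^sup>2 + 2 * (U (x, y) - g' x)\<^sup>2)"
          by (rule ennreal_leI)
        then show "ennreal ((g x - g' x)\<^sup>2) * indicator (ball 0 R) x
          \<le> 2 * (ennreal ((U (x, y) - g x)\<^sup>2) * indicator (ball 0 R) x)
            + 2 * (ennreal ((U (x, y) - g' x)\<^sup>2) * indicator (ball 0 R) x)"
          by (simp add: ennreal_plus ennreal_mult indicator_def)
      qed
      also have "\<dots> = 2 * (\<integral>\<^sup>+x\<in>ball 0 R. ennreal ((U (x, y) - g x)\<^sup>2) \<partial>lborel)
          + 2 * (\<integral>\<^sup>+x\<in>ball 0 R. ennreal ((U (x, y) - g' x)\<^sup>2) \<partial>lborel)"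
        by (rule nn_integral_linear) measurable
      also have "\<dots> \<le> 2 * ennreal (e / 4) + 2 * ennreal (e / 4)"
        using y by (intro add_mono mult_left_mono) auto
      also have "\<dots> = ennreal e"
        using e ennreal_plus[of "e / 2" "e / 2"] ennreal_mult[of 2 "e / 4"] by simp
      finally show ?thesis by simp
    qed
    have "(\<integral>\<^sup>+x\<in>ball 0 R. ennreal ((g x - g' x)\<^sup>2) \<partial>lborel) \<le> 0"
      by (rule ennreal_le_epsilon[OF small])
    then have "(\<integral>\<^sup>+x\<in>ball 0 R. ennreal ((g x - g' x)\<^sup>2) \<partial>lborel) = 0" by (simp only: le_zero_eq)
    then have "AE x in lborel. ennreal ((g x - g' x)\<^sup>2) * indicator (ball 0 R) x = 0"
      by (subst (asm) nn_integral_0_iff_AE) measurable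
    then show ?thesis by eventually_elim (auto simp: indicator_def split: if_splits)
  qed
  then have "AE x in lborel. \<forall>n. x \<in> ball 0 (real (Suc n)) \<longrightarrow> g x = g' x"
    by (subst AE_all_countable) auto
  then show ?thesis
  proof eventually_elim
    case (elim x)
    obtain n where "norm x < real n" using reals_Archimedean2 by blast
    then have "x \<in> ball 0 (real (Suc n))" by simp
    then show ?case using elim by blast
  qed
qed

lemma is_trace0_linear:
  fixes U :: "(real ^ 'd) \<times> real \<Rightarrow> real"
  assumes U: "has_weak_gradient (UNIV \<times> I) U G" and V: "has_weak_gradient (UNIV \<times> I) V H"
    and g: "is_trace0 U g" and g': "is_trace0 V g'"
  shows "is_trace0 (\<lambda>z. U z + t * V z) (\<lambda>x. g x + t * g' x)"
  unfolding is_trace0_def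
proof (intro conjI allI impI)
  have [measurable]: "g \<in> borel_measurable borel" "g' \<in> borel_measurable borel"
    using g g' by (auto simp: is_trace0_def)
  show "(\<lambda>x. g x + t * g' x) \<in> borel_measurable lborel" by measurable
  fix R e :: real assume R: "R > 0" and e: "e > 0"
  define e' where "e' = e / (4 * (1 + t\<^sup>2))"
  have t: "1 + t\<^sup>2 > 0" by (simp add: add_pos_nonneg)
  have "e' > 0" using e t by (simp add: e'_def)
  then obtain d d' where d: "d > 0" "AE y in lborel. 0 < y \<and> y < d \<longrightarrow>
        (\<integral>\<^sup>+x\<in>ball 0 R. ennreal ((U (x, y) - g x)\<^sup>2) \<partial>lborel) < ennreal e'"
      "d' > 0" "AE y in lborel. 0 < y \<and> y < d' \<longrightarrow>
        (\<integral>\<^sup>+x\<in>ball 0 R. ennreal ((V (x, y) - g' x)\<^sup>2) \<partial>lborel) < ennreal e'"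
    using g g' R unfolding is_trace0_def by meson
  show "\<exists>\<delta>>0. AE y in lborel. 0 < y \<and> y < \<delta> \<longrightarrow>
      (\<integral>\<^sup>+x\<in>ball 0 R. ennreal ((U (x, y) + t * V (x, y) - (g x + t * g' x))\<^sup>2) \<partial>lborel) < ennreal e"
  proof (intro exI[of _ "min h (min d d')"] conjI)
    show "min h (min d d') > 0" using d h_pos by simp
    show "AE y in lborel. 0 < y \<and> y < min h (min d d') \<longrightarrow>
      (\<integral>\<^sup>+x\<in>ball 0 R. ennreal ((U (x, y) + t * V (x, y) - (g x + t * g' x))\<^sup>2) \<partial>lborel) < ennreal e"
      using d(2,4)
    proof eventually_elim
      case (elim y)
      show ?case
      proof
        assume y: "0 < y \<and> y < min h (min d d')"
        then have yI: "y \<in> I" using h_I by auto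
        note [measurable] = measurable_slice[OF U yI] measurable_slice[OF V yI]
        have "(\<integral>\<^sup>+x\<in>ball 0 R. ennreal ((U (x, y) + t * V (x, y) - (g x + t * g' x))\<^sup>2) \<partial>lborel)
            \<le> (\<integral>\<^sup>+x. 2 * (ennreal ((U (x, y) - g x)\<^sup>2) * indicator (ball 0 R) x)
              + ennreal (2 * t\<^sup>2) * (ennreal ((V (x, y) - g' x)\<^sup>2) * indicator (ball 0 R) x) \<partial>lborel)"
        proof (rule nn_integral_mono)
          fix x
          have "(U (x, y) + t * V (x, y) - (g x + t * g' x))\<^sup>2
              \<le> 2 * (U (x, y) - g x)\<^sup>2 + (2 * t\<^sup>2) * (V (x, y) - g' x)\<^sup>2"
            using square_add_le[of "U (x, y) - g x" "t * (V (x, y) - g' x)"]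
            by (simp add: power_mult_distrib add_diff_add right_diff_distrib[symmetric])
          then have "ennreal ((U (x, y) + t * V (x, y) - (g x + t * g' x))\<^sup>2)
              \<le> ennreal (2 * (U (x, y) - g x)\<^sup>2 + (2 * t\<^sup>2) * (V (x, y) - g' x)\<^sup>2)"
            by (rule ennreal_leI)
          then show "ennreal ((U (x, y) + t * V (x, y) - (g x + t * g' x))\<^sup>2) * indicator (ball 0 R) x
            \<le> 2 * (ennreal ((U (x, y) - g x)\<^sup>2) * indicator (ball 0 R) x)
              + ennreal (2 * t\<^sup>2) * (ennreal ((V (x, y) - g' x)\<^sup>2) * indicator (ball 0 R) x)"
            by (simp add: ennreal_plus ennreal_mult indicator_def)
        qed
        also have "\<dots> = 2 * (\<integral>\<^sup>+x\<in>ball 0 R. ennreal ((U (x, y) - g x)\<^sup>2) \<partial>lborel)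
            + ennreal (2 * t\<^sup>2) * (\<integral>\<^sup>+x\<in>ball 0 R. ennreal ((V (x, y) - g' x)\<^sup>2) \<partial>lborel)"
          by (rule nn_integral_linear) measurable
        also have "\<dots> \<le> 2 * ennreal e' + ennreal (2 * t\<^sup>2) * ennreal e'"
          using elim y by (intro add_mono mult_left_mono) auto
        also have "\<dots> = ennreal (2 * e' + 2 * t\<^sup>2 * e')"
          using \<open>e' > 0\<close> by (simp add: ennreal_plus ennreal_mult)
        also have "2 * e' + 2 * t\<^sup>2 * e' = e / 2"
        proof -
          have "e' * (4 * (1 + t\<^sup>2)) = e" using t by (simp add: e'_def)
          then show ?thesis by (simp add: algebra_simps)
        qed
        also have "ennreal (e / 2) < ennreal e" using e by (simp add: ennreal_lessI)
        finally show "(\<integral>\<^sup>+x\<in>ball 0 R. ennreal ((U (x, y) + t * V (x, y) - (g x + t * g' x))\<^sup>2) \<partial>lborel) < ennreal e" .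
      qed
    qed
  qed
qed

lemma trace0_Hardy:
  fixes U :: "(real ^ 'd) \<times> real \<Rightarrow> real"
  assumes U: "U \<in> H1rho \<alpha> (UNIV \<times> I)" and \<alpha>: "-1 < \<alpha>" "\<alpha> < 1"
  shows "is_trace0 U (trace0 U)"
    and "(\<integral>\<^sup>+z\<in>UNIV \<times> I. ennreal (snd z powr (\<alpha> - 2)) * ennreal ((U z - trace0 U (fst z))\<^sup>2) \<partial>lborel)
      \<le> ennreal (4 / (1 - \<alpha>)\<^sup>2) * grad_energy \<alpha> (UNIV \<times> I) U"
proof -
  let ?D = "UNIV \<times> I :: ((real ^ 'd) \<times> real) set"
  let ?G = "weak_grad ?D U"
  have wg: "has_weak_gradient ?D U ?G" and fin: "grad_energy \<alpha> ?D U < \<infinity>"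
    using U by (auto simp: H1rho_iff)
  let ?E = "\<integral>\<^sup>+z\<in>?D. ennreal (snd z powr \<alpha>) * ennreal ((snd (?G z))\<^sup>2) \<partial>lborel"
  have E: "?E \<le> grad_energy \<alpha> ?D U"
    unfolding grad_energy_def
  proof (intro nn_integral_mono mult_right_mono mult_left_mono ennreal_leI)
    fix z show "(snd (?G z))\<^sup>2 \<le> (norm (?G z))\<^sup>2"
      using norm_snd_le[of "snd (?G z)" "fst (?G z)"] abs_le_square_iff[of "snd (?G z)" "norm (?G z)"] by simp
  qed auto
  then have Efin: "?E < \<infinity>" using fin by (rule le_less_trans)
  obtain g where g [measurable]: "g \<in> borel_measurable borel"
    and 1: "(\<integral>\<^sup>+z\<in>?D. ennreal (snd z powr (\<alpha> - 2)) * ennreal ((U z - g (fst z))\<^sup>2) \<partial>lborel)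
      \<le> ennreal (4 / (1 - \<alpha>)\<^sup>2) * ?E"
    and 2: "AE y in lborel. y \<in> I \<longrightarrow>
      (\<integral>\<^sup>+x. ennreal ((U (x, y) - g x)\<^sup>2) \<partial>lborel) \<le> ennreal (y powr (1 - \<alpha>) / (1 - \<alpha>)) * ?E"
    by (rule trace_bounds[OF wg \<alpha> Efin])
  obtain E where E': "?E = ennreal E" "E \<ge> 0" using Efin by (cases ?E) auto
  have tr: "is_trace0 U g"
    unfolding is_trace0_def
  proof (intro conjI allI impI)
    fix R e :: real assume R: "R > 0" and e: "e > 0"
    define \<delta> where "\<delta> = (e * (1 - \<alpha>) / (E + 1)) powr (1 / (1 - \<alpha>))"
    have \<delta>0: "\<delta> > 0" using e \<alpha> E' by (simp add: \<delta>_def)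
    have \<delta>: "\<delta> powr (1 - \<alpha>) = e * (1 - \<alpha>) / (E + 1)"
      using e \<alpha> E' by (simp add: \<delta>_def powr_powr)
    show "\<exists>\<delta>>0. AE y in lborel. 0 < y \<and> y < \<delta> \<longrightarrow>
        (\<integral>\<^sup>+x\<in>ball 0 R. ennreal ((U (x, y) - g x)\<^sup>2) \<partial>lborel) < ennreal e"
    proof (intro exI[of _ "min h \<delta>"] conjI)
      show "AE y in lborel. 0 < y \<and> y < min h \<delta> \<longrightarrow>
        (\<integral>\<^sup>+x\<in>ball 0 R. ennreal ((U (x, y) - g x)\<^sup>2) \<partial>lborel) < ennreal e"
        using 2
      proof eventually_elim
        case (elim y)
        show ?case
        proof
          assume y: "0 < y \<and> y < min h \<delta>"
          then have yI: "y \<in> I" using h_I by auto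
          have "(\<integral>\<^sup>+x\<in>ball 0 R. ennreal ((U (x, y) - g x)\<^sup>2) \<partial>lborel)
              \<le> (\<integral>\<^sup>+x. ennreal ((U (x, y) - g x)\<^sup>2) \<partial>lborel)"
            by (intro nn_integral_mono) (auto simp: indicator_def)
          also have "\<dots> \<le> ennreal (y powr (1 - \<alpha>) / (1 - \<alpha>)) * ennreal E"
            using elim yI E' by simp
          also have "\<dots> = ennreal (y powr (1 - \<alpha>) / (1 - \<alpha>) * E)"
            using \<alpha> E' by (simp add: ennreal_mult del: times_divide_eq_left)
          also have "\<dots> < ennreal e"
          proof (rule ennreal_lessI[OF e])
            have "y powr (1 - \<alpha>) / (1 - \<alpha>) * E \<le> \<delta> powr (1 - \<alpha>) / (1 - \<alpha>) * E"
              using y \<alpha> E' by (intro mult_right_mono divide_right_mono powr_mono2) auto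
            also have "\<dots> = e * (E / (E + 1))"
              using \<alpha> by (simp add: \<delta>)
            also have "\<dots> < e * 1"
              using e E' by (intro mult_strict_left_mono) auto
            finally show "y powr (1 - \<alpha>) / (1 - \<alpha>) * E < e" by simp
          qed
          finally show "(\<integral>\<^sup>+x\<in>ball 0 R. ennreal ((U (x, y) - g x)\<^sup>2) \<partial>lborel) < ennreal e" .
        qed
      qed
    qed (use \<delta>0 h_pos in auto)
  qed measurable
  then show tr0: "is_trace0 U (trace0 U)"
    unfolding trace0_def by (rule someI[of "is_trace0 U"])
  have "AE x in lborel. g x = trace0 U x"
    by (rule is_trace0_unique[OF wg tr tr0])
  then have "AE z in lborel. g (fst z) = trace0 U (fst (z :: (real ^ 'd) \<times> real))"
    by (rule AE_lborel_fst)
  then have "(\<integral>\<^sup>+z\<in>?D. ennreal (snd z powr (\<alpha> - 2)) * ennreal ((U z - trace0 U (fst z))\<^sup>2) \<partial>lborel)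
      = (\<integral>\<^sup>+z\<in>?D. ennreal (snd z powr (\<alpha> - 2)) * ennreal ((U z - g (fst z))\<^sup>2) \<partial>lborel)"
    by (intro nn_integral_cong_AE) (auto elim!: eventually_mono)
  also have "\<dots> \<le> ennreal (4 / (1 - \<alpha>)\<^sup>2) * grad_energy \<alpha> ?D U"
    by (rule order_trans[OF 1 mult_left_mono[OF E]]) simp
  finally show "(\<integral>\<^sup>+z\<in>?D. ennreal (snd z powr (\<alpha> - 2)) * ennreal ((U z - trace0 U (fst z))\<^sup>2) \<partial>lborel)
      \<le> ennreal (4 / (1 - \<alpha>)\<^sup>2) * grad_energy \<alpha> ?D U" .
qed

end

lemma nn_integral_lborel_pair:
  fixes F :: "'a::euclidean_space \<times> 'b::euclidean_space \<Rightarrow> ennreal"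
  assumes "F \<in> borel_measurable borel"
  shows "(\<integral>\<^sup>+z. F z \<partial>lborel) = (\<integral>\<^sup>+x. \<integral>\<^sup>+y. F (x, y) \<partial>lborel \<partial>lborel)"
  unfolding lborel_prod[symmetric]
  by (rule lborel.nn_integral_fst[symmetric]) (use assms in \<open>simp add: lborel_prod\<close>)

context heights
begin

text \<open>Split \<open>U\<close> into its trace, taken constant in \<open>y\<close>, and the rest. Since \<open>y \<le> \<rho>\<close>, Hardy's inequality
  bounds the rest. The trace is constant in \<open>y\<close>, and its weight \<open>y powr \<alpha> / \<rho>\<^sup>2\<close> is at most
  \<open>y powr \<alpha>\<close> for \<open>y \<le> 1\<close> and \<open>y powr (\<alpha> - 2)\<close> for \<open>y \<ge> 1\<close>, which has the finite integral
  \<open>1 / (1 + \<alpha>) + 1 / (1 - \<alpha>)\<close>.\<close>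

lemma mass_le_trace:
  fixes U :: "(real ^ 'd) \<times> real \<Rightarrow> real"
  assumes U: "U \<in> H1rho \<alpha> (UNIV \<times> I)" and \<alpha>: "-1 < \<alpha>" "\<alpha> < 1"
  shows "mass_energy \<alpha> (UNIV \<times> I) U
    \<le> ennreal (2 / (1 + \<alpha>) + 2 / (1 - \<alpha>)) * (\<integral>\<^sup>+x. ennreal ((trace0 U x)\<^sup>2) \<partial>lborel)
      + ennreal (8 / (1 - \<alpha>)\<^sup>2) * grad_energy \<alpha> (UNIV \<times> I) U"
proof -
  let ?D = "UNIV \<times> I :: ((real ^ 'd) \<times> real) set"
  define g where "g = trace0 U"
  have [measurable]: "g \<in> borel_measurable borel"
    using trace0_Hardy(1)[OF U \<alpha>] by (simp add: is_trace0_def g_def)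
  have wg: "has_weak_gradient ?D U (weak_grad ?D U)" using U by (simp add: H1rho_iff)
  note Um [measurable] = measurable_H1rho(1)[OF wg]
  define w where "w y = ennreal (y powr \<alpha>) * indicator {0<..1} y + ennreal (y powr (\<alpha> - 2)) * indicator {1..} y" for y
  have [measurable]: "w \<in> borel_measurable borel" unfolding w_def by measurable
  have w: "(\<integral>\<^sup>+y. w y \<partial>lborel) = ennreal (1 / (1 + \<alpha>) + 1 / (1 - \<alpha>))"
  proof -
    have "(\<integral>\<^sup>+y. w y \<partial>lborel) = (\<integral>\<^sup>+y\<in>{0<..1}. ennreal (y powr \<alpha>) \<partial>lborel) + (\<integral>\<^sup>+y\<in>{1..}. ennreal (y powr (\<alpha> - 2)) \<partial>lborel)"
      unfolding w_def by (rule nn_integral_add) measurable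
    also have "\<dots> = ennreal (1 / (1 + \<alpha>)) + ennreal (1 / (1 - \<alpha>))"
      using \<alpha> by (simp add: nn_integral_powr_Ioc nn_integral_powr_Ici minus_divide_right add.commute)
    also have "\<dots> = ennreal (1 / (1 + \<alpha>) + 1 / (1 - \<alpha>))"
      using \<alpha> by (simp add: ennreal_plus)
    finally show ?thesis .
  qed
  define V where "V z = (indicator ?D z * U z - g (fst z))\<^sup>2" for z
  have [measurable]: "V \<in> borel_measurable borel" unfolding V_def by measurable
  have "mass_energy \<alpha> ?D U \<le> (\<integral>\<^sup>+z. 2 * (w (snd z) * ennreal ((g (fst z))\<^sup>2))
      + 2 * (ennreal (snd z powr (\<alpha> - 2)) * ennreal (V z) * indicator ?D z) \<partial>lborel)"
    unfolding mass_energy_def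
  proof (rule nn_integral_mono)
    fix z :: "(real ^ 'd) \<times> real"
    show "ennreal (snd z powr \<alpha>) * ennreal ((U z)\<^sup>2 / (rho z)\<^sup>2) * indicator ?D z
      \<le> 2 * (w (snd z) * ennreal ((g (fst z))\<^sup>2))
      + 2 * (ennreal (snd z powr (\<alpha> - 2)) * ennreal (V z) * indicator ?D z)"
    proof (cases "z \<in> ?D")
      case True
      let ?y = "snd z"
      have y: "?y > 0" using True I_pos by auto
      have rho: "(rho z)\<^sup>2 \<ge> 1" "(rho z)\<^sup>2 \<ge> ?y\<^sup>2" by (auto simp: rho_squared)
      have b1: "?y powr \<alpha> / (rho z)\<^sup>2 \<le> ?y powr (\<alpha> - 2)"
        using y rho by (auto simp: powr_diff intro!: divide_left_mono mult_pos_pos)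
      have b0: "ennreal (?y powr \<alpha> / (rho z)\<^sup>2) \<le> w ?y"
      proof (cases "?y \<le> 1")
        case True
        have "?y powr \<alpha> / (rho z)\<^sup>2 \<le> ?y powr \<alpha> / 1"
          using rho by (intro divide_left_mono) auto
        then have "ennreal (?y powr \<alpha> / (rho z)\<^sup>2) \<le> ennreal (?y powr \<alpha>)" by (intro ennreal_leI) simp
        also have "\<dots> \<le> w ?y"
          unfolding w_def using True y by (intro add_increasing2) auto
        finally show ?thesis .
      next
        case False
        then show ?thesis using ennreal_leI[OF b1] y by (simp add: w_def)
      qed
      have "(U z)\<^sup>2 \<le> 2 * (g (fst z))\<^sup>2 + 2 * V z"
        using square_add_le[of "g (fst z)" "U z - g (fst z)"] True by (simp add: V_def)
      then have "?y powr \<alpha> / (rho z)\<^sup>2 * (U z)\<^sup>2 \<le> ?y powr \<alpha> / (rho z)\<^sup>2 * (2 * (g (fst z))\<^sup>2 + 2 * V z)"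
        by (rule mult_left_mono) simp
      also have "\<dots> = 2 * (?y powr \<alpha> / (rho z)\<^sup>2 * (g (fst z))\<^sup>2) + 2 * (?y powr \<alpha> / (rho z)\<^sup>2 * V z)"
        by (simp only: distrib_left mult.left_commute)
      also have "\<dots> \<le> 2 * (?y powr \<alpha> / (rho z)\<^sup>2 * (g (fst z))\<^sup>2) + 2 * (?y powr (\<alpha> - 2) * V z)"
        using mult_right_mono[OF b1, of "V z"] by (simp add: V_def)
      finally have "ennreal (?y powr \<alpha> / (rho z)\<^sup>2 * (U z)\<^sup>2)
          \<le> ennreal (2 * (?y powr \<alpha> / (rho z)\<^sup>2 * (g (fst z))\<^sup>2) + 2 * (?y powr (\<alpha> - 2) * V z))"
        by (rule ennreal_leI)
      also have "\<dots> = 2 * (ennreal (?y powr \<alpha> / (rho z)\<^sup>2) * ennreal ((g (fst z))\<^sup>2)) + 2 * (ennreal (?y powr (\<alpha> - 2)) * ennreal (V z))"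
        by (simp add: ennreal_plus ennreal_mult V_def del: times_divide_eq_left times_divide_eq_right)
      also have "\<dots> \<le> 2 * (w ?y * ennreal ((g (fst z))\<^sup>2)) + 2 * (ennreal (?y powr (\<alpha> - 2)) * ennreal (V z))"
        by (intro add_mono mult_left_mono mult_right_mono b0) auto
      finally show ?thesis
        using True by (simp add: ennreal_mult[symmetric])
    qed simp
  qed
  also have "\<dots> = 2 * (\<integral>\<^sup>+z. w (snd z) * ennreal ((g (fst z))\<^sup>2) \<partial>lborel)
      + 2 * (\<integral>\<^sup>+z\<in>?D. ennreal (snd z powr (\<alpha> - 2)) * ennreal (V z) \<partial>lborel)"
    by (rule nn_integral_linear) measurable
  also have "(\<integral>\<^sup>+z. w (snd z) * ennreal ((g (fst z))\<^sup>2) \<partial>lborel)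
      = ennreal (1 / (1 + \<alpha>) + 1 / (1 - \<alpha>)) * (\<integral>\<^sup>+x. ennreal ((g x)\<^sup>2) \<partial>(lborel :: (real ^ 'd) measure))"
    by (subst nn_integral_lborel_pair) (simp_all add: nn_integral_multc nn_integral_cmult w)
  also have "(\<integral>\<^sup>+z\<in>?D. ennreal (snd z powr (\<alpha> - 2)) * ennreal (V z) \<partial>lborel)
      = (\<integral>\<^sup>+z\<in>?D. ennreal (snd z powr (\<alpha> - 2)) * ennreal ((U z - trace0 U (fst z))\<^sup>2) \<partial>lborel)"
    by (intro nn_integral_cong) (auto simp: V_def g_def indicator_def)
  also have "2 * (ennreal (1 / (1 + \<alpha>) + 1 / (1 - \<alpha>)) * (\<integral>\<^sup>+x. ennreal ((g x)\<^sup>2) \<partial>(lborel :: (real ^ 'd) measure)))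
      + 2 * \<dots> \<le> 2 * (ennreal (1 / (1 + \<alpha>) + 1 / (1 - \<alpha>)) * (\<integral>\<^sup>+x. ennreal ((g x)\<^sup>2) \<partial>(lborel :: (real ^ 'd) measure)))
      + 2 * (ennreal (4 / (1 - \<alpha>)\<^sup>2) * grad_energy \<alpha> ?D U)"
    by (intro add_left_mono mult_left_mono trace0_Hardy(2)[OF U \<alpha>]) simp
  also have "\<dots> = ennreal (2 / (1 + \<alpha>) + 2 / (1 - \<alpha>)) * (\<integral>\<^sup>+x. ennreal ((g x)\<^sup>2) \<partial>(lborel :: (real ^ 'd) measure))
      + ennreal (8 / (1 - \<alpha>)\<^sup>2) * grad_energy \<alpha> ?D U"
  proof -
    have "2 * ennreal (1 / (1 + \<alpha>) + 1 / (1 - \<alpha>)) = ennreal (2 / (1 + \<alpha>) + 2 / (1 - \<alpha>))"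
      using \<alpha> ennreal_mult[of 2 "1 / (1 + \<alpha>) + 1 / (1 - \<alpha>)"] by (simp add: distrib_left)
    moreover have "2 * ennreal (4 / (1 - \<alpha>)\<^sup>2) = ennreal (8 / (1 - \<alpha>)\<^sup>2)"
      using ennreal_mult[of 2 "4 / (1 - \<alpha>)\<^sup>2"] by simp
    ultimately show ?thesis by (simp add: mult.assoc[symmetric])
  qed
  finally show ?thesis by (simp add: g_def)
qed

text \<open>Averaging over heights up to \<open>min 1 h / 2\<close> bounds the trace on a ball by the energy; the negative
  power of \<open>h\<close> is the only place where a short cylinder costs something.\<close>

lemma local_trace_bound:
  fixes U :: "(real ^ 'd) \<times> real \<Rightarrow> real"
  assumes U: "U \<in> H1rho \<alpha> (UNIV \<times> I)" and \<alpha>: "-1 < \<alpha>" "\<alpha> < 1" and R: "R > 0"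
  shows "(\<integral>\<^sup>+x\<in>ball 0 R. ennreal ((trace0 U x)\<^sup>2) \<partial>lborel)
    \<le> ennreal (4 * (1 + \<alpha>) * (1 + 1 / h)\<^sup>2 * (4 + 2 * R\<^sup>2 + 8 / (1 - \<alpha>)\<^sup>2))
      * (grad_energy \<alpha> (UNIV \<times> I) U + mass_energy \<alpha> (UNIV \<times> I) U)"
proof -
  let ?D = "UNIV \<times> I :: ((real ^ 'd) \<times> real) set"
  define g where "g = trace0 U"
  have [measurable]: "g \<in> borel_measurable borel"
    using trace0_Hardy(1)[OF U \<alpha>] by (simp add: is_trace0_def g_def)
  have wg: "has_weak_gradient ?D U (weak_grad ?D U)" using U by (simp add: H1rho_iff)
  note Um [measurable] = measurable_H1rho(1)[OF wg]
  \<comment> \<open>strictly below \<open>h\<close>, so that the heights up to and including \<open>c\<close> belong to the cylinder\<close>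
  define c where "c = min 1 h / 2"
  have c: "0 < c" "c \<le> 1" "c < h" using h_pos by (auto simp: c_def)
  define T where "T = (\<integral>\<^sup>+x\<in>ball 0 R. ennreal ((g x)\<^sup>2) \<partial>lborel)"
  define V where "V z = (indicator ?D z * U z - g (fst z))\<^sup>2" for z
  have [measurable]: "V \<in> borel_measurable borel" unfolding V_def by measurable
  define M where "M z = (indicator ?D z * U z)\<^sup>2 / (rho z)\<^sup>2" for z
  have [measurable]: "M \<in> borel_measurable borel" unfolding M_def by measurable
  let ?P = "grad_energy \<alpha> ?D U + mass_energy \<alpha> ?D U"
  have "ennreal (c powr (\<alpha> + 1) / (\<alpha> + 1)) * T
      = (\<integral>\<^sup>+z. (ennreal ((g (fst z))\<^sup>2) * indicator (ball 0 R) (fst z)) * (ennreal (snd z powr \<alpha>) * indicator {0<..c} (snd z)) \<partial>lborel)"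
    using \<alpha> c unfolding T_def
    by (subst nn_integral_lborel_pair) (simp_all add: nn_integral_multc nn_integral_cmult nn_integral_powr_Ioc mult.commute)
  also have "\<dots> \<le> (\<integral>\<^sup>+z. ennreal (4 + 2 * R\<^sup>2) * (ennreal (snd z powr \<alpha>) * ennreal (M z) * indicator ?D z)
      + 2 * (ennreal (snd z powr (\<alpha> - 2)) * ennreal (V z) * indicator ?D z) \<partial>lborel)"
  proof (rule nn_integral_mono)
    fix z :: "(real ^ 'd) \<times> real"
    let ?y = "snd z"
    show "(ennreal ((g (fst z))\<^sup>2) * indicator (ball 0 R) (fst z)) * (ennreal (?y powr \<alpha>) * indicator {0<..c} ?y)
      \<le> ennreal (4 + 2 * R\<^sup>2) * (ennreal (?y powr \<alpha>) * ennreal (M z) * indicator ?D z)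
      + 2 * (ennreal (?y powr (\<alpha> - 2)) * ennreal (V z) * indicator ?D z)"
    proof (cases "fst z \<in> ball 0 R \<and> ?y \<in> {0<..c}")
      case True
      then have y: "0 < ?y" "?y \<le> 1" and x: "norm (fst z) \<le> R" and D: "z \<in> ?D"
        using c h_I by (auto simp: mem_Times_iff)
      have rho: "(rho z)\<^sup>2 \<le> 2 + R\<^sup>2"
        using x y power_mono[OF x, of 2] power_le_one[of ?y 2] by (simp add: rho_squared)
      have "(g (fst z))\<^sup>2 \<le> 2 * (U z)\<^sup>2 + 2 * V z"
        using square_add_le[of "U z" "g (fst z) - U z"] D by (simp add: V_def power2_commute)
      also have "(U z)\<^sup>2 = (rho z)\<^sup>2 * M z"
        using D rho_ge_1[of z] by (simp add: M_def)
      also have "\<dots> \<le> (2 + R\<^sup>2) * M z"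
        by (rule mult_right_mono[OF rho]) (simp add: M_def)
      finally have "(g (fst z))\<^sup>2 \<le> (4 + 2 * R\<^sup>2) * M z + 2 * V z" by (simp add: algebra_simps)
      then have "?y powr \<alpha> * (g (fst z))\<^sup>2 \<le> ?y powr \<alpha> * ((4 + 2 * R\<^sup>2) * M z + 2 * V z)"
        by (rule mult_left_mono) simp
      also have "\<dots> \<le> (4 + 2 * R\<^sup>2) * (?y powr \<alpha> * M z) + 2 * (?y powr (\<alpha> - 2) * V z)"
      proof -
        have "?y powr \<alpha> \<le> ?y powr (\<alpha> - 2)" using y by (intro powr_mono') auto
        from mult_right_mono[OF this, of "V z"] show ?thesis by (simp add: V_def algebra_simps)
      qed
      finally have "ennreal (?y powr \<alpha> * (g (fst z))\<^sup>2)
        \<le> ennreal ((4 + 2 * R\<^sup>2) * (?y powr \<alpha> * M z) + 2 * (?y powr (\<alpha> - 2) * V z))"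
        by (rule ennreal_leI)
      also have "\<dots> = ennreal (4 + 2 * R\<^sup>2) * (ennreal (?y powr \<alpha>) * ennreal (M z)) + 2 * (ennreal (?y powr (\<alpha> - 2)) * ennreal (V z))"
        by (simp add: ennreal_plus ennreal_mult V_def M_def add_nonneg_nonneg del: ennreal_plus[symmetric] times_divide_eq_right)
      finally show ?thesis using True D by (simp add: ennreal_mult mult.commute)
    qed (auto simp: indicator_def)
  qed
  also have "\<dots> = ennreal (4 + 2 * R\<^sup>2) * (\<integral>\<^sup>+z\<in>?D. ennreal (snd z powr \<alpha>) * ennreal (M z) \<partial>lborel)
      + 2 * (\<integral>\<^sup>+z\<in>?D. ennreal (snd z powr (\<alpha> - 2)) * ennreal (V z) \<partial>lborel)"
    by (rule nn_integral_linear) measurable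
  also have "(\<integral>\<^sup>+z\<in>?D. ennreal (snd z powr \<alpha>) * ennreal (M z) \<partial>lborel) = mass_energy \<alpha> ?D U"
    unfolding mass_energy_def by (intro nn_integral_cong) (auto simp: M_def indicator_def)
  also have "(\<integral>\<^sup>+z\<in>?D. ennreal (snd z powr (\<alpha> - 2)) * ennreal (V z) \<partial>lborel)
      = (\<integral>\<^sup>+z\<in>?D. ennreal (snd z powr (\<alpha> - 2)) * ennreal ((U z - trace0 U (fst z))\<^sup>2) \<partial>lborel)"
    by (intro nn_integral_cong) (auto simp: V_def g_def indicator_def)
  also have "ennreal (4 + 2 * R\<^sup>2) * mass_energy \<alpha> ?D U + 2 * \<dots>
      \<le> ennreal (4 + 2 * R\<^sup>2) * ?P + 2 * (ennreal (4 / (1 - \<alpha>)\<^sup>2) * ?P)"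
    by (intro add_mono mult_left_mono order_trans[OF trace0_Hardy(2)[OF U \<alpha>]]) (auto intro: add_increasing)
  also have "\<dots> = ennreal (4 + 2 * R\<^sup>2 + 8 / (1 - \<alpha>)\<^sup>2) * ?P"
  proof -
    have "2 * ennreal (4 / (1 - \<alpha>)\<^sup>2) = ennreal (8 / (1 - \<alpha>)\<^sup>2)"
      using ennreal_mult[of 2 "4 / (1 - \<alpha>)\<^sup>2"] by simp
    then have "2 * (ennreal (4 / (1 - \<alpha>)\<^sup>2) * ?P) = ennreal (8 / (1 - \<alpha>)\<^sup>2) * ?P"
      by (simp only: mult.assoc[symmetric])
    then show ?thesis
      by (simp only: distrib_right[symmetric]) (simp add: ennreal_plus[symmetric] add_nonneg_nonneg del: ennreal_plus)
  qed
  finally have main: "ennreal (c powr (\<alpha> + 1) / (\<alpha> + 1)) * T \<le> ennreal (4 + 2 * R\<^sup>2 + 8 / (1 - \<alpha>)\<^sup>2) * ?P" .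
  have cb: "(\<alpha> + 1) / c powr (\<alpha> + 1) \<le> 4 * (1 + \<alpha>) * (1 + 1 / h)\<^sup>2"
  proof -
    have "1 / c powr (\<alpha> + 1) \<le> 1 / c powr 2"
      using c \<alpha> by (intro divide_left_mono powr_mono') auto
    also have "\<dots> = (1 / c)\<^sup>2" using c by (simp add: power_divide)
    also have "\<dots> \<le> (2 * (1 + 1 / h))\<^sup>2"
    proof (rule power_mono)
      show "1 / c \<le> 2 * (1 + 1 / h)" using h_pos by (auto simp: c_def min_def field_simps)
    qed (use c in simp)
    finally have "1 / c powr (\<alpha> + 1) \<le> 4 * (1 + 1 / h)\<^sup>2" by (simp only: power_mult_distrib) simp
    then have "(\<alpha> + 1) * (1 / c powr (\<alpha> + 1)) \<le> (\<alpha> + 1) * (4 * (1 + 1 / h)\<^sup>2)"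
      using \<alpha> by (intro mult_left_mono) auto
    moreover have "4 * (1 + \<alpha>) * (1 + 1 / h)\<^sup>2 = (\<alpha> + 1) * (4 * (1 + 1 / h)\<^sup>2)" by (simp only: ac_simps)
    ultimately show ?thesis by (simp only: times_divide_eq_right mult_1_right)
  qed
  have "T = ennreal ((\<alpha> + 1) / c powr (\<alpha> + 1)) * (ennreal (c powr (\<alpha> + 1) / (\<alpha> + 1)) * T)"
    using c \<alpha> by (simp add: mult.assoc[symmetric] ennreal_mult[symmetric])
  also have "\<dots> \<le> ennreal (4 * (1 + \<alpha>) * (1 + 1 / h)\<^sup>2) * (ennreal (4 + 2 * R\<^sup>2 + 8 / (1 - \<alpha>)\<^sup>2) * ?P)"
    by (intro mult_mono ennreal_leI cb main) auto
  also have "\<dots> = ennreal (4 * (1 + \<alpha>) * (1 + 1 / h)\<^sup>2 * (4 + 2 * R\<^sup>2 + 8 / (1 - \<alpha>)\<^sup>2)) * ?P"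
    using \<alpha> by (subst mult.assoc[symmetric], subst ennreal_mult[symmetric]) (auto simp: add_nonneg_nonneg)
  finally show ?thesis by (simp add: T_def g_def)
qed

end

text \<open>The basis vectors of the coordinates \<open>x\<close>.\<close>

definition horizontal :: "((real ^ 'd) \<times> real) set" where
  "horizontal = (\<lambda>u. (u, 0)) ` Basis"

lemma horizontal_subset_Basis: "horizontal \<subseteq> Basis"
  by (auto simp: horizontal_def Basis_prod_def)

lemma card_horizontal: "card (horizontal :: ((real ^ 'd) \<times> real) set) = CARD('d)"
  unfolding horizontal_def by (subst card_image) (auto simp: inj_on_def)

lemma axis_proj_horizontal: "axis_proj horizontal z = (fst z, 0)"
proof -
  have "axis_proj horizontal z = (\<Sum>u\<in>Basis. (z \<bullet> (u, 0)) *\<^sub>R (u, 0))"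
    unfolding axis_proj_def horizontal_def by (subst sum.reindex) (auto simp: inj_on_def)
  also have "\<dots> = (\<Sum>u\<in>Basis. (fst z \<bullet> u) *\<^sub>R u, 0)"
    by (simp add: prod_eq_iff fst_sum snd_sum inner_prod_def)
  finally show ?thesis by (simp add: euclidean_representation)
qed

lemma dilate_horizontal: "dilate horizontal m z = (m *\<^sub>R fst z, snd z)"
  by (simp add: dilate_def axis_proj_horizontal prod_eq_iff algebra_simps)

context heights
begin

text \<open>In at least three horizontal dimensions the mass is bounded by the horizontal gradient alone.
  Dilating \<open>U\<close> horizontally by 4 shrinks its mass by a factor \<open>16 / 4 ^ CARD('d) \<le> 1 / 4\<close>, so that
  most of the mass sits in the difference, which the gradient controls. That the mass is known to
  be finite excludes the constants.\<close>

lemma mass_le_gradient: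
  fixes U :: "(real ^ 'd) \<times> real \<Rightarrow> real"
  assumes U: "U \<in> H1rho \<alpha> (UNIV \<times> I)" and d: "CARD('d) \<ge> 3"
  shows "mass_energy \<alpha> (UNIV \<times> I) U \<le> 36 * grad_energy \<alpha> (UNIV \<times> I) U"
proof -
  let ?D = "UNIV \<times> I :: ((real ^ 'd) \<times> real) set"
  let ?G = "weak_grad ?D U"
  let ?T = "\<lambda>m z :: (real ^ 'd) \<times> real. dilate horizontal m z"
  have wg: "has_weak_gradient ?D U ?G" and fin: "grad_energy \<alpha> ?D U + mass_energy \<alpha> ?D U < \<infinity>"
    using U by (auto simp: H1rho_iff)
  note [measurable] = measurable_H1rho[OF wg]
  define U0 where "U0 z = indicator ?D z * U z" for z
  define F where "F z = norm (indicator ?D z *\<^sub>R ?G z)" for z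
  have [measurable]: "U0 \<in> borel_measurable borel" "F \<in> borel_measurable borel"
    unfolding U0_def[abs_def] F_def[abs_def] by measurable
  define H where "H z = ennreal (snd z powr \<alpha>) * ennreal ((F z)\<^sup>2) * indicator ?D z" for z
  define M where "M z = ennreal (snd z powr \<alpha>) * ennreal ((U0 z)\<^sup>2 / (rho z)\<^sup>2) * indicator ?D z" for z
  have [measurable]: "H \<in> borel_measurable borel" "M \<in> borel_measurable borel"
    unfolding H_def M_def by measurable
  have H: "(\<integral>\<^sup>+z. H z \<partial>lborel) = grad_energy \<alpha> ?D U"
    unfolding grad_energy_def H_def by (intro nn_integral_cong) (auto simp: F_def indicator_def)
  have M: "(\<integral>\<^sup>+z. M z \<partial>lborel) = mass_energy \<alpha> ?D U"
    unfolding mass_energy_def M_def by (intro nn_integral_cong) (auto simp: U0_def indicator_def)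
  have identity: "AE z in lborel. z \<in> ?D \<longrightarrow> U (?T 4 z) - U (?T 1 z) = (LINT m:{1..4}|lborel. ?G (?T m z) \<bullet> axis_proj horizontal z)"
    by (rule weak_gradient_along_dilations[OF open_cylinder wg horizontal_subset_Basis])
      (auto simp: dilate_horizontal)
  define A where "A z = ennreal (snd z powr \<alpha> / (rho z)\<^sup>2 * (U0 (?T 4 z) - U0 z)\<^sup>2) * indicator ?D z" for z
  have [measurable]: "A \<in> borel_measurable borel" unfolding A_def by measurable
  \<comment> \<open>3 is the length of the interval of dilation factors; \<open>norm (fst z) \<le> rho z\<close> cancels the weight\<close>
  have A: "AE z in lborel. A z \<le> 3 * (\<integral>\<^sup>+m. H (?T m z) * indicator {1..4::real} m \<partial>lborel)"
    using identity
  proof eventually_elim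
    case (elim z)
    show ?case
    proof (cases "z \<in> ?D")
      case True
      have TD: "?T m z \<in> ?D" for m using True by (auto simp: dilate_horizontal)
      have "U0 (?T 4 z) - U0 z = (LINT m:{1..4}|lborel. ?G (?T m z) \<bullet> (fst z, 0))"
        using elim True TD by (simp add: U0_def axis_proj_horizontal dilate_1[OF horizontal_subset_Basis])
      then have "ennreal \<bar>U0 (?T 4 z) - U0 z\<bar>
          \<le> (\<integral>\<^sup>+m. ennreal (norm (indicator {1..4} m *\<^sub>R (?G (?T m z) \<bullet> (fst z, 0)))) \<partial>lborel)"
        unfolding set_lebesgue_integral_def
        using norm_integral_le_nn_integral[of lborel "\<lambda>m. indicator {1..4} m *\<^sub>R (?G (?T m z) \<bullet> (fst z, 0))"] by simp
      also have "\<dots> \<le> (\<integral>\<^sup>+m\<in>{1..4}. ennreal (F (?T m z) * norm (fst z)) \<partial>lborel)"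
      proof (rule nn_integral_mono)
        fix m :: real
        have "\<bar>?G (?T m z) \<bullet> (fst z, 0)\<bar> \<le> F (?T m z) * norm (fst z)"
          using Cauchy_Schwarz_ineq2[of "?G (?T m z)" "(fst z, 0)"] TD by (simp add: F_def)
        then show "ennreal (norm (indicator {1..4} m *\<^sub>R (?G (?T m z) \<bullet> (fst z, 0))))
            \<le> ennreal (F (?T m z) * norm (fst z)) * indicator {1..4} m"
          by (auto simp: indicator_def ennreal_leI)
      qed
      finally have "(ennreal \<bar>U0 (?T 4 z) - U0 z\<bar>)\<^sup>2 \<le> (\<integral>\<^sup>+m\<in>{1..4}. ennreal (F (?T m z) * norm (fst z)) \<partial>lborel)\<^sup>2"
        by (rule power_mono) simp
      also have "\<dots> \<le> (\<integral>\<^sup>+m\<in>{1..4::real}. ennreal (1 / 1) \<partial>lborel) * (\<integral>\<^sup>+m\<in>{1..4}. ennreal 1 * (ennreal (F (?T m z) * norm (fst z)))\<^sup>2 \<partial>lborel)"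
        by (rule weighted_Cauchy_Schwarz) auto
      also have "(\<integral>\<^sup>+m\<in>{1..4::real}. ennreal (1 / 1) \<partial>lborel) = 3" by simp
      also have "(\<integral>\<^sup>+m\<in>{1..4}. ennreal 1 * (ennreal (F (?T m z) * norm (fst z)))\<^sup>2 \<partial>lborel)
          = (\<integral>\<^sup>+m. ennreal ((norm (fst z))\<^sup>2) * (ennreal ((F (?T m z))\<^sup>2) * indicator {1..4} m) \<partial>lborel)"
        by (intro nn_integral_cong) (simp add: F_def ennreal_power power_mult_distrib ennreal_mult mult_ac)
      also have "\<dots> = ennreal ((norm (fst z))\<^sup>2) * (\<integral>\<^sup>+m\<in>{1..4}. ennreal ((F (?T m z))\<^sup>2) \<partial>lborel)" (is "_ = _ * ?J")
        by (rule nn_integral_cmult) measurable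
      finally have *: "ennreal ((U0 (?T 4 z) - U0 z)\<^sup>2) \<le> 3 * (ennreal ((norm (fst z))\<^sup>2) * ?J)"
        by (simp add: ennreal_power)
      have r: "(norm (fst z))\<^sup>2 / (rho z)\<^sup>2 \<le> 1"
      proof -
        have "(norm (fst z))\<^sup>2 \<le> (rho z)\<^sup>2" "(rho z)\<^sup>2 > 0"
          using rho_ge_1[of z] by (simp_all add: rho_squared) (simp add: add_pos_nonneg)
        then show ?thesis by (simp add: divide_le_eq_1_pos)
      qed
      have "A z = ennreal (snd z powr \<alpha> / (rho z)\<^sup>2) * ennreal ((U0 (?T 4 z) - U0 z)\<^sup>2)"
        using True unfolding A_def by (subst ennreal_mult[symmetric]) auto
      also have "\<dots> \<le> ennreal (snd z powr \<alpha> / (rho z)\<^sup>2) * (3 * (ennreal ((norm (fst z))\<^sup>2) * ?J))"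
        by (rule mult_left_mono[OF *]) simp
      also have "\<dots> = 3 * (ennreal (snd z powr \<alpha>) * (ennreal ((norm (fst z))\<^sup>2 / (rho z)\<^sup>2) * ?J))"
      proof -
        have *: "a * (3 * (b * j)) = 3 * (a * b * j)" for a b j :: ennreal by (simp only: ac_simps)
        have "ennreal (snd z powr \<alpha> / (rho z)\<^sup>2) * ennreal ((norm (fst z))\<^sup>2)
            = ennreal (snd z powr \<alpha>) * ennreal ((norm (fst z))\<^sup>2 / (rho z)\<^sup>2)"
          by (subst (1 2) ennreal_mult[symmetric]) auto
        then show ?thesis unfolding * by (simp only: mult.assoc)
      qed
      also have "\<dots> \<le> 3 * (ennreal (snd z powr \<alpha>) * (1 * ?J))"
        using r by (intro mult_left_mono mult_right_mono) auto
      also have "ennreal (snd z powr \<alpha>) * (1 * ?J) = (\<integral>\<^sup>+m. ennreal (snd z powr \<alpha>) * (ennreal ((F (?T m z))\<^sup>2) * indicator {1..4} m) \<partial>lborel)"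
        unfolding mult_1 by (rule nn_integral_cmult[symmetric]) measurable
      also have "\<dots> = (\<integral>\<^sup>+m. H (?T m z) * indicator {1..4::real} m \<partial>lborel)"
        using TD by (intro nn_integral_cong) (simp add: H_def dilate_horizontal mult.assoc)
      finally show ?thesis .
    qed (simp add: A_def)
  qed
  have Am: "(\<integral>\<^sup>+z. A z \<partial>lborel) \<le> 9 * grad_energy \<alpha> ?D U"
  proof -
    have m1: "(\<lambda>z. \<integral>\<^sup>+m. H (?T m z) * indicator {1..4::real} m \<partial>lborel) \<in> borel_measurable lborel" by measurable
    have m2: "(\<lambda>(m, z). H (?T m z) * indicator {1..4::real} m) \<in> borel_measurable (lborel \<Otimes>\<^sub>M lborel)" by measurable
    have "(\<integral>\<^sup>+z. A z \<partial>lborel) \<le> (\<integral>\<^sup>+z. 3 * (\<integral>\<^sup>+m. H (?T m z) * indicator {1..4::real} m \<partial>lborel) \<partial>lborel)"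
      by (rule nn_integral_mono_AE[OF A])
    also have "\<dots> = 3 * (\<integral>\<^sup>+z. \<integral>\<^sup>+m. H (?T m z) * indicator {1..4::real} m \<partial>lborel \<partial>lborel)"
      by (rule nn_integral_cmult[OF m1])
    also have "(\<integral>\<^sup>+z. \<integral>\<^sup>+m. H (?T m z) * indicator {1..4::real} m \<partial>lborel \<partial>lborel)
        = (\<integral>\<^sup>+m. \<integral>\<^sup>+z. H (?T m z) * indicator {1..4::real} m \<partial>lborel \<partial>lborel)"
      by (rule lborel_pair.Fubini'[OF m2])
    also have "\<dots> \<le> (\<integral>\<^sup>+m. grad_energy \<alpha> ?D U * indicator {1..4::real} m \<partial>lborel)"
    proof (rule nn_integral_mono)
      fix m :: real
      show "(\<integral>\<^sup>+z. H (?T m z) * indicator {1..4::real} m \<partial>lborel) \<le> grad_energy \<alpha> ?D U * indicator {1..4::real} m"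
        using nn_integral_compose_dilate_le[OF horizontal_subset_Basis, of 1 m H]
        by (auto simp: H indicator_def)
    qed
    also have "\<dots> = 3 * grad_energy \<alpha> ?D U"
      by (subst nn_integral_cmult_indicator) (auto simp: mult.commute)
    finally have "(\<integral>\<^sup>+z. A z \<partial>lborel) \<le> 3 * (3 * grad_energy \<alpha> ?D U)" by (simp add: mult_left_mono)
    also have "\<dots> = 9 * grad_energy \<alpha> ?D U" by (simp add: mult.assoc[symmetric])
    finally show ?thesis .
  qed
  have Bm: "(\<integral>\<^sup>+z. M (?T 4 z) \<partial>lborel) \<le> ennreal (1 / 64) * mass_energy \<alpha> ?D U"
  proof -
    have "(\<integral>\<^sup>+z. M (?T 4 z) \<partial>lborel) \<le> ennreal (1 / 4 ^ CARD('d)) * (\<integral>\<^sup>+z. M z \<partial>lborel)"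
      using nn_integral_compose_dilate_le[OF horizontal_subset_Basis, of 4 4 M] by (simp add: card_horizontal)
    also have "\<dots> \<le> ennreal (1 / 64) * (\<integral>\<^sup>+z. M z \<partial>lborel)"
      using power_increasing[OF d, of "4 :: real"] by (intro mult_right_mono ennreal_leI divide_left_mono) auto
    finally show ?thesis by (simp add: M)
  qed
  have "mass_energy \<alpha> ?D U \<le> (\<integral>\<^sup>+z. 2 * A z + 32 * M (?T 4 z) \<partial>lborel)"
    unfolding M[symmetric]
  proof (rule nn_integral_mono)
    fix z
    show "M z \<le> 2 * A z + 32 * M (?T 4 z)"
    proof (cases "z \<in> ?D")
      case True
      have TD: "?T 4 z \<in> ?D" using True by (auto simp: dilate_horizontal)
      let ?w = "snd z powr \<alpha>"
      have rho: "(rho (?T 4 z))\<^sup>2 \<le> 16 * (rho z)\<^sup>2"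
        by (simp add: rho_squared dilate_horizontal power_mult_distrib)
      have pos: "(rho z)\<^sup>2 > 0" "(rho (?T 4 z))\<^sup>2 > 0"
        using rho_ge_1[of z] rho_ge_1[of "?T 4 z"] by auto
      have "(U0 z)\<^sup>2 \<le> 2 * (U0 (?T 4 z) - U0 z)\<^sup>2 + 2 * (U0 (?T 4 z))\<^sup>2"
        using square_add_le[of "U0 z - U0 (?T 4 z)" "U0 (?T 4 z)"] by (simp add: power2_commute)
      then have "?w / (rho z)\<^sup>2 * (U0 z)\<^sup>2 \<le> ?w / (rho z)\<^sup>2 * (2 * (U0 (?T 4 z) - U0 z)\<^sup>2 + 2 * (U0 (?T 4 z))\<^sup>2)"
        by (rule mult_left_mono) simp
      also have "\<dots> = 2 * (?w / (rho z)\<^sup>2 * (U0 (?T 4 z) - U0 z)\<^sup>2) + 2 * (?w * ((U0 (?T 4 z))\<^sup>2 / (rho z)\<^sup>2))"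
        by (simp add: distrib_left mult.left_commute)
      also have "\<dots> \<le> 2 * (?w / (rho z)\<^sup>2 * (U0 (?T 4 z) - U0 z)\<^sup>2) + 32 * (?w * ((U0 (?T 4 z))\<^sup>2 / (rho (?T 4 z))\<^sup>2))"
      proof -
        have "(U0 (?T 4 z))\<^sup>2 / (rho z)\<^sup>2 \<le> 16 * ((U0 (?T 4 z))\<^sup>2 / (rho (?T 4 z))\<^sup>2)"
          using mult_left_mono[OF rho, of "(U0 (?T 4 z))\<^sup>2"] pos by (simp add: divide_le_eq pos_le_divide_eq mult_ac)
        from mult_left_mono[OF this, of ?w] show ?thesis by simp
      qed
      finally have "ennreal (?w * ((U0 z)\<^sup>2 / (rho z)\<^sup>2)) \<le> ennreal (2 * (?w / (rho z)\<^sup>2 * (U0 (?T 4 z) - U0 z)\<^sup>2) + 32 * (?w * ((U0 (?T 4 z))\<^sup>2 / (rho (?T 4 z))\<^sup>2)))"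
        by (intro ennreal_leI) simp
      also have "\<dots> = 2 * ennreal (?w / (rho z)\<^sup>2 * (U0 (?T 4 z) - U0 z)\<^sup>2) + 32 * (ennreal ?w * ennreal ((U0 (?T 4 z))\<^sup>2 / (rho (?T 4 z))\<^sup>2))"
        by (subst ennreal_mult[symmetric]; simp add: ennreal_plus ennreal_mult' del: times_divide_eq_left times_divide_eq_right)
      also have "\<dots> = 2 * A z + 32 * M (?T 4 z)"
        using True TD by (simp add: A_def M_def dilate_horizontal)
      finally show ?thesis using True by (simp add: M_def ennreal_mult del: times_divide_eq_right)
    qed (simp add: M_def)
  qed
  also have "\<dots> = 2 * (\<integral>\<^sup>+z. A z \<partial>lborel) + 32 * (\<integral>\<^sup>+z. M (?T 4 z) \<partial>lborel)"
    by (rule nn_integral_linear) measurable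
  also have "\<dots> \<le> 2 * (9 * grad_energy \<alpha> ?D U) + 32 * (ennreal (1 / 64) * mass_energy \<alpha> ?D U)"
    by (intro add_mono mult_left_mono Am Bm) auto
  finally have main: "mass_energy \<alpha> ?D U \<le> 2 * (9 * grad_energy \<alpha> ?D U) + 32 * (ennreal (1 / 64) * mass_energy \<alpha> ?D U)" .
  \<comment> \<open>the mass on the right carries the factor \<open>1 / 2\<close> and is finite, so that it can be absorbed\<close>
  obtain m g where mg: "mass_energy \<alpha> ?D U = ennreal m" "m \<ge> 0" "grad_energy \<alpha> ?D U = ennreal g" "g \<ge> 0"
    using fin by (cases "mass_energy \<alpha> ?D U"; cases "grad_energy \<alpha> ?D U") auto
  have "2 * (9 * ennreal g) + 32 * (ennreal (1 / 64) * ennreal m) = ennreal (2 * (9 * g) + 32 * (1 / 64 * m))"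
    using mg by (simp add: ennreal_plus ennreal_mult del: times_divide_eq_left)
  then have "ennreal m \<le> ennreal (2 * (9 * g) + 32 * (1 / 64 * m))"
    using main mg by simp
  then have "m \<le> 2 * (9 * g) + 32 * (1 / 64 * m)"
    using mg by (subst (asm) ennreal_le_iff) auto
  then have "m \<le> 36 * g" by simp
  then show ?thesis using mg ennreal_leI[of m "36 * g"] by (simp add: ennreal_mult)
qed

end

section \<open>Minimization of quadratic functionals and completeness\<close>

text \<open>This yields the Cauchy--Schwarz inequality for a form that is only semidefinite.\<close>

lemma quadratic_nonneg_discriminant:
  fixes A b c :: real
  assumes "A \<ge> 0" "\<And>t. 0 \<le> c + 2 * b * t + A * t\<^sup>2"
  shows "b\<^sup>2 \<le> A * c"
proof (cases "A = 0")
  case True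
  have "b = 0"
  proof (rule ccontr)
    assume b: "b \<noteq> 0"
    have "0 \<le> c + 2 * b * (- (c + 1) / (2 * b))" using assms(2)[of "- (c + 1) / (2 * b)"] True by simp
    then show False using b by simp
  qed
  then show ?thesis using True by simp
next
  case False
  then have A: "A > 0" using assms(1) by simp
  have "0 \<le> c + 2 * b * (- b / A) + A * (- b / A)\<^sup>2" by (rule assms(2))
  also have "\<dots> = c - b\<^sup>2 / A" using A by (simp add: power2_eq_square field_simps)
  finally show ?thesis using A by (simp add: field_simps)
qed

text \<open>The Riesz representation theorem for a symmetric form on a space of functions. The form may
  vanish on non-zero functions, since functions equal almost everywhere are not identified. A
  minimizing sequence of \<open>J u = a u u - 2 * l u\<close> is a Cauchy sequence by the parallelogram identity,
  and at its limit the first variation \<open>a u v - l v\<close> vanishes.\<close>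

lemma riesz_minimization:
  fixes V :: "('a \<Rightarrow> real) set" and a :: "('a \<Rightarrow> real) \<Rightarrow> ('a \<Rightarrow> real) \<Rightarrow> real"
  assumes ne: "V \<noteq> {}"
    and lin: "\<And>u v t. u \<in> V \<Longrightarrow> v \<in> V \<Longrightarrow> (\<lambda>z. u z + t * v z) \<in> V"
    and sym: "\<And>u v. u \<in> V \<Longrightarrow> v \<in> V \<Longrightarrow> a u v = a v u"
    and add: "\<And>u v w t. u \<in> V \<Longrightarrow> v \<in> V \<Longrightarrow> w \<in> V \<Longrightarrow> a (\<lambda>z. u z + t * v z) w = a u w + t * a v w"
    and pos: "\<And>u. u \<in> V \<Longrightarrow> 0 \<le> a u u"
    and l_lin: "\<And>u v t. u \<in> V \<Longrightarrow> v \<in> V \<Longrightarrow> l (\<lambda>z. u z + t * v z) = l u + t * l v"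
    and l_bdd: "\<And>u. u \<in> V \<Longrightarrow> \<bar>l u\<bar> \<le> K * sqrt (a u u)"
    and complete: "\<And>u. (\<And>n. u n \<in> V) \<Longrightarrow>
      (\<And>e. e > 0 \<Longrightarrow> \<exists>N. \<forall>m\<ge>N. \<forall>n\<ge>N. a (\<lambda>z. u m z + (-1) * u n z) (\<lambda>z. u m z + (-1) * u n z) < e) \<Longrightarrow>
      \<exists>v\<in>V. (\<lambda>n. a (\<lambda>z. u n z + (-1) * v z) (\<lambda>z. u n z + (-1) * v z)) \<longlonglongrightarrow> 0"
  shows "\<exists>u\<in>V. \<forall>v\<in>V. a u v = l v"
proof -
  define J where "J u = a u u - 2 * l u" for u
  have expand: "a (\<lambda>z. u z + t * v z) (\<lambda>z. u z + t * v z) = a u u + 2 * a u v * t + a v v * t\<^sup>2"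
    if "u \<in> V" "v \<in> V" for u v t
  proof -
    have w: "(\<lambda>z. u z + t * v z) \<in> V" using that by (rule lin)
    have "a (\<lambda>z. u z + t * v z) (\<lambda>z. u z + t * v z) = a u (\<lambda>z. u z + t * v z) + t * a v (\<lambda>z. u z + t * v z)"
      by (rule add[OF that w])
    also have "a u (\<lambda>z. u z + t * v z) = a u u + t * a v u"
      using sym[OF that(1) w] add[OF that that(1)] by simp
    also have "a v (\<lambda>z. u z + t * v z) = a u v + t * a v v"
      using sym[OF that(2) w] add[OF that that(2)] by simp
    finally show ?thesis using sym[OF that] by (simp add: power2_eq_square algebra_simps)
  qed
  have J_expand: "J (\<lambda>z. u z + t * v z) = J u + 2 * (a u v - l v) * t + a v v * t\<^sup>2"
    if "u \<in> V" "v \<in> V" for u v t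
    using expand[OF that] l_lin[OF that] by (simp add: J_def algebra_simps)
  have CS: "(a u v)\<^sup>2 \<le> a v v * a u u" if "u \<in> V" "v \<in> V" for u v
    by (rule quadratic_nonneg_discriminant) (use pos lin that expand[OF that, symmetric] in auto)
  have J_lower: "J u \<ge> - K\<^sup>2" if "u \<in> V" for u
  proof -
    have "2 * l u \<le> 2 * K * sqrt (a u u)" using l_bdd[OF that] by simp
    moreover have "0 \<le> (sqrt (a u u) - K)\<^sup>2" by simp
    ultimately show ?thesis using pos[OF that] by (simp add: J_def power2_diff mult_ac)
  qed
  define m where "m = (INF u\<in>V. J u)"
  have bdd: "bdd_below (J ` V)" using J_lower by (intro bdd_belowI2) auto
  have m_le: "m \<le> J u" if "u \<in> V" for u unfolding m_def using bdd that by (rule cINF_lower)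
  have "\<exists>u\<in>V. J u < m + 1 / real (Suc n)" for n
  proof -
    have "Inf (J ` V) < m + 1 / real (Suc n)" by (simp add: m_def)
    then show ?thesis using ne by (subst (asm) cInf_less_iff[OF _ bdd]) auto
  qed
  then obtain u where u: "\<And>n. u n \<in> V" "\<And>n. J (u n) < m + 1 / real (Suc n)" by metis
  have near: "a (\<lambda>z. v z + (-1) * u z) (\<lambda>z. v z + (-1) * u z) \<le> 2 * (J u - m) + 2 * (J v - m)"
    if "u \<in> V" "v \<in> V" for u v
  proof -
    define d where "d = (\<lambda>z. v z + (-1) * u z)"
    have d: "d \<in> V" unfolding d_def by (rule lin[OF that(2,1)])
    have v: "(\<lambda>z. u z + 1 * d z) = v" by (simp add: d_def)
    have Jv: "J v = J u + 2 * (a u d - l d) + a d d"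
      using J_expand[OF that(1) d, of 1] unfolding v by simp
    have m: "m \<le> J u + (a u d - l d) + a d d / 4"
      using m_le[OF lin[OF that(1) d, of "1/2"]] J_expand[OF that(1) d, of "1/2"]
      by (simp add: power2_eq_square diff_divide_distrib)
    have "D \<le> 2 * (j - m) + 2 * (k - m)" if "k = j + 2 * b + D" "m \<le> j + b + D / 4" for j k b D :: real
      using that by argo
    from this[OF Jv m] have "a d d \<le> 2 * (J u - m) + 2 * (J v - m)" .
    then show ?thesis unfolding d_def .
  qed
  have "\<exists>v\<in>V. (\<lambda>n. a (\<lambda>z. u n z + (-1) * v z) (\<lambda>z. u n z + (-1) * v z)) \<longlonglongrightarrow> 0"
  proof (rule complete[OF u(1)])
    fix e :: real assume e: "e > 0"
    then obtain N where N: "1 / real (Suc N) < e / 4"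
      using nat_approx_posE[of "e / 4"] by auto
    have "a (\<lambda>z. u i z + (-1) * u j z) (\<lambda>z. u i z + (-1) * u j z) < e" if "i \<ge> N" "j \<ge> N" for i j
    proof -
      have small: "J (u k) - m < e / 4" if "k \<ge> N" for k
      proof -
        have "1 / real (Suc k) \<le> 1 / real (Suc N)" using that by (intro divide_left_mono) auto
        then show ?thesis using u(2)[of k] N by linarith
      qed
      have "2 * q + 2 * p < e" if "p < e / 4" "q < e / 4" for p q :: real using that by simp
      from this[OF small[OF that(1)] small[OF that(2)]]
      have "2 * (J (u j) - m) + 2 * (J (u i) - m) < e" .
      then show ?thesis by (rule le_less_trans[OF near[OF u(1) u(1)]])
    qed
    then show "\<exists>N. \<forall>i\<ge>N. \<forall>j\<ge>N. a (\<lambda>z. u i z + (-1) * u j z) (\<lambda>z. u i z + (-1) * u j z) < e" by blast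
  qed
  then obtain v where v: "v \<in> V" "(\<lambda>n. a (\<lambda>z. u n z + (-1) * v z) (\<lambda>z. u n z + (-1) * v z)) \<longlonglongrightarrow> 0" by blast
  have "a v w = l w" if w: "w \<in> V" for w
  proof -
    let ?e = "\<lambda>n z. u n z + (-1) * v z"
    have e: "?e n \<in> V" for n using u(1) v(1) by (rule lin)
    have 1: "(\<lambda>n. a (u n) w - l w) \<longlonglongrightarrow> 0"
    proof -
      have bound: "(a (u n) w - l w)\<^sup>2 \<le> a w w * (1 / real (Suc n))" for n
      proof (rule quadratic_nonneg_discriminant[OF pos[OF w]])
        fix t
        have "m \<le> J (u n) + 2 * (a (u n) w - l w) * t + a w w * t\<^sup>2"
          using m_le[OF lin[OF u(1)[of n] w, of t]] J_expand[OF u(1)[of n] w, of t] by simp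
        then show "0 \<le> 1 / real (Suc n) + 2 * (a (u n) w - l w) * t + a w w * t\<^sup>2"
          using u(2)[of n] by linarith
      qed
      have "(\<lambda>n. a w w * (1 / real (Suc n))) \<longlonglongrightarrow> a w w * 0"
        by (rule tendsto_mult[OF tendsto_const LIMSEQ_Suc[OF lim_1_over_n]])
      then have "(\<lambda>n. a w w * (1 / real (Suc n))) \<longlonglongrightarrow> 0" by simp
      with always_eventually[OF allI[OF zero_le_power2]] always_eventually[OF allI[OF bound]] tendsto_const
      have "(\<lambda>n. (a (u n) w - l w)\<^sup>2) \<longlonglongrightarrow> 0" by (rule tendsto_sandwich)
      then show ?thesis by simp
    qed
    have 2: "(\<lambda>n. a (?e n) w) \<longlonglongrightarrow> 0"
    proof -
      have "(\<lambda>n. a w w * a (?e n) (?e n)) \<longlonglongrightarrow> a w w * 0"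
        by (rule tendsto_mult[OF tendsto_const v(2)])
      then have "(\<lambda>n. a w w * a (?e n) (?e n)) \<longlonglongrightarrow> 0" by simp
      with always_eventually[OF allI[OF zero_le_power2]] always_eventually[OF allI[OF CS[OF e w]]] tendsto_const
      have "(\<lambda>n. (a (?e n) w)\<^sup>2) \<longlonglongrightarrow> 0" by (rule tendsto_sandwich)
      then show ?thesis by simp
    qed
    have "a (?e n) w = a (u n) w - a v w" for n
      using add[OF u(1) v(1) w, of n "-1"] by simp
    then have "(\<lambda>n. (a (u n) w - l w) - a (?e n) w) = (\<lambda>n. a v w - l w)" by (auto simp: fun_eq_iff)
    then have "(\<lambda>n::nat. a v w - l w) \<longlonglongrightarrow> 0 - 0" using tendsto_diff[OF 1 2] by simp
    then show ?thesis by (simp add: LIMSEQ_const_iff)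
  qed
  then show ?thesis using v(1) by blast
qed

lemma summable_norm_if_weighted_squares_finite:
  fixes x :: "nat \<Rightarrow> real"
  assumes "(\<Sum>k. ennreal (4 ^ k * (x k)\<^sup>2)) < \<infinity>"
  shows "summable (\<lambda>k. \<bar>x k\<bar>)"
proof -
  obtain C where C: "(\<Sum>k. ennreal (4 ^ k * (x k)\<^sup>2)) = ennreal C" "C \<ge> 0"
    using assms unfolding infinity_ennreal_def less_top_ennreal by blast
  have bound: "\<bar>x k\<bar> \<le> sqrt C * (1 / 2) ^ k" for k
  proof -
    have term_le: "t k \<le> suminf t" for t :: "nat \<Rightarrow> ennreal"
      using sum_le_suminf[of t "{k}"] by simp
    have "ennreal (4 ^ k * (x k)\<^sup>2) \<le> ennreal C"
      unfolding C(1)[symmetric] by (rule term_le)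
    then have "4 ^ k * (x k)\<^sup>2 \<le> C" using C(2) by simp
    moreover have "4 ^ k * (x k)\<^sup>2 = (2 ^ k * \<bar>x k\<bar>)\<^sup>2"
    proof -
      have "(4 :: real) ^ k = (2 ^ k)\<^sup>2" by (simp add: power2_eq_square power_mult_distrib[symmetric])
      then show ?thesis by (simp add: power_mult_distrib)
    qed
    ultimately have "2 ^ k * \<bar>x k\<bar> \<le> sqrt C" by (simp add: real_le_rsqrt)
    then show ?thesis by (simp add: power_one_over field_simps)
  qed
  have "summable (\<lambda>k. sqrt C * (1 / 2) ^ k)"
    by (rule summable_mult[OF summable_geometric]) simp
  then show ?thesis
    by (rule summable_comparison_test'[where N = 0]) (simp add: bound)
qed

text \<open>Completeness of \<open>L\<^sup>2\<close>: along a rapidly converging subsequence, the weighted squares of the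
  increments are summable almost everywhere, so that the subsequence converges pointwise; Fatou's
  lemma turns this into convergence in the norm.\<close>

lemma L2_complete:
  fixes F :: "nat \<Rightarrow> 'a \<Rightarrow> 'b::euclidean_space"
  assumes [measurable]: "\<And>n. F n \<in> borel_measurable M"
    and cauchy: "\<And>e. e > 0 \<Longrightarrow> \<exists>N. \<forall>m\<ge>N. \<forall>n\<ge>N. (\<integral>\<^sup>+x. ennreal ((norm (F m x - F n x))\<^sup>2) \<partial>M) \<le> ennreal e"
  obtains f where "f \<in> borel_measurable M"
    "\<forall>e>0. \<exists>N. \<forall>n\<ge>N. (\<integral>\<^sup>+x. ennreal ((norm (F n x - f x))\<^sup>2) \<partial>M) \<le> ennreal e"
proof -
  have "\<exists>N. \<forall>m\<ge>N. \<forall>n\<ge>N. (\<integral>\<^sup>+x. ennreal ((norm (F m x - F n x))\<^sup>2) \<partial>M) \<le> ennreal ((1 / 8) ^ k)" for k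
    by (rule cauchy) simp
  then obtain N where N: "\<And>k m n. m \<ge> N k \<Longrightarrow> n \<ge> N k \<Longrightarrow>
      (\<integral>\<^sup>+x. ennreal ((norm (F m x - F n x))\<^sup>2) \<partial>M) \<le> ennreal ((1 / 8) ^ k)" by metis
  \<comment> \<open>a monotone choice of indices beyond \<open>N k\<close>\<close>
  define r where "r k = k + (\<Sum>i\<le>k. N i)" for k
  have r: "r k \<ge> N k" "r (Suc k) \<ge> r k" "r k \<ge> k" for k
    unfolding r_def using member_le_sum[of k "{..k}" N] by auto
  have "(\<integral>\<^sup>+x. (\<Sum>k. ennreal (4 ^ k * (norm (F (r (Suc k)) x - F (r k) x))\<^sup>2)) \<partial>M)
      = (\<Sum>k. (\<integral>\<^sup>+x. ennreal (4 ^ k * (norm (F (r (Suc k)) x - F (r k) x))\<^sup>2) \<partial>M))"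
    by (rule nn_integral_suminf) measurable
  also have "\<dots> \<le> (\<Sum>k. ennreal ((1 / 2) ^ k))"
  proof (rule suminf_le)
    fix k
    have "(\<integral>\<^sup>+x. ennreal (4 ^ k * (norm (F (r (Suc k)) x - F (r k) x))\<^sup>2) \<partial>M)
        = ennreal (4 ^ k) * (\<integral>\<^sup>+x. ennreal ((norm (F (r (Suc k)) x - F (r k) x))\<^sup>2) \<partial>M)"
      by (subst nn_integral_cmult[symmetric]) (auto simp: ennreal_mult)
    also have "\<dots> \<le> ennreal (4 ^ k) * ennreal ((1 / 8) ^ k)"
      using r[of k] by (intro mult_left_mono N) auto
    also have "\<dots> = ennreal ((1 / 2) ^ k)"
      by (simp add: ennreal_mult[symmetric] power_mult_distrib[symmetric])
    finally show "(\<integral>\<^sup>+x. ennreal (4 ^ k * (norm (F (r (Suc k)) x - F (r k) x))\<^sup>2) \<partial>M) \<le> ennreal ((1 / 2) ^ k)" .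
  qed auto
  also have "\<dots> < \<infinity>"
    by (subst suminf_ennreal2) (auto intro: summable_geometric)
  finally have "AE x in M. (\<Sum>k. ennreal (4 ^ k * (norm (F (r (Suc k)) x - F (r k) x))\<^sup>2)) \<noteq> \<infinity>"
    by (intro nn_integral_PInf_AE) auto
  then have conv: "AE x in M. convergent (\<lambda>k. F (r k) x)"
  proof eventually_elim
    case (elim x)
    then have "summable (\<lambda>k. \<bar>norm (F (r (Suc k)) x - F (r k) x)\<bar>)"
      by (intro summable_norm_if_weighted_squares_finite) (simp only: top.not_eq_extremum infinity_ennreal_def)
    then have "summable (\<lambda>k. norm (F (r (Suc k)) x - F (r k) x))" by (simp only: abs_norm_cancel)
    then have "summable (\<lambda>k. F (r (Suc k)) x - F (r k) x)" by (rule summable_norm_cancel)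
    then have "convergent (\<lambda>n. \<Sum>k<n. F (r (Suc k)) x - F (r k) x)"
      by (simp add: summable_iff_convergent)
    then have "convergent (\<lambda>n. F (r n) x - F (r 0) x)"
      by (simp add: sum_lessThan_telescope[of "\<lambda>k. F (r k) x"])
    from convergent_add[OF this convergent_const[of "F (r 0) x"]] show ?case by simp
  qed
  define f where "f x = lim (\<lambda>k. F (r k) x)" for x
  have [measurable]: "f \<in> borel_measurable M" unfolding f_def by (rule borel_measurable_lim_metric) measurable
  have lim: "AE x in M. (\<lambda>k. F (r k) x) \<longlonglongrightarrow> f x"
    using conv by eventually_elim (simp add: f_def convergent_LIMSEQ_iff)
  have "\<exists>N. \<forall>n\<ge>N. (\<integral>\<^sup>+x. ennreal ((norm (F n x - f x))\<^sup>2) \<partial>M) \<le> ennreal e" if e: "e > 0" for e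
  proof -
    obtain N' where N': "\<And>m n. m \<ge> N' \<Longrightarrow> n \<ge> N' \<Longrightarrow> (\<integral>\<^sup>+x. ennreal ((norm (F m x - F n x))\<^sup>2) \<partial>M) \<le> ennreal e"
      using cauchy[OF e] by blast
    have "(\<integral>\<^sup>+x. ennreal ((norm (F n x - f x))\<^sup>2) \<partial>M) \<le> ennreal e" if n: "n \<ge> N'" for n
    proof -
      have "\<exists>k0. \<forall>k\<ge>k0. (\<integral>\<^sup>+x. ennreal ((norm (F n x - F (r k) x))\<^sup>2) \<partial>M) \<le> ennreal e"
        using N'[OF n] r(3) by (meson order_trans)
      then obtain k0 where k0: "\<And>k. k \<ge> k0 \<Longrightarrow> (\<integral>\<^sup>+x. ennreal ((norm (F n x - F (r k) x))\<^sup>2) \<partial>M) \<le> ennreal e" by blast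
      have "(\<integral>\<^sup>+x. ennreal ((norm (F n x - f x))\<^sup>2) \<partial>M) = (\<integral>\<^sup>+x. liminf (\<lambda>k. ennreal ((norm (F n x - F (r k) x))\<^sup>2)) \<partial>M)"
      proof (rule nn_integral_cong_AE, use lim in eventually_elim)
        case (elim x)
        have "(\<lambda>k. ennreal ((norm (F n x - F (r k) x))\<^sup>2)) \<longlonglongrightarrow> ennreal ((norm (F n x - f x))\<^sup>2)"
          by (intro tendsto_ennrealI tendsto_intros elim)
        from lim_imp_Liminf[OF _ this] show ?case by simp
      qed
      also have "\<dots> \<le> liminf (\<lambda>k. \<integral>\<^sup>+x. ennreal ((norm (F n x - F (r k) x))\<^sup>2) \<partial>M)"
        by (rule nn_integral_liminf) measurable
      also have "\<dots> \<le> liminf (\<lambda>k. ennreal e)"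
        by (rule Liminf_mono) (use k0 in \<open>auto simp: eventually_sequentially\<close>)
      also have "\<dots> = ennreal e" by (simp add: Liminf_const)
      finally show ?thesis .
    qed
    then show ?thesis by blast
  qed
  then show ?thesis using that[of f] by simp
qed

section \<open>Completeness of the energy space\<close>

lemma tendsto_0_ennrealI:
  assumes "\<And>e. e > 0 \<Longrightarrow> \<exists>N. \<forall>n\<ge>N. f n \<le> ennreal e"
  shows "f \<longlonglongrightarrow> (0 :: ennreal)"
proof (rule order_tendstoI)
  fix a :: ennreal assume "0 < a"
  then obtain b where b: "0 < b" "b < a" using dense by blast
  then have "b < top" by (meson less_le_trans top_greatest)
  then obtain e where "b = ennreal e" unfolding less_top_ennreal by blast
  then have e: "0 < ennreal e" "ennreal e < a" using b by auto
  then have "e > 0" by simp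
  then obtain N where "\<forall>n\<ge>N. f n \<le> ennreal e" using assms by blast
  then show "\<forall>\<^sub>F n in sequentially. f n < a"
    unfolding eventually_sequentially using e(2) le_less_trans by blast
qed simp

lemma ennreal_square_le_imp_le_sqrt:
  assumes "x\<^sup>2 \<le> ennreal c" "0 \<le> c"
  shows "x \<le> ennreal (sqrt c)"
proof (cases x)
  case (real r)
  then have "r\<^sup>2 \<le> c" using assms by (simp add: ennreal_power)
  then show ?thesis using real by (simp add: ennreal_leI real_le_rsqrt)
next
  case top
  then show ?thesis using assms by (simp add: power2_eq_square ennreal_mult_top top_unique)
qed

lemma norm_fst_le_norm: "norm (fst p) \<le> norm p"
  using norm_fst_le[of "fst p" "snd p"] by simp

lemma norm_snd_le_norm: "norm (snd p) \<le> norm p"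
  using norm_snd_le[of "snd p" "fst p"] by simp

context heights
begin

definition energy_measure :: "real \<Rightarrow> ((real ^ 'd) \<times> real) measure" where
  "energy_measure \<alpha> = density lborel (\<lambda>z. ennreal (snd z powr \<alpha>) * indicator (UNIV \<times> I) z)"

text \<open>The weighted Sobolev norm is the \<open>L\<^sup>2\<close> norm of this vector, made of the function and its
  weak gradient.\<close>

definition energy_vector ::
  "((real ^ 'd) \<times> real \<Rightarrow> real) \<Rightarrow> ((real ^ 'd) \<times> real \<Rightarrow> (real ^ 'd) \<times> real) \<Rightarrow>
    (real ^ 'd) \<times> real \<Rightarrow> real \<times> ((real ^ 'd) \<times> real)" where
  "energy_vector U G z = (indicator (UNIV \<times> I) z * U z / rho z, indicator (UNIV \<times> I) z *\<^sub>R G z)"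

definition total_energy :: "real \<Rightarrow> ((real ^ 'd) \<times> real \<Rightarrow> real) \<Rightarrow> ennreal" where
  "total_energy \<alpha> U = grad_energy \<alpha> (UNIV \<times> I) U + mass_energy \<alpha> (UNIV \<times> I) U"

lemma sets_energy_measure [simp, measurable_cong]: "sets (energy_measure \<alpha>) = sets borel"
  by (simp add: energy_measure_def)

lemma nn_integral_energy_measure:
  assumes "f \<in> borel_measurable borel"
  shows "(\<integral>\<^sup>+z. f z \<partial>(energy_measure \<alpha> :: ((real ^ 'd) \<times> real) measure))
    = (\<integral>\<^sup>+z\<in>UNIV \<times> I. ennreal (snd z powr \<alpha>) * f z \<partial>lborel)"
  unfolding energy_measure_def using assms
  by (subst nn_integral_density) (auto intro!: nn_integral_cong simp: mult_ac)

lemma AE_energy_measure: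
  assumes "AE z in lborel. z \<in> UNIV \<times> I \<longrightarrow> P z"
  shows "AE z in (energy_measure \<alpha> :: ((real ^ 'd) \<times> real) measure). P z"
proof -
  have m: "(\<lambda>z :: (real ^ 'd) \<times> real. ennreal (snd z powr \<alpha>) * indicator (UNIV \<times> I) z) \<in> borel_measurable lborel"
    by measurable
  show ?thesis
    unfolding energy_measure_def AE_density[OF m]
    using assms by eventually_elim (auto simp: indicator_def split: if_splits)
qed

lemma measurable_energy_vector:
  assumes "has_weak_gradient (UNIV \<times> I) U G"
  shows "energy_vector U G \<in> borel_measurable borel"
  using measurable_H1rho[OF assms] unfolding energy_vector_def by measurable

lemma total_energy_eq:
  assumes U: "has_weak_gradient (UNIV \<times> I) U G"
  shows "total_energy \<alpha> U = (\<integral>\<^sup>+z. ennreal ((norm (energy_vector U G z))\<^sup>2) \<partial>energy_measure \<alpha>)"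
proof -
  let ?D = "UNIV \<times> I :: ((real ^ 'd) \<times> real) set"
  let ?G = "weak_grad ?D U"
  have wg: "has_weak_gradient ?D U ?G" by (rule has_weak_gradient_weak_grad[OF U])
  note [measurable] = measurable_energy_vector[OF wg] measurable_energy_vector[OF U]
  have "AE z in lborel. z \<in> ?D \<longrightarrow> ?G z = G z"
    by (rule has_weak_gradient_unique[OF open_cylinder wg U]) simp
  then have "AE z in energy_measure \<alpha>. ?G z = G z" by (rule AE_energy_measure)
  then have "(\<integral>\<^sup>+z. ennreal ((norm (energy_vector U G z))\<^sup>2) \<partial>energy_measure \<alpha>)
      = (\<integral>\<^sup>+z. ennreal ((norm (energy_vector U ?G z))\<^sup>2) \<partial>energy_measure \<alpha>)"
    by (intro nn_integral_cong_AE) (auto elim!: eventually_mono simp: energy_vector_def)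
  also have "\<dots> = (\<integral>\<^sup>+z\<in>?D. ennreal (snd z powr \<alpha>) * ennreal ((norm (energy_vector U ?G z))\<^sup>2) \<partial>lborel)"
    by (rule nn_integral_energy_measure) measurable
  also have "\<dots> = (\<integral>\<^sup>+z. ennreal (indicator ?D z * H1rho_density \<alpha> ?D U z) \<partial>lborel)"
    by (intro nn_integral_cong)
      (auto simp: energy_vector_def H1rho_density_def norm_Pair indicator_def power_divide ennreal_mult' add.commute)
  also have "\<dots> = total_energy \<alpha> U"
    by (simp add: nn_integral_H1rho_density(2)[OF wg] total_energy_def)
  finally show ?thesis by simp
qed

lemma energy_vector_linear:
  "energy_vector (\<lambda>z. U z + t * V z) (\<lambda>z. G z + t *\<^sub>R H z) z = energy_vector U G z + t *\<^sub>R energy_vector V H z"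
  by (simp add: energy_vector_def prod_eq_iff indicator_def add_divide_distrib)

lemma H1rho_iff_total_energy:
  fixes U :: "(real ^ 'd) \<times> real \<Rightarrow> real"
  shows "U \<in> H1rho \<alpha> (UNIV \<times> I) \<longleftrightarrow>
    has_weak_gradient (UNIV \<times> I) U (weak_grad (UNIV \<times> I) U) \<and> total_energy \<alpha> U < \<infinity>"
  by (simp add: H1rho_iff total_energy_def)

lemma norm_add_squared_le: "(norm (x + y))\<^sup>2 \<le> 2 * (norm x)\<^sup>2 + 2 * (norm (y :: 'a::real_normed_vector))\<^sup>2"
  by (rule order_trans[OF power_mono[OF norm_triangle_ineq norm_ge_zero] square_add_le])

lemma nn_integral_norm_add_squared_le:
  fixes f g :: "'a \<Rightarrow> 'b::euclidean_space"
  assumes [measurable]: "f \<in> borel_measurable M" "g \<in> borel_measurable M"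
  shows "(\<integral>\<^sup>+z. ennreal ((norm (f z + g z))\<^sup>2) \<partial>M)
    \<le> 2 * (\<integral>\<^sup>+z. ennreal ((norm (f z))\<^sup>2) \<partial>M) + 2 * (\<integral>\<^sup>+z. ennreal ((norm (g z))\<^sup>2) \<partial>M)"
proof -
  have "(\<integral>\<^sup>+z. ennreal ((norm (f z + g z))\<^sup>2) \<partial>M)
      \<le> (\<integral>\<^sup>+z. 2 * ennreal ((norm (f z))\<^sup>2) + 2 * ennreal ((norm (g z))\<^sup>2) \<partial>M)"
    using ennreal_leI[OF norm_add_squared_le] by (intro nn_integral_mono) (simp add: ennreal_plus ennreal_mult)
  also have "\<dots> = 2 * (\<integral>\<^sup>+z. ennreal ((norm (f z))\<^sup>2) \<partial>M) + 2 * (\<integral>\<^sup>+z. ennreal ((norm (g z))\<^sup>2) \<partial>M)"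
    by (rule nn_integral_linear) measurable
  finally show ?thesis .
qed

lemma H1rho_linear:
  fixes U V :: "(real ^ 'd) \<times> real \<Rightarrow> real"
  assumes U: "U \<in> H1rho \<alpha> (UNIV \<times> I)" and V: "V \<in> H1rho \<alpha> (UNIV \<times> I)"
  shows "(\<lambda>z. U z + t * V z) \<in> H1rho \<alpha> (UNIV \<times> I)"
    and "AE z in lborel. z \<in> UNIV \<times> I \<longrightarrow> weak_grad (UNIV \<times> I) (\<lambda>z. U z + t * V z) z
      = weak_grad (UNIV \<times> I) U z + t *\<^sub>R weak_grad (UNIV \<times> I) V z"
proof -
  let ?D = "UNIV \<times> I :: ((real ^ 'd) \<times> real) set"
  let ?W = "\<lambda>z. U z + t * V z"
  have u: "has_weak_gradient ?D U (weak_grad ?D U)" "total_energy \<alpha> U < \<infinity>"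
    and v: "has_weak_gradient ?D V (weak_grad ?D V)" "total_energy \<alpha> V < \<infinity>"
    using U V by (auto simp: H1rho_iff_total_energy)
  have w: "has_weak_gradient ?D ?W (\<lambda>z. weak_grad ?D U z + t *\<^sub>R weak_grad ?D V z)"
    by (rule has_weak_gradient_linear[OF u(1) v(1)])
  note [measurable] = measurable_energy_vector[OF u(1)] measurable_energy_vector[OF v(1)]
  have "total_energy \<alpha> ?W = (\<integral>\<^sup>+z. ennreal ((norm (energy_vector U (weak_grad ?D U) z
      + t *\<^sub>R energy_vector V (weak_grad ?D V) z))\<^sup>2) \<partial>energy_measure \<alpha>)"
    by (simp add: total_energy_eq[OF w] energy_vector_linear)
  also have "\<dots> \<le> 2 * (\<integral>\<^sup>+z. ennreal ((norm (energy_vector U (weak_grad ?D U) z))\<^sup>2) \<partial>energy_measure \<alpha>)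
      + 2 * (\<integral>\<^sup>+z. ennreal ((norm (t *\<^sub>R energy_vector V (weak_grad ?D V) z))\<^sup>2) \<partial>energy_measure \<alpha>)"
    by (rule nn_integral_norm_add_squared_le) measurable
  also have "(\<integral>\<^sup>+z. ennreal ((norm (t *\<^sub>R energy_vector V (weak_grad ?D V) z))\<^sup>2) \<partial>energy_measure \<alpha>)
      = ennreal (t\<^sup>2) * total_energy \<alpha> V"
    unfolding total_energy_eq[OF v(1)]
    by (subst nn_integral_cmult[symmetric]) (auto simp: power_mult_distrib ennreal_mult)
  also have "2 * (\<integral>\<^sup>+z. ennreal ((norm (energy_vector U (weak_grad ?D U) z))\<^sup>2) \<partial>energy_measure \<alpha>)
      + 2 * (ennreal (t\<^sup>2) * total_energy \<alpha> V) < \<infinity>"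
    using u(2) v(2) unfolding total_energy_eq[OF u(1), symmetric] by (simp add: ennreal_mult_less_top)
  finally have "total_energy \<alpha> ?W < \<infinity>" .
  then show "?W \<in> H1rho \<alpha> ?D"
    using has_weak_gradient_weak_grad[OF w] by (simp add: H1rho_iff_total_energy)
  show "AE z in lborel. z \<in> ?D \<longrightarrow> weak_grad ?D ?W z = weak_grad ?D U z + t *\<^sub>R weak_grad ?D V z"
    by (rule has_weak_gradient_unique[OF open_cylinder has_weak_gradient_weak_grad[OF w] w]) simp
qed

lemma total_energy_diff:
  assumes U: "has_weak_gradient (UNIV \<times> I) U G" and V: "has_weak_gradient (UNIV \<times> I) V H"
  shows "total_energy \<alpha> (\<lambda>z. U z + (-1) * V z)
    = (\<integral>\<^sup>+z. ennreal ((norm (energy_vector U G z - energy_vector V H z))\<^sup>2) \<partial>energy_measure \<alpha>)"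
  using total_energy_eq[OF has_weak_gradient_linear[OF U V, of "-1"]] energy_vector_linear[of U "-1" V G H] by simp

text \<open>On compact subsets of the cylinder the weights are harmless.\<close>

lemma local_L1_bound:
  fixes K :: "((real ^ 'd) \<times> real) set"
  assumes K: "compact K" "K \<subseteq> UNIV \<times> I"
  obtains C :: real where "0 \<le> C"
    "\<forall>f \<in> borel_measurable borel.
      (\<integral>\<^sup>+z\<in>K. ennreal \<bar>f z\<bar> \<partial>lborel)\<^sup>2
      \<le> ennreal C * (\<integral>\<^sup>+z\<in>UNIV \<times> I. ennreal (snd z powr \<alpha>) * ennreal ((f z)\<^sup>2 / (rho z)\<^sup>2) \<partial>lborel)"
proof -
  have [measurable]: "K \<in> sets borel" using K(1) by (simp add: borel_closed compact_imp_closed)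
  define w where "w z = snd z powr \<alpha> / (rho z)\<^sup>2" for z :: "(real ^ 'd) \<times> real"
  have [measurable]: "w \<in> borel_measurable borel" unfolding w_def by measurable
  have y: "snd z > 0" if "z \<in> K" for z
  proof -
    have "z \<in> UNIV \<times> I" by (rule subsetD[OF K(2) that])
    then show ?thesis using I_pos by auto
  qed
  have rho0: "(rho z)\<^sup>2 > 0" for z :: "(real ^ 'd) \<times> real" using rho_ge_1[of z] by simp
  have pos: "w z > 0" if "z \<in> K" for z
    unfolding w_def using y[OF that] rho0 by simp
  have "continuous_on K (\<lambda>z. 1 / w z)"
    unfolding w_def rho_squared
  proof (intro continuous_intros ballI)
    fix z assume z: "z \<in> K"
    show "snd z \<noteq> 0" using y[OF z] by simp
    show "1 + (norm (fst z))\<^sup>2 + (snd z)\<^sup>2 \<noteq> 0" using rho0[of z] unfolding rho_squared by simp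
    show "snd z powr \<alpha> / (1 + (norm (fst z))\<^sup>2 + (snd z)\<^sup>2) \<noteq> 0"
      using less_imp_neq[OF pos[OF z]] unfolding w_def rho_squared by (rule not_sym)
  qed
  then have "compact ((\<lambda>z. 1 / w z) ` K)" using K(1) by (rule compact_continuous_image)
  then have "bounded ((\<lambda>z. 1 / w z) ` K)" by (rule compact_imp_bounded)
  then obtain B where B0: "\<forall>x\<in>(\<lambda>z. 1 / w z) ` K. norm x \<le> B" unfolding bounded_iff by blast
  have B: "1 / w z \<le> \<bar>B\<bar>" if "z \<in> K" for z
  proof -
    have "norm (1 / w z) \<le> B" using B0 that by blast
    then show ?thesis using abs_ge_self[of "1 / w z"] abs_ge_self[of B] unfolding real_norm_def by (meson order_trans)
  qed
  have "(\<integral>\<^sup>+z\<in>K. ennreal (1 / w z) \<partial>lborel) \<le> (\<integral>\<^sup>+z. ennreal \<bar>B\<bar> * indicator K z \<partial>lborel)"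
  proof (rule nn_integral_mono)
    fix z
    show "ennreal (1 / w z) * indicator K z \<le> ennreal \<bar>B\<bar> * indicator K z"
      using B by (cases "z \<in> K") (simp_all add: ennreal_leI)
  qed
  also have "\<dots> < \<infinity>"
    using emeasure_bounded_finite[OF compact_imp_bounded[OF K(1)]]
    by (subst nn_integral_cmult_indicator) (auto simp: ennreal_mult_less_top)
  finally obtain C where C: "0 \<le> C" "(\<integral>\<^sup>+z\<in>K. ennreal (1 / w z) \<partial>lborel) = ennreal C"
    unfolding infinity_ennreal_def less_top_ennreal by blast
  show ?thesis
  proof (rule that[OF C(1)], rule ballI)
    fix f :: "(real ^ 'd) \<times> real \<Rightarrow> real" assume [measurable]: "f \<in> borel_measurable borel"
    have "(\<integral>\<^sup>+z\<in>K. ennreal \<bar>f z\<bar> \<partial>lborel)\<^sup>2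
        \<le> (\<integral>\<^sup>+z\<in>K. ennreal (1 / w z) \<partial>lborel) * (\<integral>\<^sup>+z\<in>K. ennreal (w z) * (ennreal \<bar>f z\<bar>)\<^sup>2 \<partial>lborel)"
      by (rule weighted_Cauchy_Schwarz) (use pos in auto)
    also have "\<dots> \<le> ennreal C * (\<integral>\<^sup>+z\<in>UNIV \<times> I. ennreal (snd z powr \<alpha>) * ennreal ((f z)\<^sup>2 / (rho z)\<^sup>2) \<partial>lborel)"
      unfolding C(2)
    proof (intro mult_left_mono nn_integral_mono)
      fix z :: "(real ^ 'd) \<times> real"
      have "ennreal (w z) * (ennreal \<bar>f z\<bar>)\<^sup>2 = ennreal (snd z powr \<alpha>) * ennreal ((f z)\<^sup>2 / (rho z)\<^sup>2)"
        by (simp add: w_def ennreal_power ennreal_mult[symmetric])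
      then show "ennreal (w z) * (ennreal \<bar>f z\<bar>)\<^sup>2 * indicator K z
          \<le> ennreal (snd z powr \<alpha>) * ennreal ((f z)\<^sup>2 / (rho z)\<^sup>2) * indicator (UNIV \<times> I) z"
        using K(2) by (auto simp: indicator_def)
    qed simp
    finally show "(\<integral>\<^sup>+z\<in>K. ennreal \<bar>f z\<bar> \<partial>lborel)\<^sup>2
      \<le> ennreal C * (\<integral>\<^sup>+z\<in>UNIV \<times> I. ennreal (snd z powr \<alpha>) * ennreal ((f z)\<^sup>2 / (rho z)\<^sup>2) \<partial>lborel)" .
  qed
qed

text \<open>The vectors \<open>(U\<^sub>n / \<rho>, \<nabla> U\<^sub>n)\<close> converge in \<open>L\<^sup>2\<close> with the weight \<open>y powr \<alpha>\<close>. This convergence implies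
  convergence in \<open>L\<^sup>1\<close> on compact subsets, so that the second component of the limit is the weak
  gradient of \<open>\<rho>\<close> times the first one.\<close>

lemma H1rho_complete:
  fixes U :: "nat \<Rightarrow> (real ^ 'd) \<times> real \<Rightarrow> real"
  assumes U: "\<And>n. U n \<in> H1rho \<alpha> (UNIV \<times> I)"
    and cauchy: "\<And>e. e > 0 \<Longrightarrow> \<exists>N. \<forall>m\<ge>N. \<forall>n\<ge>N. total_energy \<alpha> (\<lambda>z. U m z + (-1) * U n z) \<le> ennreal e"
  obtains V where "V \<in> H1rho \<alpha> (UNIV \<times> I)"
    "\<forall>e>0. \<exists>N. \<forall>n\<ge>N. total_energy \<alpha> (\<lambda>z. U n z + (-1) * V z) \<le> ennreal e"
proof -
  let ?D = "UNIV \<times> I :: ((real ^ 'd) \<times> real) set"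
  let ?M = "energy_measure \<alpha> :: ((real ^ 'd) \<times> real) measure"
  define G where "G n = weak_grad ?D (U n)" for n
  have wg: "has_weak_gradient ?D (U n) (G n)" and fin: "total_energy \<alpha> (U n) < \<infinity>" for n
    using U[of n] by (auto simp: H1rho_iff_total_energy G_def)
  define F where "F n = energy_vector (U n) (G n)" for n
  have Fm [measurable]: "F n \<in> borel_measurable borel" for n
    unfolding F_def by (rule measurable_energy_vector[OF wg])
  have Fm' [measurable]: "F n \<in> borel_measurable ?M" for n by measurable
  have cauchyF: "\<exists>N. \<forall>m\<ge>N. \<forall>n\<ge>N. (\<integral>\<^sup>+z. ennreal ((norm (F m z - F n z))\<^sup>2) \<partial>?M) \<le> ennreal e" if "e > 0" for e
    using cauchy[OF that] unfolding total_energy_diff[OF wg wg] F_def .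
  obtain f where f0: "f \<in> borel_measurable ?M"
    and lim0: "\<forall>e>0. \<exists>N. \<forall>n\<ge>N. (\<integral>\<^sup>+z. ennreal ((norm (F n z - f z))\<^sup>2) \<partial>?M) \<le> ennreal e"
    by (rule L2_complete[of F ?M, OF Fm' cauchyF])
  note lim = lim0[rule_format]
  have f [measurable]: "f \<in> borel_measurable borel" using f0 by simp
  define V where "V z = rho z * fst (f z)" for z
  define H where "H z = snd (f z)" for z
  have [measurable]: "V \<in> borel_measurable borel" "H \<in> borel_measurable borel"
    unfolding V_def[abs_def] H_def[abs_def] by measurable
  have vec: "energy_vector V H z = f z" if "z \<in> ?D" for z
    using that rho_ge_1[of z] by (simp add: energy_vector_def V_def H_def prod_eq_iff)
  have ffin: "(\<integral>\<^sup>+z. ennreal ((norm (f z))\<^sup>2) \<partial>?M) < \<infinity>"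
  proof -
    obtain N where "(\<integral>\<^sup>+z. ennreal ((norm (F N z - f z))\<^sup>2) \<partial>?M) \<le> ennreal 1"
      using lim[of 1] by auto
    then have 1: "(\<integral>\<^sup>+z. ennreal ((norm (f z - F N z))\<^sup>2) \<partial>?M) < \<infinity>"
      by (simp add: norm_minus_commute le_less_trans)
    have "(\<integral>\<^sup>+z. ennreal ((norm (F N z + (f z - F N z)))\<^sup>2) \<partial>?M)
        \<le> 2 * (\<integral>\<^sup>+z. ennreal ((norm (F N z))\<^sup>2) \<partial>?M) + 2 * (\<integral>\<^sup>+z. ennreal ((norm (f z - F N z))\<^sup>2) \<partial>?M)"
      by (rule nn_integral_norm_add_squared_le) measurable
    also have "\<dots> < \<infinity>"
      using 1 fin[of N] unfolding total_energy_eq[OF wg] F_def by (simp add: ennreal_mult_less_top)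
    finally show ?thesis by simp
  qed
  have onD: "(\<integral>\<^sup>+z\<in>?D. ennreal (snd z powr \<alpha>) * ennreal ((c z)\<^sup>2 / (rho z)\<^sup>2) \<partial>lborel)
      \<le> (\<integral>\<^sup>+z. ennreal ((norm (g z))\<^sup>2) \<partial>?M)"
    if [measurable]: "g \<in> borel_measurable borel" and "\<And>z. z \<in> ?D \<Longrightarrow> \<bar>c z\<bar> / rho z \<le> norm (g z)"
    for c and g :: "(real ^ 'd) \<times> real \<Rightarrow> real \<times> ((real ^ 'd) \<times> real)"
  proof -
    have "(\<integral>\<^sup>+z. ennreal ((norm (g z))\<^sup>2) \<partial>?M) = (\<integral>\<^sup>+z\<in>?D. ennreal (snd z powr \<alpha>) * ennreal ((norm (g z))\<^sup>2) \<partial>lborel)"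
      by (rule nn_integral_energy_measure) measurable
    moreover have "ennreal (snd z powr \<alpha>) * ennreal ((c z)\<^sup>2 / (rho z)\<^sup>2) * indicator ?D z
        \<le> ennreal (snd z powr \<alpha>) * ennreal ((norm (g z))\<^sup>2) * indicator ?D z" for z
    proof (cases "z \<in> ?D")
      case True
      have "(\<bar>c z\<bar> / rho z)\<^sup>2 \<le> (norm (g z))\<^sup>2"
        using that(2)[OF True] rho_ge_1[of z] by (intro power_mono) auto
      then show ?thesis
        using True by (intro mult_right_mono mult_left_mono ennreal_leI) (auto simp: power_divide)
    qed simp
    ultimately show ?thesis by (simp only: nn_integral_mono)
  qed
  have div_rho: "x / rho z \<le> x" if "0 \<le> x" for x and z :: "(real ^ 'd) \<times> real"
    using divide_left_mono[OF rho_ge_1[of z] that] rho_ge_1[of z] by simp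
  have bV: "\<bar>V z\<bar> / rho z \<le> norm (f z)" "norm (H z) / rho z \<le> norm (f z)" for z
    using rho_ge_1[of z] norm_fst_le[of "fst (f z)" "snd (f z)"] norm_snd_le[of "snd (f z)" "fst (f z)"]
      div_rho[of "norm (H z)" z]
    by (auto simp: V_def H_def abs_mult)
  have bd: "\<bar>indicator ?D z * U n z - V z\<bar> / rho z \<le> norm (F n z - f z)"
      "\<bar>(indicator ?D z *\<^sub>R G n z) \<bullet> b - H z \<bullet> b\<bar> / rho z \<le> norm (F n z - f z)" if "z \<in> ?D" "b \<in> Basis" for z n b
  proof -
    have r: "rho z > 0" using rho_ge_1[of z] by linarith
    have "fst (F n z - f z) = (indicator ?D z * U n z - V z) / rho z"
      using that r by (simp add: F_def energy_vector_def V_def diff_divide_distrib)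
    then show "\<bar>indicator ?D z * U n z - V z\<bar> / rho z \<le> norm (F n z - f z)"
      using norm_fst_le_norm[of "F n z - f z"] r by (simp add: abs_divide del: fst_diff)
    have "snd (F n z - f z) = indicator ?D z *\<^sub>R G n z - H z"
      using that by (simp add: F_def energy_vector_def H_def)
    then have "norm (indicator ?D z *\<^sub>R G n z - H z) \<le> norm (F n z - f z)"
      using norm_snd_le_norm[of "F n z - f z"] by (simp del: snd_diff)
    moreover have "\<bar>(indicator ?D z *\<^sub>R G n z) \<bullet> b - H z \<bullet> b\<bar> \<le> norm (indicator ?D z *\<^sub>R G n z - H z)"
      using Basis_le_norm[OF that(2), of "indicator ?D z *\<^sub>R G n z - H z"] by (simp add: inner_diff_left)
    ultimately show "\<bar>(indicator ?D z *\<^sub>R G n z) \<bullet> b - H z \<bullet> b\<bar> / rho z \<le> norm (F n z - f z)"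
      using div_rho[of "\<bar>(indicator ?D z *\<^sub>R G n z) \<bullet> b - H z \<bullet> b\<bar>" z] by linarith
  qed
  have loc: "(\<integral>\<^sup>+z\<in>K. ennreal \<bar>c z\<bar> \<partial>lborel) < \<infinity>"
    if K: "compact K" "K \<subseteq> ?D" and cm [measurable]: "c \<in> borel_measurable borel"
      and cb: "\<And>z. \<bar>c z\<bar> / rho z \<le> norm (f z)" for K c
  proof -
    obtain C where "0 \<le> C" and C: "\<forall>c\<in>borel_measurable borel. (\<integral>\<^sup>+z\<in>K. ennreal \<bar>c z\<bar> \<partial>lborel)\<^sup>2
      \<le> ennreal C * (\<integral>\<^sup>+z\<in>?D. ennreal (snd z powr \<alpha>) * ennreal ((c z)\<^sup>2 / (rho z)\<^sup>2) \<partial>lborel)"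
      by (rule local_L1_bound[OF K])
    have "(\<integral>\<^sup>+z\<in>K. ennreal \<bar>c z\<bar> \<partial>lborel)\<^sup>2
      \<le> ennreal C * (\<integral>\<^sup>+z\<in>?D. ennreal (snd z powr \<alpha>) * ennreal ((c z)\<^sup>2 / (rho z)\<^sup>2) \<partial>lborel)"
      using C cm by blast
    also have "\<dots> \<le> ennreal C * (\<integral>\<^sup>+z. ennreal ((norm (f z))\<^sup>2) \<partial>?M)"
      using cb by (intro mult_left_mono onD) auto
    also have "\<dots> < \<infinity>" using ffin by (simp add: ennreal_mult_less_top)
    finally show ?thesis
      by (auto simp: power2_eq_square ennreal_mult_less_top less_top[symmetric] ennreal_mult_eq_top_iff)
  qed
  have liV: "locally_integrable ?D V"
    unfolding locally_integrable_def set_integrable_def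
  proof safe
    fix K assume K: "compact K" "K \<subseteq> ?D"
    have [measurable]: "K \<in> sets borel" using K(1) by (simp add: borel_closed compact_imp_closed)
    have "(\<integral>\<^sup>+z. ennreal (norm (indicator K z *\<^sub>R V z)) \<partial>lborel) = (\<integral>\<^sup>+z\<in>K. ennreal \<bar>V z\<bar> \<partial>lborel)"
      by (intro nn_integral_cong) (auto simp: indicator_def)
    also have "\<dots> < \<infinity>" by (rule loc[OF K _ bV(1)]) measurable
    finally show "integrable lborel (\<lambda>z. indicator K z *\<^sub>R V z)" by (intro integrableI_bounded) auto
  qed
  have liH: "locally_integrable ?D H"
    unfolding locally_integrable_def set_integrable_def
  proof safe
    fix K assume K: "compact K" "K \<subseteq> ?D"
    have [measurable]: "K \<in> sets borel" using K(1) by (simp add: borel_closed compact_imp_closed)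
    have "(\<integral>\<^sup>+z. ennreal (norm (indicator K z *\<^sub>R H z)) \<partial>lborel) = (\<integral>\<^sup>+z\<in>K. ennreal \<bar>norm (H z)\<bar> \<partial>lborel)"
      by (intro nn_integral_cong) (auto simp: indicator_def)
    also have "\<dots> < \<infinity>" by (rule loc[OF K]) (use bV(2) in auto)
    finally show "integrable lborel (\<lambda>z. indicator K z *\<^sub>R H z)" by (intro integrableI_bounded) auto
  qed
  have conv: "(\<lambda>n. \<integral>\<^sup>+z\<in>K. ennreal \<bar>c n z\<bar> \<partial>lborel) \<longlonglongrightarrow> 0"
    if K: "compact K" "K \<subseteq> ?D" and cm [measurable]: "\<And>n. c n \<in> borel_measurable borel"
      and cb: "\<And>n z. z \<in> ?D \<Longrightarrow> \<bar>c n z\<bar> / rho z \<le> norm (F n z - f z)" for K c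
  proof (rule tendsto_0_ennrealI)
    fix e :: real assume e: "e > 0"
    obtain C where C0: "0 \<le> C" and C1: "\<forall>c\<in>borel_measurable borel. (\<integral>\<^sup>+z\<in>K. ennreal \<bar>c z\<bar> \<partial>lborel)\<^sup>2
      \<le> ennreal C * (\<integral>\<^sup>+z\<in>?D. ennreal (snd z powr \<alpha>) * ennreal ((c z)\<^sup>2 / (rho z)\<^sup>2) \<partial>lborel)"
      by (rule local_L1_bound[OF K])
    have C: "0 \<le> C" "\<And>n. (\<integral>\<^sup>+z\<in>K. ennreal \<bar>c n z\<bar> \<partial>lborel)\<^sup>2
      \<le> ennreal C * (\<integral>\<^sup>+z\<in>?D. ennreal (snd z powr \<alpha>) * ennreal ((c n z)\<^sup>2 / (rho z)\<^sup>2) \<partial>lborel)"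
      using C0 C1 cm by blast+
    obtain N where N: "\<And>n. n \<ge> N \<Longrightarrow> (\<integral>\<^sup>+z. ennreal ((norm (F n z - f z))\<^sup>2) \<partial>?M) \<le> ennreal (e\<^sup>2 / (C + 1))"
      using lim[of "e\<^sup>2 / (C + 1)"] e C(1) by (auto simp: zero_less_divide_iff)
    have "(\<integral>\<^sup>+z\<in>K. ennreal \<bar>c n z\<bar> \<partial>lborel) \<le> ennreal e" if "n \<ge> N" for n
    proof -
      have "(\<integral>\<^sup>+z\<in>K. ennreal \<bar>c n z\<bar> \<partial>lborel)\<^sup>2 \<le> ennreal C * (\<integral>\<^sup>+z. ennreal ((norm (F n z - f z))\<^sup>2) \<partial>?M)"
        using cb
        by (intro order_trans[OF C(2)] mult_left_mono onD) auto
      also have "\<dots> \<le> ennreal C * ennreal (e\<^sup>2 / (C + 1))"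
        by (intro mult_left_mono N that) simp
      also have "\<dots> \<le> ennreal (e\<^sup>2)"
        using C(1) by (subst ennreal_mult[symmetric]) (auto intro!: ennreal_leI mult_right_mono simp: divide_le_eq mult.commute)
      finally have "(\<integral>\<^sup>+z\<in>K. ennreal \<bar>c n z\<bar> \<partial>lborel) \<le> ennreal (sqrt (e\<^sup>2))"
        by (rule ennreal_square_le_imp_le_sqrt) simp
      then show ?thesis using e by simp
    qed
    then show "\<exists>N. \<forall>n\<ge>N. (\<integral>\<^sup>+z\<in>K. ennreal \<bar>c n z\<bar> \<partial>lborel) \<le> ennreal e" by blast
  qed
  note [measurable] = measurable_H1rho[OF wg]
  have wgV: "has_weak_gradient ?D V H"
  proof (rule has_weak_gradient_limit[OF wg liV liH])
    fix K :: "((real ^ 'd) \<times> real) set" assume K: "compact K" "K \<subseteq> ?D"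
    have "(\<lambda>n. \<integral>\<^sup>+z\<in>K. ennreal \<bar>indicator ?D z * U n z - V z\<bar> \<partial>lborel) \<longlonglongrightarrow> 0"
      by (rule conv[OF K]) (use bd(1)[OF _ SOME_Basis] in auto)
    moreover have "(\<integral>\<^sup>+z\<in>K. ennreal \<bar>indicator ?D z * U n z - V z\<bar> \<partial>lborel) = (\<integral>\<^sup>+z\<in>K. ennreal \<bar>U n z - V z\<bar> \<partial>lborel)" for n
      using K(2) by (intro nn_integral_cong) (auto simp: indicator_def)
    ultimately show "(\<lambda>n. \<integral>\<^sup>+z\<in>K. ennreal \<bar>U n z - V z\<bar> \<partial>lborel) \<longlonglongrightarrow> 0" by simp
    fix b :: "(real ^ 'd) \<times> real" assume b: "b \<in> Basis"
    have "(\<lambda>n. \<integral>\<^sup>+z\<in>K. ennreal \<bar>(indicator ?D z *\<^sub>R G n z) \<bullet> b - H z \<bullet> b\<bar> \<partial>lborel) \<longlonglongrightarrow> 0"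
    proof (rule conv[OF K])
      show "(\<lambda>z. (indicator ?D z *\<^sub>R G n z) \<bullet> b - H z \<bullet> b) \<in> borel_measurable borel" for n
        by measurable
    qed (rule bd(2)[OF _ b])
    moreover have "(\<integral>\<^sup>+z\<in>K. ennreal \<bar>(indicator ?D z *\<^sub>R G n z) \<bullet> b - H z \<bullet> b\<bar> \<partial>lborel)
        = (\<integral>\<^sup>+z\<in>K. ennreal \<bar>G n z \<bullet> b - H z \<bullet> b\<bar> \<partial>lborel)" for n
      using K(2) by (intro nn_integral_cong) (auto simp: indicator_def)
    ultimately show "(\<lambda>n. \<integral>\<^sup>+z\<in>K. ennreal \<bar>G n z \<bullet> b - H z \<bullet> b\<bar> \<partial>lborel) \<longlonglongrightarrow> 0" by simp
  qed
  have vecAE: "AE z in ?M. energy_vector V H z = f z"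
    by (rule AE_energy_measure) (use vec in auto)
  have "total_energy \<alpha> V = (\<integral>\<^sup>+z. ennreal ((norm (f z))\<^sup>2) \<partial>?M)"
    unfolding total_energy_eq[OF wgV]
    by (rule nn_integral_cong_AE) (use vecAE in \<open>eventually_elim, simp\<close>)
  then have V1: "V \<in> H1rho \<alpha> ?D"
    using ffin has_weak_gradient_weak_grad[OF wgV] by (simp add: H1rho_iff_total_energy)
  have V2: "\<exists>N. \<forall>n\<ge>N. total_energy \<alpha> (\<lambda>z. U n z + (-1) * V z) \<le> ennreal e" if "e > 0" for e
  proof -
    have "total_energy \<alpha> (\<lambda>z. U n z + (-1) * V z) = (\<integral>\<^sup>+z. ennreal ((norm (F n z - f z))\<^sup>2) \<partial>?M)" for n
      unfolding total_energy_diff[OF wg wgV] F_def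
      by (rule nn_integral_cong_AE) (use vecAE in \<open>eventually_elim, simp\<close>)
    then show ?thesis using lim[OF that] by simp
  qed
  show ?thesis using that[OF V1] V2 by simp
qed

end

section \<open>The bilinear form\<close>

lemma norm_matrix_vector_mult_le: "norm (M *v x) \<le> norm M * norm x" for M :: "real ^ 'm ^ 'n"
proof -
  have "norm (M *v x) = L2_set (\<lambda>i. \<bar>M $ i \<bullet> x\<bar>) UNIV"
    by (simp add: norm_vec_def matrix_vector_mul_component)
  also have "\<dots> \<le> L2_set (\<lambda>i. norm (M $ i) * norm x) UNIV"
    by (rule L2_set_mono) (auto intro: Cauchy_Schwarz_ineq2)
  also have "\<dots> = norm M * norm x"
    by (simp add: norm_vec_def[of M] L2_set_left_distrib)
  finally show ?thesis .
qed

lemma continuous_on_matrix_vector_mult: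
  fixes f :: "'a::topological_space \<Rightarrow> real ^ 'm ^ 'n"
  assumes "continuous_on S f" "continuous_on S g"
  shows "continuous_on S (\<lambda>x. f x *v g x)"
  unfolding matrix_vector_mult_def
  by (intro continuous_on_vec_lambda continuous_on_sum continuous_on_mult
      bounded_linear.continuous_on[OF bounded_linear_vec_nth] assms)

text \<open>The data of the variational problem on a cylinder, with a uniform bound for the coefficients in
  place of the domain outside of which they are the identity.\<close>

locale extension_problem = heights I h
  for I :: "real set" and h :: real +
  fixes \<AA> :: "real ^ 'd \<Rightarrow> real ^ 'd ^ 'd" and \<beta> s a \<Lambda> :: real
  assumes \<beta>: "0 < \<beta>" "\<beta> < 1" and s: "0 \<le> s"
    and \<AA>_cont: "continuous_on UNIV \<AA>"
    and \<AA>_sym: "\<And>x. transpose (\<AA> x) = \<AA> x"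
    and a_pos: "0 < a" and \<AA>_pos: "\<And>x \<eta>. a * (norm \<eta>)\<^sup>2 \<le> (\<AA> x *v \<eta>) \<bullet> \<eta>"
    and \<AA>_le: "\<And>x. norm (\<AA> x) \<le> \<Lambda>" and \<Lambda>: "1 \<le> \<Lambda>"
    and d_or_s: "CARD('d) \<ge> 3 \<or> s > 0"
begin

abbreviation \<alpha> :: real where "\<alpha> \<equiv> 1 - 2 * \<beta>"

abbreviation cyl :: "((real ^ 'd) \<times> real) set" where "cyl \<equiv> UNIV \<times> I"

lemma \<alpha>: "-1 < \<alpha>" "\<alpha> < 1" using \<beta> by auto

lemma d_const_pos: "0 < d_const \<beta>"
  unfolding d_const_def using \<beta> by (intro divide_pos_pos mult_pos_pos Gamma_real_pos) auto

lemma ext_mult_bounds: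
  shows "min a 1 * (norm w)\<^sup>2 \<le> ext_mult (\<AA> x) w \<bullet> w"
    and "\<bar>ext_mult (\<AA> x) v \<bullet> w\<bar> \<le> \<Lambda> * (norm v * norm w)"
proof -
  have "min a 1 * (norm w)\<^sup>2 = min a 1 * (norm (fst w))\<^sup>2 + min a 1 * (snd w)\<^sup>2"
    by (cases w) (simp add: norm_Pair distrib_left)
  also have "\<dots> \<le> a * (norm (fst w))\<^sup>2 + 1 * (snd w)\<^sup>2"
    by (intro add_mono mult_right_mono) auto
  also have "\<dots> \<le> (\<AA> x *v fst w) \<bullet> fst w + snd w * snd w"
    using \<AA>_pos[where \<eta>="fst w"] by (simp add: power2_eq_square)
  finally show "min a 1 * (norm w)\<^sup>2 \<le> ext_mult (\<AA> x) w \<bullet> w" by (simp add: ext_mult_def inner_prod_def)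
  have "norm (\<AA> x *v fst v) \<le> \<Lambda> * norm (fst v)"
    by (rule order_trans[OF norm_matrix_vector_mult_le mult_right_mono[OF \<AA>_le]]) simp
  then have 1: "(norm (\<AA> x *v fst v))\<^sup>2 \<le> (\<Lambda> * norm (fst v))\<^sup>2" by (rule power_mono) simp
  have 2: "(snd v)\<^sup>2 \<le> (\<Lambda> * snd v)\<^sup>2"
    using \<Lambda> mult_right_mono[OF one_le_power[OF \<Lambda>, of 2], of "(snd v)\<^sup>2"] by (simp add: power_mult_distrib)
  have "(norm (ext_mult (\<AA> x) v))\<^sup>2 \<le> (\<Lambda> * norm v)\<^sup>2"
    using add_mono[OF 1 2] by (cases v) (simp add: ext_mult_def norm_Pair power_mult_distrib distrib_left)
  then have "norm (ext_mult (\<AA> x) v) \<le> \<Lambda> * norm v"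
    by (rule power2_le_imp_le) (use \<Lambda> in simp)
  then have "norm (ext_mult (\<AA> x) v) * norm w \<le> \<Lambda> * norm v * norm w" by (rule mult_right_mono) simp
  then show "\<bar>ext_mult (\<AA> x) v \<bullet> w\<bar> \<le> \<Lambda> * (norm v * norm w)"
    using Cauchy_Schwarz_ineq2[of "ext_mult (\<AA> x) v" w] by simp
qed

lemma ext_mult_sym: "ext_mult (\<AA> x) v \<bullet> w = ext_mult (\<AA> x) w \<bullet> v"
proof -
  have "(\<AA> x *v fst v) \<bullet> fst w = fst v \<bullet> (\<AA> x *v fst w)"
    using dot_lmul_matrix[of "fst v" "\<AA> x" "fst w"] vector_transpose_matrix[of "fst v" "\<AA> x"]
    by (simp add: \<AA>_sym)
  then show ?thesis by (simp add: ext_mult_def inner_prod_def inner_commute)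
qed

lemma ext_mult_linear: "ext_mult M (v + t *\<^sub>R v') = ext_mult M v + t *\<^sub>R ext_mult M v'"
  by (simp add: ext_mult_def matrix_vector_right_distrib matrix_vector_mult_scaleR prod_eq_iff)

lemma measurable_ext_mult:
  fixes G H :: "(real ^ 'd) \<times> real \<Rightarrow> (real ^ 'd) \<times> real"
  assumes [measurable]: "G \<in> borel_measurable borel" "H \<in> borel_measurable borel"
  shows "(\<lambda>z. ext_mult (\<AA> (fst z)) (G z) \<bullet> H z) \<in> borel_measurable borel"
proof -
  have "continuous_on UNIV (\<lambda>p :: (real ^ 'd) \<times> ((real ^ 'd) \<times> real) \<times> ((real ^ 'd) \<times> real).
      ext_mult (\<AA> (fst p)) (fst (snd p)) \<bullet> snd (snd p))"
    unfolding ext_mult_def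
    by (intro continuous_intros continuous_on_matrix_vector_mult continuous_on_compose2[OF \<AA>_cont]) auto
  then have m: "(\<lambda>p :: (real ^ 'd) \<times> ((real ^ 'd) \<times> real) \<times> ((real ^ 'd) \<times> real).
      ext_mult (\<AA> (fst p)) (fst (snd p)) \<bullet> snd (snd p)) \<in> borel_measurable borel"
    by (rule borel_measurable_continuous_onI)
  have "(\<lambda>z :: (real ^ 'd) \<times> real. (fst z, G z, H z)) \<in> borel_measurable borel" by measurable
  from measurable_compose[OF this m] show ?thesis by simp
qed

definition gradient_form :: "((real ^ 'd) \<times> real \<Rightarrow> real) \<Rightarrow> ((real ^ 'd) \<times> real \<Rightarrow> real) \<Rightarrow> real" where
  "gradient_form U V = (LINT z:cyl|lborel. snd z powr \<alpha> *
      (ext_mult (\<AA> (fst z)) (weak_grad cyl U z) \<bullet> weak_grad cyl V z))"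

lemma gradient_integrable:
  assumes U: "U \<in> H1rho \<alpha> cyl"
  shows "integrable lborel (\<lambda>z. indicator cyl z * (snd z powr \<alpha> * (norm (weak_grad cyl U z))\<^sup>2))"
    and "ennreal (LINT z|lborel. indicator cyl z * (snd z powr \<alpha> * (norm (weak_grad cyl U z))\<^sup>2)) = grad_energy \<alpha> cyl U"
proof -
  have wg: "has_weak_gradient cyl U (weak_grad cyl U)" and fin: "grad_energy \<alpha> cyl U < \<infinity>"
    using U by (auto simp: H1rho_iff)
  note [measurable] = measurable_H1rho(2)[OF wg]
  have eq: "indicator cyl z * (snd z powr \<alpha> * (norm (weak_grad cyl U z))\<^sup>2)
      = snd z powr \<alpha> * (norm (indicator cyl z *\<^sub>R weak_grad cyl U z))\<^sup>2" for z
    by (auto simp: indicator_def)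
  have m: "(\<lambda>z. snd z powr \<alpha> * (norm (indicator cyl z *\<^sub>R weak_grad cyl U z))\<^sup>2) \<in> borel_measurable borel"
    by measurable
  have e: "(\<integral>\<^sup>+z. ennreal (snd z powr \<alpha> * (norm (indicator cyl z *\<^sub>R weak_grad cyl U z))\<^sup>2) \<partial>lborel) = grad_energy \<alpha> cyl U"
    unfolding grad_energy_def by (intro nn_integral_cong) (auto simp: indicator_def ennreal_mult)
  have i: "integrable lborel (\<lambda>z. snd z powr \<alpha> * (norm (indicator cyl z *\<^sub>R weak_grad cyl U z))\<^sup>2)"
  proof (rule integrableI_bounded)
    show "(\<integral>\<^sup>+z. ennreal (norm (snd z powr \<alpha> * (norm (indicator cyl z *\<^sub>R weak_grad cyl U z))\<^sup>2)) \<partial>lborel) < \<infinity>"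
      using e fin by simp
  qed (use m in simp)
  show "integrable lborel (\<lambda>z. indicator cyl z * (snd z powr \<alpha> * (norm (weak_grad cyl U z))\<^sup>2))"
    unfolding eq by (rule i)
  show "ennreal (LINT z|lborel. indicator cyl z * (snd z powr \<alpha> * (norm (weak_grad cyl U z))\<^sup>2)) = grad_energy \<alpha> cyl U"
    unfolding eq by (subst nn_integral_eq_integral[OF i, symmetric]) (simp_all add: e[simplified])
qed

lemma gradient_form_integrable:
  assumes U: "U \<in> H1rho \<alpha> cyl" and V: "V \<in> H1rho \<alpha> cyl"
  shows "integrable lborel (\<lambda>z. indicator cyl z * (snd z powr \<alpha> *
      (ext_mult (\<AA> (fst z)) (weak_grad cyl U z) \<bullet> weak_grad cyl V z)))"
proof -
  have wg: "has_weak_gradient cyl U (weak_grad cyl U)" "has_weak_gradient cyl V (weak_grad cyl V)"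
    using U V by (auto simp: H1rho_iff)
  have "(\<lambda>z :: (real ^ 'd) \<times> real. snd z powr \<alpha>) \<in> borel_measurable borel" by measurable
  then have "(\<lambda>z. snd z powr \<alpha> * (ext_mult (\<AA> (fst z)) (indicator cyl z *\<^sub>R weak_grad cyl U z)
      \<bullet> (indicator cyl z *\<^sub>R weak_grad cyl V z))) \<in> borel_measurable borel"
    by (rule borel_measurable_times[OF _ measurable_ext_mult[OF measurable_H1rho(2)[OF wg(1)] measurable_H1rho(2)[OF wg(2)]]])
  moreover have "snd z powr \<alpha> * (ext_mult (\<AA> (fst z)) (indicator cyl z *\<^sub>R weak_grad cyl U z)
      \<bullet> (indicator cyl z *\<^sub>R weak_grad cyl V z)) = indicator cyl z * (snd z powr \<alpha> *
      (ext_mult (\<AA> (fst z)) (weak_grad cyl U z) \<bullet> weak_grad cyl V z))" for z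
    by (simp add: indicator_def)
  ultimately have m: "(\<lambda>z. indicator cyl z * (snd z powr \<alpha> *
      (ext_mult (\<AA> (fst z)) (weak_grad cyl U z) \<bullet> weak_grad cyl V z))) \<in> borel_measurable lborel"
    by (simp only: measurable_lborel2)
  have i: "integrable lborel (\<lambda>z. \<Lambda> * (indicator cyl z * (snd z powr \<alpha> * (norm (weak_grad cyl U z))\<^sup>2)
      + indicator cyl z * (snd z powr \<alpha> * (norm (weak_grad cyl V z))\<^sup>2)))"
    by (intro integrable_mult_right Bochner_Integration.integrable_add gradient_integrable(1) U V)
  show ?thesis
  proof (rule Bochner_Integration.integrable_bound[OF i m], rule AE_I2)
    fix z :: "(real ^ 'd) \<times> real"
    let ?u = "norm (weak_grad cyl U z)" and ?v = "norm (weak_grad cyl V z)"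
    have "\<bar>ext_mult (\<AA> (fst z)) (weak_grad cyl U z) \<bullet> weak_grad cyl V z\<bar> \<le> \<Lambda> * (?u\<^sup>2 + ?v\<^sup>2)"
    proof (rule order_trans[OF ext_mult_bounds(2) mult_left_mono])
      have "p * q \<le> p\<^sup>2 + q\<^sup>2" if "0 \<le> p" "0 \<le> q" for p q :: real
        using sum_squares_bound[of p q] mult_nonneg_nonneg[OF that] by linarith
      then show "?u * ?v \<le> ?u\<^sup>2 + ?v\<^sup>2" by simp
    qed (use \<Lambda> in simp)
    from mult_left_mono[OF this, of "indicator cyl z * snd z powr \<alpha>"]
    show "norm (indicator cyl z * (snd z powr \<alpha> * (ext_mult (\<AA> (fst z)) (weak_grad cyl U z) \<bullet> weak_grad cyl V z)))
      \<le> norm (\<Lambda> * (indicator cyl z * (snd z powr \<alpha> * ?u\<^sup>2) + indicator cyl z * (snd z powr \<alpha> * ?v\<^sup>2)))"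
      using \<Lambda> by (cases "z \<in> cyl") (auto simp: abs_mult algebra_simps)
  qed
qed

lemma gradient_form_bounds:
  assumes U: "U \<in> H1rho \<alpha> cyl"
  shows "ennreal (min a 1) * grad_energy \<alpha> cyl U \<le> ennreal (gradient_form U U)"
    and "ennreal (gradient_form U U) \<le> ennreal \<Lambda> * grad_energy \<alpha> cyl U"
    and "0 \<le> gradient_form U U"
proof -
  let ?g = "\<lambda>z. indicator cyl z * (snd z powr \<alpha> * (norm (weak_grad cyl U z))\<^sup>2)"
  let ?f = "\<lambda>z. indicator cyl z * (snd z powr \<alpha> * (ext_mult (\<AA> (fst z)) (weak_grad cyl U z) \<bullet> weak_grad cyl U z))"
  have f: "gradient_form U U = (LINT z|lborel. ?f z)"
    by (simp add: gradient_form_def set_lebesgue_integral_def)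
  have l: "(LINT z|lborel. min a 1 * ?g z) \<le> (LINT z|lborel. ?f z)"
  proof (rule integral_mono[OF integrable_mult_right[OF gradient_integrable(1)[OF U]] gradient_form_integrable[OF U U]])
    fix z :: "(real ^ 'd) \<times> real"
    from mult_left_mono[OF ext_mult_bounds(1)[of "weak_grad cyl U z" "fst z"], of "indicator cyl z * snd z powr \<alpha>"]
    show "min a 1 * ?g z \<le> ?f z" by (simp add: mult_ac)
  qed
  have u: "(LINT z|lborel. ?f z) \<le> (LINT z|lborel. \<Lambda> * ?g z)"
  proof (rule integral_mono[OF gradient_form_integrable[OF U U] integrable_mult_right[OF gradient_integrable(1)[OF U]]])
    fix z :: "(real ^ 'd) \<times> real"
    have "ext_mult (\<AA> (fst z)) (weak_grad cyl U z) \<bullet> weak_grad cyl U z \<le> \<Lambda> * (norm (weak_grad cyl U z) * norm (weak_grad cyl U z))"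
      by (rule order_trans[OF abs_ge_self ext_mult_bounds(2)])
    from mult_left_mono[OF this, of "indicator cyl z * snd z powr \<alpha>"]
    show "?f z \<le> \<Lambda> * ?g z" by (simp add: mult_ac power2_eq_square)
  qed
  have g0: "0 \<le> (LINT z|lborel. ?g z)" by (rule Bochner_Integration.integral_nonneg) simp
  have m0: "0 \<le> min a 1" "0 \<le> \<Lambda>" using a_pos \<Lambda> by auto
  show "0 \<le> gradient_form U U"
    using l mult_nonneg_nonneg[OF m0(1) g0] unfolding f integral_mult_right_zero by linarith
  show "ennreal (min a 1) * grad_energy \<alpha> cyl U \<le> ennreal (gradient_form U U)"
    using ennreal_leI[OF l] unfolding f integral_mult_right_zero
    by (simp only: ennreal_mult[OF m0(1) g0] gradient_integrable(2)[OF U])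
  show "ennreal (gradient_form U U) \<le> ennreal \<Lambda> * grad_energy \<alpha> cyl U"
    using ennreal_leI[OF u] unfolding f integral_mult_right_zero
    by (simp only: ennreal_mult[OF m0(2) g0] gradient_integrable(2)[OF U])
qed

lemma gradient_form_sym: "gradient_form U V = gradient_form V U"
  unfolding gradient_form_def by (simp only: ext_mult_sym[of _ "weak_grad cyl U _"])

lemma gradient_form_linear:
  assumes U: "U \<in> H1rho \<alpha> cyl" and V: "V \<in> H1rho \<alpha> cyl" and W: "W \<in> H1rho \<alpha> cyl"
  shows "gradient_form (\<lambda>z. U z + t * V z) W = gradient_form U W + t * gradient_form V W"
proof -
  let ?f = "\<lambda>U z. indicator cyl z * (snd z powr \<alpha> * (ext_mult (\<AA> (fst z)) (weak_grad cyl U z) \<bullet> weak_grad cyl W z))"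
  let ?S = "\<lambda>z. U z + t * V z"
  have S: "?S \<in> H1rho \<alpha> cyl" by (rule H1rho_linear(1)[OF U V])
  have "(LINT z|lborel. ?f ?S z) = (LINT z|lborel. ?f U z + t * ?f V z)"
  proof (rule integral_cong_AE)
    show "?f ?S \<in> borel_measurable lborel"
      by (rule borel_measurable_integrable[OF gradient_form_integrable[OF S W]])
    show "(\<lambda>z. ?f U z + t * ?f V z) \<in> borel_measurable lborel"
      by (intro borel_measurable_add borel_measurable_times borel_measurable_const
          borel_measurable_integrable gradient_form_integrable U V W)
    show "AE z in lborel. ?f ?S z = ?f U z + t * ?f V z"
      using H1rho_linear(2)[OF U V, of t]
      by eventually_elim (auto simp: indicator_def ext_mult_linear inner_add_left algebra_simps)
  qed
  also have "\<dots> = (LINT z|lborel. ?f U z) + t * (LINT z|lborel. ?f V z)"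
    by (subst Bochner_Integration.integral_add)
      (simp_all only: gradient_form_integrable[OF U W] gradient_form_integrable[OF V W] integrable_mult_right
        integral_mult_right_zero simp_thms)
  finally show ?thesis by (simp add: gradient_form_def set_lebesgue_integral_def)
qed

end

section \<open>Coercivity and unique solvability\<close>

lemma L2_norm_squared:
  fixes g :: "'a::euclidean_space \<Rightarrow> real"
  assumes "g \<in> L2"
  shows "ennreal ((L2_norm_on UNIV g)\<^sup>2) = (\<integral>\<^sup>+x. ennreal ((g x)\<^sup>2) \<partial>lborel)"
proof -
  have i: "integrable lborel (\<lambda>x. (g x)\<^sup>2)" using assms by (simp add: L2_def)
  have "0 \<le> (LINT x|lborel. (g x)\<^sup>2)" by (rule Bochner_Integration.integral_nonneg) simp
  then show ?thesis
    using nn_integral_eq_integral[OF i] by (simp add: L2_norm_on_def set_lebesgue_integral_def)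
qed

lemma L2_iff:
  fixes g :: "'a::euclidean_space \<Rightarrow> real"
  shows "g \<in> L2 \<longleftrightarrow> g \<in> borel_measurable borel \<and> (\<integral>\<^sup>+x. ennreal ((g x)\<^sup>2) \<partial>lborel) < \<infinity>"
  by (auto simp: L2_def integrable_iff_bounded)

lemma L2_product_integrable:
  fixes f g :: "'a::euclidean_space \<Rightarrow> real"
  assumes f: "f \<in> L2" and g: "g \<in> L2"
  shows "integrable lborel (\<lambda>x. f x * g x)"
proof (rule Bochner_Integration.integrable_bound)
  show "integrable lborel (\<lambda>x. (f x)\<^sup>2 + (g x)\<^sup>2)" using f g by (simp add: L2_def)
  show "(\<lambda>x. f x * g x) \<in> borel_measurable lborel"
    using f g unfolding L2_def by (auto intro!: borel_measurable_times)
  have "\<bar>p * q\<bar> \<le> \<bar>p\<^sup>2 + q\<^sup>2\<bar>" for p q :: real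
  proof -
    have "2 * (\<bar>p\<bar> * \<bar>q\<bar>) \<le> p\<^sup>2 + q\<^sup>2"
      using sum_squares_bound[of "\<bar>p\<bar>" "\<bar>q\<bar>"] by (simp add: mult.assoc)
    moreover have "0 \<le> \<bar>p\<bar> * \<bar>q\<bar>" by simp
    ultimately have "\<bar>p\<bar> * \<bar>q\<bar> \<le> p\<^sup>2 + q\<^sup>2" by linarith
    then show ?thesis by (simp add: abs_mult)
  qed
  then show "AE x in lborel. norm (f x * g x) \<le> norm ((f x)\<^sup>2 + (g x)\<^sup>2)" by simp
qed

context extension_problem
begin

abbreviation E :: "((real ^ 'd) \<times> real \<Rightarrow> real) set" where "E \<equiv> energy_space \<alpha> s cyl"
abbreviation form :: "((real ^ 'd) \<times> real \<Rightarrow> real) \<Rightarrow> ((real ^ 'd) \<times> real \<Rightarrow> real) \<Rightarrow> real" where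
  "form \<equiv> bilinear_form \<beta> s \<AA> cyl"
abbreviation diff :: "((real ^ 'd) \<times> real \<Rightarrow> real) \<Rightarrow> ((real ^ 'd) \<times> real \<Rightarrow> real) \<Rightarrow> (real ^ 'd) \<times> real \<Rightarrow> real" where
  "diff U V \<equiv> (\<lambda>z. U z + (-1) * V z)"

lemma E_H1rho: "U \<in> E \<Longrightarrow> U \<in> H1rho \<alpha> cyl"
  by (simp add: energy_space_def)

lemma E_trace: "U \<in> E \<Longrightarrow> s > 0 \<Longrightarrow> trace0 U \<in> L2"
  by (simp add: energy_space_def)

lemma trace0_measurable: "U \<in> H1rho \<alpha> cyl \<Longrightarrow> trace0 U \<in> borel_measurable borel"
  using trace0_Hardy(1)[OF _ \<alpha>] by (auto simp: is_trace0_def)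

lemma trace0_linear:
  assumes U: "U \<in> H1rho \<alpha> cyl" and V: "V \<in> H1rho \<alpha> cyl"
  shows "AE x in lborel. trace0 (\<lambda>z. U z + t * V z) x = trace0 U x + t * trace0 V x"
proof -
  have wg: "has_weak_gradient cyl U (weak_grad cyl U)" "has_weak_gradient cyl V (weak_grad cyl V)"
    using U V by (auto simp: H1rho_iff)
  show ?thesis
    by (rule is_trace0_unique[OF has_weak_gradient_linear[OF wg]
          trace0_Hardy(1)[OF H1rho_linear(1)[OF U V] \<alpha>]
          is_trace0_linear[OF wg trace0_Hardy(1)[OF U \<alpha>] trace0_Hardy(1)[OF V \<alpha>]]])
qed

lemma E_linear:
  assumes U: "U \<in> E" and V: "V \<in> E"
  shows "(\<lambda>z. U z + t * V z) \<in> E"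
proof -
  let ?W = "\<lambda>z. U z + t * V z"
  note H = E_H1rho[OF U] E_H1rho[OF V]
  have W: "?W \<in> H1rho \<alpha> cyl" by (rule H1rho_linear(1)[OF H])
  have "trace0 ?W \<in> L2" if s0: "s > 0"
  proof -
    note u = E_trace[OF U s0] and v = E_trace[OF V s0]
    have i: "integrable lborel (\<lambda>x. (trace0 U x)\<^sup>2 + 2 * t * (trace0 U x * trace0 V x) + t\<^sup>2 * (trace0 V x)\<^sup>2)"
      using u v L2_product_integrable[OF u v] by (simp add: L2_def)
    have [measurable]: "trace0 U \<in> borel_measurable borel" "trace0 V \<in> borel_measurable borel" "trace0 ?W \<in> borel_measurable borel"
      by (rule trace0_measurable, rule H W)+
    have "integrable lborel (\<lambda>x. (trace0 ?W x)\<^sup>2)"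
    proof (rule integrable_cong_AE_imp[OF i])
      show "AE x in lborel. (trace0 U x)\<^sup>2 + 2 * t * (trace0 U x * trace0 V x) + t\<^sup>2 * (trace0 V x)\<^sup>2 = (trace0 ?W x)\<^sup>2"
        using trace0_linear[OF H, of t]
        by eventually_elim (simp add: power2_eq_square algebra_simps)
    qed measurable
    then show ?thesis by (simp add: L2_def)
  qed
  then show ?thesis using W by (simp add: energy_space_def)
qed

definition trace_form :: "((real ^ 'd) \<times> real \<Rightarrow> real) \<Rightarrow> ((real ^ 'd) \<times> real \<Rightarrow> real) \<Rightarrow> real" where
  "trace_form U V = (LINT x|lborel. trace0 U x * trace0 V x)"

lemma form_eq: "form U V = gradient_form U V + s * d_const \<beta> * trace_form U V"
  by (simp add: bilinear_form_def gradient_form_def trace_form_def)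

lemma form_sym: "form U V = form V U"
  unfolding form_eq by (simp add: gradient_form_sym[of U] trace_form_def mult.commute)

lemma form_linear:
  assumes U: "U \<in> E" and V: "V \<in> E" and W: "W \<in> E"
  shows "form (\<lambda>z. U z + t * V z) W = form U W + t * form V W"
proof -
  let ?S = "\<lambda>z. U z + t * V z"
  note H = E_H1rho[OF U] E_H1rho[OF V] E_H1rho[OF W]
  have "s * trace_form ?S W = s * (trace_form U W + t * trace_form V W)"
  proof (cases "s > 0")
    case True
    note L = E_trace[OF U True] E_trace[OF V True] E_trace[OF W True]
    have S: "trace0 ?S \<in> L2" by (rule E_trace[OF E_linear[OF U V] True])
    note i = L2_product_integrable[OF L(1,3)] L2_product_integrable[OF L(2,3)] L2_product_integrable[OF S L(3)]
    have "trace_form ?S W = (LINT x|lborel. trace0 U x * trace0 W x + t * (trace0 V x * trace0 W x))"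
      unfolding trace_form_def
    proof (rule integral_cong_AE)
      show "AE x in lborel. trace0 ?S x * trace0 W x = trace0 U x * trace0 W x + t * (trace0 V x * trace0 W x)"
        using trace0_linear[OF H(1,2), of t] by eventually_elim (simp add: algebra_simps)
    qed (use i in \<open>auto intro!: borel_measurable_integrable\<close>)
    also have "\<dots> = trace_form U W + t * trace_form V W"
      using i by (simp add: trace_form_def)
    finally show ?thesis by simp
  qed (use s in simp)
  then have "s * d_const \<beta> * trace_form ?S W = s * d_const \<beta> * (trace_form U W + t * trace_form V W)" by auto
  then show ?thesis unfolding form_eq gradient_form_linear[OF H] by (simp add: algebra_simps)
qed

text \<open>The bound of the mass by the other terms of the energy; it is independent of the cylinder.\<close>

definition mass_const :: real where
  "mass_const = (if s > 0 then max ((2 / (1 + \<alpha>) + 2 / (1 - \<alpha>)) / s) (8 / (1 - \<alpha>)\<^sup>2) else 36)"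

definition coercivity_const :: real where
  "coercivity_const = (mass_const + 1) / min (min a 1) (d_const \<beta>)"

lemma mass_const_nonneg: "0 \<le> mass_const"
  unfolding mass_const_def using \<alpha> s by (auto intro: max.coboundedI2)

lemma coercivity_const_pos: "0 < coercivity_const"
  unfolding coercivity_const_def using mass_const_nonneg a_pos d_const_pos by (intro divide_pos_pos) auto

text \<open>All quantities in the estimates are finite on the energy space, so that the inequalities between
  extended nonnegative numbers become linear inequalities between reals. The bound for the mass
  distinguishes the two ways to coercivity: through the trace if \<open>s > 0\<close>, and through horizontal
  dilations if \<open>d \<ge> 3\<close>.\<close>

lemma energies_real:
  assumes U: "U \<in> E"
  obtains g m where "0 \<le> g" "0 \<le> m" "grad_energy \<alpha> cyl U = ennreal g" "mass_energy \<alpha> cyl U = ennreal m"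
    "(H1rho_norm \<alpha> cyl U)\<^sup>2 = g + m" "m \<le> mass_const * (g + s * trace_form U U)"
    "min a 1 * g \<le> gradient_form U U" "gradient_form U U \<le> \<Lambda> * g"
    "0 \<le> trace_form U U" "s * (L2_norm_on UNIV (trace0 U))\<^sup>2 = s * trace_form U U"
    "total_energy \<alpha> U = ennreal (g + m)"
proof -
  note H = E_H1rho[OF U]
  have fin: "grad_energy \<alpha> cyl U < top" "mass_energy \<alpha> cyl U < top"
    using H by (auto simp: H1rho_iff)
  obtain g where g: "0 \<le> g" "grad_energy \<alpha> cyl U = ennreal g" using fin(1) unfolding less_top_ennreal by blast
  obtain m where m: "0 \<le> m" "mass_energy \<alpha> cyl U = ennreal m" using fin(2) unfolding less_top_ennreal by blast
  have total: "total_energy \<alpha> U = ennreal (g + m)"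
    unfolding total_energy_def g(2) m(2) using g(1) m(1) by (simp add: ennreal_plus)
  have norm: "(H1rho_norm \<alpha> cyl U)\<^sup>2 = g + m"
  proof -
    have "ennreal ((H1rho_norm \<alpha> cyl U)\<^sup>2) = ennreal (g + m)"
      using H1rho_norm_squared[OF H] total unfolding total_energy_def by (simp only:)
    then show ?thesis using g(1) m(1) by (subst (asm) ennreal_inj) auto
  qed
  have tf: "0 \<le> trace_form U U"
    unfolding trace_form_def by (rule Bochner_Integration.integral_nonneg) simp
  have tf2: "(L2_norm_on UNIV (trace0 U))\<^sup>2 = trace_form U U"
    using tf unfolding L2_norm_on_def trace_form_def by (simp add: set_lebesgue_integral_def power2_eq_square)
  have mass: "m \<le> mass_const * (g + s * trace_form U U)"
  proof (cases "s > 0")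
    case True
    let ?A = "2 / (1 + \<alpha>) + 2 / (1 - \<alpha>)" and ?B = "8 / (1 - \<alpha>)\<^sup>2" and ?T = "trace_form U U"
    have A0: "0 \<le> ?A" using \<alpha> by (intro add_nonneg_nonneg[OF divide_nonneg_nonneg divide_nonneg_nonneg]) auto
    have B0: "0 \<le> ?B" by simp
    have "ennreal m \<le> ennreal ?A * ennreal ?T + ennreal ?B * ennreal g"
      using mass_le_trace[OF H \<alpha>] L2_norm_squared[OF E_trace[OF U True]] unfolding g(2) m(2) tf2 by simp
    also have "\<dots> = ennreal (?A * ?T + ?B * g)"
      by (simp only: ennreal_plus[OF mult_nonneg_nonneg[OF A0 tf] mult_nonneg_nonneg[OF B0 g(1)]]
          ennreal_mult[OF A0 tf] ennreal_mult[OF B0 g(1)])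
    finally have "m \<le> ?A * ?T + ?B * g"
      using mult_nonneg_nonneg[OF A0 tf] mult_nonneg_nonneg[OF B0 g(1)] by (subst (asm) ennreal_le_iff) auto
    also have "\<dots> = ?A / s * (s * ?T) + ?B * g" using True by simp
    also have "\<dots> \<le> mass_const * (s * ?T) + mass_const * g"
      using True tf g(1) by (intro add_mono mult_right_mono) (auto simp: mass_const_def)
    finally show ?thesis by (simp add: distrib_left add.commute)
  next
    case False
    then have s0: "s = 0" and d: "CARD('d) \<ge> 3" using s d_or_s by auto
    have "ennreal m \<le> 36 * ennreal g" using mass_le_gradient[OF H d] unfolding g(2) m(2) .
    also have "\<dots> = ennreal (36 * g)" using g(1) by (simp add: ennreal_mult)
    finally have "m \<le> 36 * g" using g(1) by simp
    moreover have "mass_const = 36" unfolding mass_const_def using False by (rule if_not_P)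
    moreover have "g + s * trace_form U U = g" using s0 by simp
    ultimately show ?thesis by (simp only:)
  qed
  have m0: "0 \<le> min a 1" "0 \<le> \<Lambda>" using a_pos \<Lambda> by auto
  have "min a 1 * g \<le> gradient_form U U"
    using gradient_form_bounds(1)[OF H] unfolding g(2) ennreal_mult[OF m0(1) g(1), symmetric]
    by (rule ennreal_le_iff[OF gradient_form_bounds(3)[OF H], THEN iffD1])
  moreover have "gradient_form U U \<le> \<Lambda> * g"
    using gradient_form_bounds(2)[OF H] unfolding g(2) ennreal_mult[OF m0(2) g(1), symmetric]
    by (rule ennreal_le_iff[OF mult_nonneg_nonneg[OF m0(2) g(1)], THEN iffD1])
  ultimately show ?thesis
    using that[OF g(1) m(1) g(2) m(2) norm mass _ _ tf _ total] tf2 by simp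
qed

lemma coercive_bound:
  assumes U: "U \<in> E"
  shows "(energy_norm \<alpha> s cyl U)\<^sup>2 \<le> coercivity_const * form U U"
    and "0 \<le> form U U"
    and "(H1rho_norm \<alpha> cyl U)\<^sup>2 \<le> (energy_norm \<alpha> s cyl U)\<^sup>2"
    and "s * trace_form U U \<le> (energy_norm \<alpha> s cyl U)\<^sup>2"
proof -
  obtain g m where e: "0 \<le> g" "0 \<le> m" "grad_energy \<alpha> cyl U = ennreal g" "mass_energy \<alpha> cyl U = ennreal m"
    "(H1rho_norm \<alpha> cyl U)\<^sup>2 = g + m" "m \<le> mass_const * (g + s * trace_form U U)"
    "min a 1 * g \<le> gradient_form U U" "gradient_form U U \<le> \<Lambda> * g"
    "0 \<le> trace_form U U" "s * (L2_norm_on UNIV (trace0 U))\<^sup>2 = s * trace_form U U"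
    by (rule energies_real[OF U])
  let ?T = "s * trace_form U U"
  have T: "0 \<le> ?T" using s e(9) by simp
  have norm: "(energy_norm \<alpha> s cyl U)\<^sup>2 = g + m + ?T"
    unfolding energy_norm_def e(5) e(10) using e(1,2) T by simp
  let ?\<mu> = "min (min a 1) (d_const \<beta>)"
  have \<mu>: "0 < ?\<mu>" using a_pos d_const_pos by auto
  have "?\<mu> * (g + ?T) \<le> min a 1 * g + d_const \<beta> * ?T"
    unfolding distrib_left using e(1) T by (intro add_mono mult_right_mono) auto
  also have "\<dots> \<le> form U U" unfolding form_eq using e(7) by (simp add: mult_ac)
  finally have 1: "?\<mu> * (g + ?T) \<le> form U U" .
  have "0 \<le> ?\<mu> * (g + ?T)" using \<mu> e(1) T by (intro mult_nonneg_nonneg) auto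
  then show "0 \<le> form U U" using 1 by linarith
  have "(energy_norm \<alpha> s cyl U)\<^sup>2 \<le> (mass_const + 1) * (g + ?T)"
    unfolding norm using e(6) by (simp add: distrib_right)
  also have "\<dots> = coercivity_const * (?\<mu> * (g + ?T))"
  proof -
    have cancel: "p * X = p / q * (q * X)" if "0 < q" for p q X :: real using that by simp
    show ?thesis unfolding coercivity_const_def by (rule cancel[OF \<mu>])
  qed
  also have "\<dots> \<le> coercivity_const * form U U"
    using 1 coercivity_const_pos by (intro mult_left_mono) auto
  finally show "(energy_norm \<alpha> s cyl U)\<^sup>2 \<le> coercivity_const * form U U" .
  show "(H1rho_norm \<alpha> cyl U)\<^sup>2 \<le> (energy_norm \<alpha> s cyl U)\<^sup>2" unfolding norm e(5) using T by simp
  show "?T \<le> (energy_norm \<alpha> s cyl U)\<^sup>2" unfolding norm using e(1,2) by simp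
qed

lemma coercive_form: "coercive \<beta> s \<AA> cyl"
  unfolding coercive_def
proof (intro exI[of _ "1 / coercivity_const"] conjI ballI)
  show "0 < 1 / coercivity_const" using coercivity_const_pos by simp
  fix U assume "U \<in> E"
  from coercive_bound(1)[OF this] show "1 / coercivity_const * (energy_norm \<alpha> s cyl U)\<^sup>2 \<le> form U U"
    using coercivity_const_pos by (simp add: pos_divide_le_eq mult.commute)
qed

text \<open>The constant of \<open>local_trace_bound\<close>, apart from the factor that depends on the height.\<close>

definition trace_const :: "real \<Rightarrow> real" where
  "trace_const R = sqrt (4 * (1 + \<alpha>) * (4 + 2 * R\<^sup>2 + 8 / (1 - \<alpha>)\<^sup>2))"

lemma trace_const_radicand_nonneg: "0 \<le> 4 * (1 + \<alpha>) * (4 + 2 * R\<^sup>2 + 8 / (1 - \<alpha>)\<^sup>2)"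
proof (rule mult_nonneg_nonneg)
  show "0 \<le> 4 * (1 + \<alpha>)" using \<beta> by simp
  show "0 \<le> 4 + 2 * R\<^sup>2 + 8 / (1 - \<alpha>)\<^sup>2"
    by (rule add_nonneg_nonneg[OF add_nonneg_nonneg]) simp_all
qed

lemma trace_const_nonneg: "0 \<le> trace_const R"
  unfolding trace_const_def by (rule real_sqrt_ge_zero[OF trace_const_radicand_nonneg])

lemma trace_on_ball:
  assumes U: "U \<in> H1rho \<alpha> cyl" and R: "R > 0"
  shows "(\<integral>\<^sup>+x\<in>ball 0 R. ennreal ((trace0 U x)\<^sup>2) \<partial>lborel) \<le> ennreal ((trace_const R * (1 + 1 / h))\<^sup>2) * total_energy \<alpha> U"
proof -
  note trace_const_radicand_nonneg[of R]
  then have "(trace_const R * (1 + 1 / h))\<^sup>2 = 4 * (1 + \<alpha>) * (1 + 1 / h)\<^sup>2 * (4 + 2 * R\<^sup>2 + 8 / (1 - \<alpha>)\<^sup>2)"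
    unfolding power_mult_distrib trace_const_def by (simp only: real_sqrt_pow2 mult_ac)
  then show ?thesis using local_trace_bound[OF U \<alpha> R] unfolding total_energy_def by (simp only:)
qed

text \<open>The traces have an \<open>L\<^sup>2\<close> limit \<open>g\<close>, and on every ball they converge to the trace of \<open>V\<close> by the local
  trace estimate. Hence \<open>g\<close> is the trace of \<open>V\<close>.\<close>

lemma trace_limit:
  fixes u :: "nat \<Rightarrow> (real ^ 'd) \<times> real \<Rightarrow> real"
  assumes u: "\<And>n. u n \<in> E" and s0: "s > 0" and V: "V \<in> H1rho \<alpha> cyl"
    and cauchy: "\<And>e. e > 0 \<Longrightarrow> \<exists>N. \<forall>m\<ge>N. \<forall>n\<ge>N. (\<integral>\<^sup>+x. ennreal ((norm (trace0 (u m) x - trace0 (u n) x))\<^sup>2) \<partial>lborel) \<le> ennreal e"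
    and lim: "\<forall>e>0. \<exists>N. \<forall>n\<ge>N. total_energy \<alpha> (diff (u n) V) \<le> ennreal e"
  shows "trace0 V \<in> L2"
    and "e > 0 \<Longrightarrow> \<exists>N. \<forall>n\<ge>N. (\<integral>\<^sup>+x. ennreal ((trace0 (diff (u n) V) x)\<^sup>2) \<partial>lborel) \<le> ennreal e"
proof -
  have [measurable]: "trace0 (u n) \<in> borel_measurable borel" for n
    by (rule trace0_measurable[OF E_H1rho[OF u]])
  have [measurable]: "trace0 V \<in> borel_measurable borel" by (rule trace0_measurable[OF V])
  have meas: "trace0 (u n) \<in> borel_measurable lborel" for n by measurable
  obtain g where g0: "g \<in> borel_measurable lborel" and g: "\<forall>e>0. \<exists>N. \<forall>n\<ge>N. (\<integral>\<^sup>+x. ennreal ((norm (trace0 (u n) x - g x))\<^sup>2) \<partial>lborel) \<le> ennreal e"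
    by (rule L2_complete[of "\<lambda>n. trace0 (u n)" lborel, OF meas cauchy])
  have [measurable]: "g \<in> borel_measurable borel" using g0 by simp
  have tr: "AE x in lborel. trace0 (diff (u n) V) x = trace0 (u n) x - trace0 V x" for n
    using trace0_linear[OF E_H1rho[OF u[of n]] V, of "-1"] by simp
  have eq_ball: "AE x in lborel. x \<in> ball 0 R \<longrightarrow> g x = trace0 V x" if R: "R > 0" for R
  proof -
    let ?C = "(trace_const R * (1 + 1 / h))\<^sup>2"
    have small: "(\<integral>\<^sup>+x\<in>ball 0 R. ennreal ((g x - trace0 V x)\<^sup>2) \<partial>lborel) \<le> 0 + ennreal e" if e: "e > 0" for e
    proof -
      have C1: "0 < ?C + 1" by (simp add: add_nonneg_pos)
      obtain N1 where N1: "\<forall>n\<ge>N1. (\<integral>\<^sup>+x. ennreal ((norm (trace0 (u n) x - g x))\<^sup>2) \<partial>lborel) \<le> ennreal (e / 4)"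
        using g e by (meson divide_pos_pos zero_less_numeral)
      obtain N2 where N2: "\<forall>n\<ge>N2. total_energy \<alpha> (diff (u n) V) \<le> ennreal (e / 4 / (?C + 1))"
        using lim e C1 by (meson divide_pos_pos zero_less_numeral)
      define n where "n = max N1 N2"
      have a1: "(\<integral>\<^sup>+x\<in>ball 0 R. ennreal ((trace0 (u n) x - g x)\<^sup>2) \<partial>lborel) \<le> ennreal (e / 4)"
      proof -
        have "(\<integral>\<^sup>+x\<in>ball 0 R. ennreal ((trace0 (u n) x - g x)\<^sup>2) \<partial>lborel) \<le> (\<integral>\<^sup>+x. ennreal ((norm (trace0 (u n) x - g x))\<^sup>2) \<partial>lborel)"
          by (intro nn_integral_mono) (simp add: indicator_def)
        also have "\<dots> \<le> ennreal (e / 4)" using N1 by (simp add: n_def)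
        finally show ?thesis .
      qed
      have a2: "(\<integral>\<^sup>+x\<in>ball 0 R. ennreal ((trace0 (u n) x - trace0 V x)\<^sup>2) \<partial>lborel) \<le> ennreal (e / 4)"
      proof -
        have "(\<integral>\<^sup>+x\<in>ball 0 R. ennreal ((trace0 (u n) x - trace0 V x)\<^sup>2) \<partial>lborel)
            = (\<integral>\<^sup>+x\<in>ball 0 R. ennreal ((trace0 (diff (u n) V) x)\<^sup>2) \<partial>lborel)"
        proof (rule nn_integral_cong_AE)
          show "AE x in lborel. ennreal ((trace0 (u n) x - trace0 V x)\<^sup>2) * indicator (ball 0 R) x
              = ennreal ((trace0 (diff (u n) V) x)\<^sup>2) * indicator (ball 0 R) x"
            using tr[of n] by eventually_elim simp
        qed
        also have "\<dots> \<le> ennreal ?C * total_energy \<alpha> (diff (u n) V)"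
          by (rule trace_on_ball[OF H1rho_linear(1)[OF E_H1rho[OF u] V] R])
        also have "\<dots> \<le> ennreal ?C * ennreal (e / 4 / (?C + 1))"
          using N2 by (intro mult_left_mono) (simp_all add: n_def)
        also have "\<dots> = ennreal (?C * (e / 4 / (?C + 1)))"
          by (rule ennreal_mult[symmetric]) (use e C1 in simp_all)
        also have "\<dots> \<le> ennreal (e / 4)"
        proof (rule ennreal_leI)
          have "c * (p / (c + 1)) \<le> p" if "0 \<le> c" "0 < p" for c p :: real
            using that by (simp add: pos_divide_le_eq mult.commute mult_left_mono)
          from this[of ?C "e / 4"] show "?C * (e / 4 / (?C + 1)) \<le> e / 4" using e by simp
        qed
        finally show ?thesis .
      qed
      have "(\<integral>\<^sup>+x\<in>ball 0 R. ennreal ((g x - trace0 V x)\<^sup>2) \<partial>lborel)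
          \<le> (\<integral>\<^sup>+x. 2 * (ennreal ((trace0 (u n) x - g x)\<^sup>2) * indicator (ball 0 R) x)
            + 2 * (ennreal ((trace0 (u n) x - trace0 V x)\<^sup>2) * indicator (ball 0 R) x) \<partial>lborel)"
      proof (rule nn_integral_mono)
        fix x
        have "(g x - trace0 V x)\<^sup>2 \<le> 2 * (trace0 (u n) x - g x)\<^sup>2 + 2 * (trace0 (u n) x - trace0 V x)\<^sup>2"
          using square_add_le[of "- (trace0 (u n) x - g x)" "trace0 (u n) x - trace0 V x"] by (simp add: power2_commute)
        from ennreal_leI[OF this] show "ennreal ((g x - trace0 V x)\<^sup>2) * indicator (ball 0 R) x
          \<le> 2 * (ennreal ((trace0 (u n) x - g x)\<^sup>2) * indicator (ball 0 R) x)
            + 2 * (ennreal ((trace0 (u n) x - trace0 V x)\<^sup>2) * indicator (ball 0 R) x)"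
          by (simp add: ennreal_plus ennreal_mult indicator_def)
      qed
      also have "\<dots> = 2 * (\<integral>\<^sup>+x\<in>ball 0 R. ennreal ((trace0 (u n) x - g x)\<^sup>2) \<partial>lborel)
          + 2 * (\<integral>\<^sup>+x\<in>ball 0 R. ennreal ((trace0 (u n) x - trace0 V x)\<^sup>2) \<partial>lborel)"
        by (rule nn_integral_linear) measurable
      also have "\<dots> \<le> 2 * ennreal (e / 4) + 2 * ennreal (e / 4)"
        by (intro add_mono mult_left_mono a1 a2) simp_all
      also have "\<dots> = ennreal e"
        using e ennreal_plus[of "e / 2" "e / 2"] ennreal_mult[of 2 "e / 4"] by simp
      finally show ?thesis by simp
    qed
    have "(\<integral>\<^sup>+x\<in>ball 0 R. ennreal ((g x - trace0 V x)\<^sup>2) \<partial>lborel) \<le> 0"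
      by (rule ennreal_le_epsilon[OF small])
    then have "(\<integral>\<^sup>+x\<in>ball 0 R. ennreal ((g x - trace0 V x)\<^sup>2) \<partial>lborel) = 0" by (simp only: le_zero_eq)
    then have "AE x in lborel. ennreal ((g x - trace0 V x)\<^sup>2) * indicator (ball 0 R) x = 0"
      by (subst (asm) nn_integral_0_iff_AE) measurable
    then show ?thesis by eventually_elim (auto simp: indicator_def split: if_splits)
  qed
  have "AE x in lborel. \<forall>n. x \<in> ball 0 (real (Suc n)) \<longrightarrow> g x = trace0 V x"
    by (subst AE_all_countable) (use eq_ball in simp)
  then have eq: "AE x in lborel. g x = trace0 V x"
  proof eventually_elim
    case (elim x)
    obtain n where "norm x < real n" using reals_Archimedean2 by blast
    then have "x \<in> ball 0 (real (Suc n))" by simp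
    then show ?case using elim by blast
  qed
  have same: "(\<integral>\<^sup>+x. ennreal ((trace0 (diff (u n) V) x)\<^sup>2) \<partial>lborel) = (\<integral>\<^sup>+x. ennreal ((norm (trace0 (u n) x - g x))\<^sup>2) \<partial>lborel)" for n
  proof (rule nn_integral_cong_AE)
    show "AE x in lborel. ennreal ((trace0 (diff (u n) V) x)\<^sup>2) = ennreal ((norm (trace0 (u n) x - g x))\<^sup>2)"
      using tr[of n] eq by eventually_elim simp
  qed
  show "\<exists>N. \<forall>n\<ge>N. (\<integral>\<^sup>+x. ennreal ((trace0 (diff (u n) V) x)\<^sup>2) \<partial>lborel) \<le> ennreal e" if "e > 0"
    unfolding same using g that by blast
  have "(\<integral>\<^sup>+x. ennreal ((trace0 V x)\<^sup>2) \<partial>lborel) < \<infinity>"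
  proof -
    obtain N where N: "\<forall>n\<ge>N. (\<integral>\<^sup>+x. ennreal ((norm (trace0 (u n) x - g x))\<^sup>2) \<partial>lborel) \<le> ennreal 1"
      using g[rule_format, OF zero_less_one] by (rule exE)
    have "(\<integral>\<^sup>+x. ennreal ((norm (g x - trace0 (u N) x))\<^sup>2) \<partial>lborel) \<le> ennreal 1"
      by (subst norm_minus_commute) (rule N[rule_format, OF order_refl])
    then have 1: "(\<integral>\<^sup>+x. ennreal ((norm (g x - trace0 (u N) x))\<^sup>2) \<partial>lborel) < \<infinity>"
      by (rule le_less_trans) simp
    have 2: "(\<integral>\<^sup>+x. ennreal ((norm (trace0 (u N) x))\<^sup>2) \<partial>lborel) < \<infinity>"
      using E_trace[OF u[of N] s0] by (simp add: L2_iff)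
    have "(\<integral>\<^sup>+x. ennreal ((trace0 V x)\<^sup>2) \<partial>lborel) = (\<integral>\<^sup>+x. ennreal ((norm (trace0 (u N) x + (g x - trace0 (u N) x)))\<^sup>2) \<partial>lborel)"
    proof (rule nn_integral_cong_AE)
      show "AE x in lborel. ennreal ((trace0 V x)\<^sup>2) = ennreal ((norm (trace0 (u N) x + (g x - trace0 (u N) x)))\<^sup>2)"
        using eq by eventually_elim simp
    qed
    also have "\<dots> \<le> 2 * (\<integral>\<^sup>+x. ennreal ((norm (trace0 (u N) x))\<^sup>2) \<partial>lborel) + 2 * (\<integral>\<^sup>+x. ennreal ((norm (g x - trace0 (u N) x))\<^sup>2) \<partial>lborel)"
      by (rule nn_integral_norm_add_squared_le) measurable
    also have "\<dots> < \<infinity>" using 1 2 by (simp add: ennreal_mult_less_top)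
    finally show ?thesis .
  qed
  then show "trace0 V \<in> L2" by (simp add: L2_iff)
qed

lemma E_complete:
  assumes u: "\<And>n. u n \<in> E"
    and cauchy: "\<And>e. e > 0 \<Longrightarrow> \<exists>N. \<forall>m\<ge>N. \<forall>n\<ge>N. form (diff (u m) (u n)) (diff (u m) (u n)) < e"
  shows "\<exists>V\<in>E. (\<lambda>n. form (diff (u n) V) (diff (u n) V)) \<longlonglongrightarrow> 0"
proof -
  have D: "diff (u m) (u n) \<in> E" for m n by (rule E_linear[OF u u])
  have K: "coercivity_const > 0" by (rule coercivity_const_pos)
  have te: "total_energy \<alpha> W \<le> ennreal (coercivity_const * form W W)" if W: "W \<in> E" for W
  proof -
    have "total_energy \<alpha> W = ennreal ((H1rho_norm \<alpha> cyl W)\<^sup>2)"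
      unfolding total_energy_def by (rule H1rho_norm_squared[OF E_H1rho[OF W], symmetric])
    also have "\<dots> \<le> ennreal (coercivity_const * form W W)"
      by (rule ennreal_leI[OF order_trans[OF coercive_bound(3)[OF W] coercive_bound(1)[OF W]]])
    finally show ?thesis .
  qed
  have "\<exists>N. \<forall>m\<ge>N. \<forall>n\<ge>N. total_energy \<alpha> (diff (u m) (u n)) \<le> ennreal e" if e: "e > 0" for e
  proof -
    obtain N where N: "\<forall>m\<ge>N. \<forall>n\<ge>N. form (diff (u m) (u n)) (diff (u m) (u n)) < e / coercivity_const"
      using cauchy[OF divide_pos_pos[OF e K]] by blast
    have "total_energy \<alpha> (diff (u m) (u n)) \<le> ennreal e" if "m \<ge> N" "n \<ge> N" for m n
    proof (rule order_trans[OF te[OF D] ennreal_leI])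
      have "form (diff (u m) (u n)) (diff (u m) (u n)) < e / coercivity_const" using N that by blast
      then show "coercivity_const * form (diff (u m) (u n)) (diff (u m) (u n)) \<le> e"
        unfolding pos_less_divide_eq[OF K] by (simp only: mult.commute less_imp_le)
    qed
    then show ?thesis by blast
  qed
  then obtain V where V: "V \<in> H1rho \<alpha> cyl"
    and lim: "\<forall>e>0. \<exists>N. \<forall>n\<ge>N. total_energy \<alpha> (diff (u n) V) \<le> ennreal e"
    by (rule H1rho_complete[OF E_H1rho[OF u]])
  have traces: "(s > 0 \<longrightarrow> trace0 V \<in> L2) \<and> (s > 0 \<longrightarrow> (\<forall>e>0. \<exists>N. \<forall>n\<ge>N.
      (\<integral>\<^sup>+x. ennreal ((trace0 (diff (u n) V) x)\<^sup>2) \<partial>lborel) \<le> ennreal e))"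
  proof (cases "s > 0")
    case True
    have "\<exists>N. \<forall>m\<ge>N. \<forall>n\<ge>N. (\<integral>\<^sup>+x. ennreal ((norm (trace0 (u m) x - trace0 (u n) x))\<^sup>2) \<partial>lborel) \<le> ennreal e" if e: "e > 0" for e
    proof -
      obtain N where N: "\<forall>m\<ge>N. \<forall>n\<ge>N. form (diff (u m) (u n)) (diff (u m) (u n)) < e * s / coercivity_const"
        using cauchy[OF divide_pos_pos[OF mult_pos_pos[OF e True] K]] by blast
      have "(\<integral>\<^sup>+x. ennreal ((norm (trace0 (u m) x - trace0 (u n) x))\<^sup>2) \<partial>lborel) \<le> ennreal e" if "m \<ge> N" "n \<ge> N" for m n
      proof -
        let ?W = "diff (u m) (u n)"
        have "(\<integral>\<^sup>+x. ennreal ((norm (trace0 (u m) x - trace0 (u n) x))\<^sup>2) \<partial>lborel) = (\<integral>\<^sup>+x. ennreal ((trace0 ?W x)\<^sup>2) \<partial>lborel)"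
        proof (rule nn_integral_cong_AE)
          show "AE x in lborel. ennreal ((norm (trace0 (u m) x - trace0 (u n) x))\<^sup>2) = ennreal ((trace0 ?W x)\<^sup>2)"
            using trace0_linear[OF E_H1rho[OF u[of m]] E_H1rho[OF u[of n]], of "-1"] by eventually_elim simp
        qed
        also have "\<dots> = ennreal ((L2_norm_on UNIV (trace0 ?W))\<^sup>2)"
          by (rule L2_norm_squared[OF E_trace[OF D True], symmetric])
        also have "\<dots> \<le> ennreal e"
        proof (rule ennreal_leI)
          have "form ?W ?W < e * s / coercivity_const" using N that by blast
          then have 1: "coercivity_const * form ?W ?W < e * s"
            unfolding pos_less_divide_eq[OF K] by (simp only: mult.commute)
          have "s * (L2_norm_on UNIV (trace0 ?W))\<^sup>2 = s * trace_form ?W ?W"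
            by (rule energies_real[OF D[of m n]])
          also have "\<dots> < e * s"
            by (rule le_less_trans[OF order_trans[OF coercive_bound(4)[OF D] coercive_bound(1)[OF D]] 1])
          finally show "(L2_norm_on UNIV (trace0 ?W))\<^sup>2 \<le> e" using True by (simp add: mult.commute)
        qed
        finally show ?thesis .
      qed
      then show ?thesis by blast
    qed
    from trace_limit[OF u True V this lim] show ?thesis by blast
  qed simp
  then have VE: "V \<in> E" using V by (simp add: energy_space_def)
  have DV: "diff (u n) V \<in> E" for n by (rule E_linear[OF u VE])
  have "(\<lambda>n. form (diff (u n) V) (diff (u n) V)) \<longlonglongrightarrow> 0"
  proof (rule LIMSEQ_I)
    fix r :: real assume r: "r > 0"
    define c where "c = \<Lambda> + s * d_const \<beta>"
    have c: "c > 0" using \<Lambda> s d_const_pos by (auto simp: c_def intro!: add_pos_nonneg)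
    define e where "e = r / (2 * c)"
    have e: "e > 0" using r c by (simp add: e_def)
    obtain N1 where N1: "\<forall>n\<ge>N1. total_energy \<alpha> (diff (u n) V) \<le> ennreal e" using lim e by blast
    obtain N2 where N2: "\<forall>n\<ge>N2. s > 0 \<longrightarrow> (\<integral>\<^sup>+x. ennreal ((trace0 (diff (u n) V) x)\<^sup>2) \<partial>lborel) \<le> ennreal e"
      using traces e by blast
    have "norm (form (diff (u n) V) (diff (u n) V) - 0) < r" if n: "n \<ge> max N1 N2" for n
    proof -
      define W where "W = diff (u n) V"
      have W: "W \<in> E" unfolding W_def by (rule DV)
      obtain g m where en: "0 \<le> g" "0 \<le> m" "grad_energy \<alpha> cyl W = ennreal g" "mass_energy \<alpha> cyl W = ennreal m"
        "(H1rho_norm \<alpha> cyl W)\<^sup>2 = g + m" "m \<le> mass_const * (g + s * trace_form W W)"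
        "min a 1 * g \<le> gradient_form W W" "gradient_form W W \<le> \<Lambda> * g"
        "0 \<le> trace_form W W" "s * (L2_norm_on UNIV (trace0 W))\<^sup>2 = s * trace_form W W"
        "total_energy \<alpha> W = ennreal (g + m)"
        by (rule energies_real[OF W])
      have "ennreal (g + m) \<le> ennreal e" using N1 n unfolding W_def[symmetric] en(11)[symmetric] by (simp add: W_def)
      then have "g \<le> e" using en(2) e by (subst (asm) ennreal_le_iff) auto
      then have "\<Lambda> * g \<le> \<Lambda> * e" using \<Lambda> by (intro mult_left_mono) auto
      moreover have "s * trace_form W W \<le> s * e"
      proof (cases "s > 0")
        case True
        have "ennreal ((L2_norm_on UNIV (trace0 W))\<^sup>2) \<le> ennreal e"
          unfolding L2_norm_squared[OF E_trace[OF W True]] using N2 n True by (simp add: W_def)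
        then have "(L2_norm_on UNIV (trace0 W))\<^sup>2 \<le> e" using e by (subst (asm) ennreal_le_iff) auto
        from mult_left_mono[OF this s] show ?thesis unfolding en(10) .
      qed (use s in simp)
      then have "d_const \<beta> * (s * trace_form W W) \<le> d_const \<beta> * (s * e)"
        by (rule mult_left_mono[OF _ less_imp_le[OF d_const_pos]])
      moreover have "s * d_const \<beta> * trace_form W W = d_const \<beta> * (s * trace_form W W)" by simp
      ultimately have "form W W \<le> \<Lambda> * e + d_const \<beta> * (s * e)"
        using en(8) form_eq[of W W] by linarith
      also have "\<dots> = c * e" by (simp add: c_def algebra_simps)
      also have "\<dots> < r" using r c by (simp add: e_def)
      finally show ?thesis using coercive_bound(2)[OF W] by (simp add: W_def)
    qed
    then show "\<exists>N. \<forall>n\<ge>N. norm (form (diff (u n) V) (diff (u n) V) - 0) < r" by blast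
  qed
  then show ?thesis using VE by blast
qed

lemma zero_in_E: "(\<lambda>z. 0) \<in> E"
proof -
  let ?Z = "(\<lambda>z. 0) :: (real ^ 'd) \<times> real \<Rightarrow> real"
  have wg: "has_weak_gradient cyl ?Z (\<lambda>z. 0)"
    by (simp add: has_weak_gradient_def locally_integrable_def set_integrable_def)
  have "total_energy \<alpha> ?Z = 0"
    unfolding total_energy_eq[OF wg] by (simp add: energy_vector_def)
  then have H: "?Z \<in> H1rho \<alpha> cyl"
    by (simp add: H1rho_iff_total_energy has_weak_gradient_weak_grad[OF wg])
  have t0: "is_trace0 ?Z (\<lambda>x. 0)"
    unfolding is_trace0_def by (auto intro!: exI[of _ 1])
  have "AE x in lborel. trace0 ?Z x = 0"
    by (rule is_trace0_unique[OF wg trace0_Hardy(1)[OF H \<alpha>] t0])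
  then have "(\<integral>\<^sup>+x. ennreal ((trace0 ?Z x)\<^sup>2) \<partial>lborel) = nn_integral (lborel :: (real ^ 'd) measure) (\<lambda>x. 0)"
    by (intro nn_integral_cong_AE) (auto elim: eventually_mono)
  then have "trace0 ?Z \<in> L2" using trace0_measurable[OF H] by (simp add: L2_iff)
  then show ?thesis using H by (simp add: energy_space_def)
qed

text \<open>The load is supported in a ball, where the trace is controlled by the energy.\<close>

lemma load_bound:
  fixes f :: "real ^ 'd \<Rightarrow> real"
  assumes f: "f \<in> L2" and f0: "AE x in lborel. x \<notin> \<Omega> \<longrightarrow> f x = 0"
    and \<Omega>: "\<Omega> \<in> sets borel" "\<Omega> \<subseteq> ball 0 R" and R: "R > 0" and V: "V \<in> H1rho \<alpha> cyl"
  shows "integrable lborel (\<lambda>x. f x * trace0 V x)"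
    and "\<bar>LINT x|lborel. f x * trace0 V x\<bar>
      \<le> L2_norm_on \<Omega> f * (trace_const R * (1 + 1 / h)) * \<bar>H1rho_norm \<alpha> cyl V\<bar>"
proof -
  let ?N = "L2_norm_on \<Omega> f" and ?T = "trace_const R * (1 + 1 / h)" and ?H = "H1rho_norm \<alpha> cyl V"
  note [measurable] = \<Omega>(1)
  have [measurable]: "f \<in> borel_measurable borel" using f by (simp add: L2_iff)
  have [measurable]: "trace0 V \<in> borel_measurable borel" by (rule trace0_measurable[OF V])
  have "?N = L2_norm_on UNIV f"
    unfolding L2_norm_on_def set_lebesgue_integral_def
  proof (rule arg_cong[where f = sqrt], rule integral_cong_AE)
    show "AE x in lborel. indicat_real \<Omega> x *\<^sub>R (f x)\<^sup>2 = indicat_real UNIV x *\<^sub>R (f x)\<^sup>2"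
      using f0 by eventually_elim (auto simp: indicator_def)
  qed measurable
  then have N2: "(\<integral>\<^sup>+x. ennreal ((f x)\<^sup>2) \<partial>lborel) = ennreal (?N\<^sup>2)"
    using L2_norm_squared[OF f] by simp
  have N0: "0 \<le> ?N"
    unfolding L2_norm_on_def set_lebesgue_integral_def
    by (intro real_sqrt_ge_zero Bochner_Integration.integral_nonneg) simp
  have T0: "0 \<le> ?T" using trace_const_nonneg h_pos by (intro mult_nonneg_nonneg) auto
  have I: "(\<integral>\<^sup>+x. ennreal (norm (f x * trace0 V x)) \<partial>lborel) \<le> ennreal (?N * ?T * \<bar>?H\<bar>)"
  proof -
    have "(\<integral>\<^sup>+x. ennreal (norm (f x * trace0 V x)) \<partial>lborel)
        = (\<integral>\<^sup>+x. ennreal \<bar>f x\<bar> * (ennreal \<bar>trace0 V x\<bar> * indicator (ball 0 R) x) \<partial>lborel)"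
    proof (rule nn_integral_cong_AE)
      show "AE x in lborel. ennreal (norm (f x * trace0 V x)) = ennreal \<bar>f x\<bar> * (ennreal \<bar>trace0 V x\<bar> * indicator (ball 0 R) x)"
        using f0
      proof eventually_elim
        case (elim x)
        then show ?case using \<Omega>(2) by (cases "x \<in> \<Omega>") (auto simp: abs_mult ennreal_mult)
      qed
    qed
    then have "(\<integral>\<^sup>+x. ennreal (norm (f x * trace0 V x)) \<partial>lborel)\<^sup>2
        = (\<integral>\<^sup>+x. ennreal \<bar>f x\<bar> * (ennreal \<bar>trace0 V x\<bar> * indicator (ball 0 R) x) \<partial>lborel)\<^sup>2" by (rule arg_cong)
    also have "\<dots> \<le> (\<integral>\<^sup>+x. (ennreal \<bar>f x\<bar>)\<^sup>2 \<partial>lborel) * (\<integral>\<^sup>+x. (ennreal \<bar>trace0 V x\<bar> * indicator (ball 0 R) x)\<^sup>2 \<partial>lborel)"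
      by (rule Cauchy_Schwarz_nn_integral) measurable
    also have "(\<lambda>x. (ennreal \<bar>f x\<bar>)\<^sup>2) = (\<lambda>x. ennreal ((f x)\<^sup>2))"
      by (simp add: ennreal_power)
    also have "(\<lambda>x. (ennreal \<bar>trace0 V x\<bar> * indicator (ball 0 R) x)\<^sup>2) = (\<lambda>x. ennreal ((trace0 V x)\<^sup>2) * indicator (ball 0 R) x)"
      by (rule ext) (simp add: power_mult_distrib ennreal_power indicator_def)
    also have "(\<integral>\<^sup>+x. ennreal ((f x)\<^sup>2) \<partial>lborel) * (\<integral>\<^sup>+x. ennreal ((trace0 V x)\<^sup>2) * indicator (ball 0 R) x \<partial>lborel)
        \<le> ennreal (?N\<^sup>2) * (ennreal (?T\<^sup>2) * ennreal (?H\<^sup>2))"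
      unfolding N2 H1rho_norm_squared[OF V] total_energy_def[symmetric]
      by (rule mult_left_mono[OF trace_on_ball[OF V R]]) simp
    also have "\<dots> = ennreal ((?N * ?T * ?H)\<^sup>2)"
      by (simp add: ennreal_mult[symmetric] power_mult_distrib mult_ac)
    finally have "(\<integral>\<^sup>+x. ennreal (norm (f x * trace0 V x)) \<partial>lborel) \<le> ennreal (sqrt ((?N * ?T * ?H)\<^sup>2))"
      by (rule ennreal_square_le_imp_le_sqrt) simp
    then show ?thesis using N0 T0 unfolding real_sqrt_abs abs_mult[of "?N * ?T"] by simp
  qed
  show i: "integrable lborel (\<lambda>x. f x * trace0 V x)"
  proof (rule integrableI_bounded)
    show "(\<integral>\<^sup>+x. ennreal (norm (f x * trace0 V x)) \<partial>lborel) < \<infinity>"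
      by (rule le_less_trans[OF I]) simp
  qed measurable
  have "ennreal (norm (LINT x|lborel. f x * trace0 V x)) \<le> ennreal (?N * ?T * \<bar>?H\<bar>)"
    by (rule order_trans[OF norm_integral_le_nn_integral I])
  then have "norm (LINT x|lborel. f x * trace0 V x) \<le> ?N * ?T * \<bar>?H\<bar>"
    using N0 T0 by (subst (asm) ennreal_le_iff) (auto intro!: mult_nonneg_nonneg)
  then show "\<bar>LINT x|lborel. f x * trace0 V x\<bar> \<le> ?N * ?T * \<bar>?H\<bar>" by simp
qed

lemma energy_norm_nonneg: "U \<in> E \<Longrightarrow> 0 \<le> energy_norm \<alpha> s cyl U"
  unfolding energy_norm_def using s by (intro real_sqrt_ge_zero add_nonneg_nonneg mult_nonneg_nonneg) auto

lemma H1rho_norm_le_energy_norm: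
  assumes U: "U \<in> E"
  shows "\<bar>H1rho_norm \<alpha> cyl U\<bar> \<le> energy_norm \<alpha> s cyl U"
  using coercive_bound(3)[OF U] energy_norm_nonneg[OF U]
    abs_le_square_iff[of "H1rho_norm \<alpha> cyl U" "energy_norm \<alpha> s cyl U"] by simp

text \<open>By coercivity the weighted mass of \<open>W - U\<close> vanishes, and its weight is positive.\<close>

lemma form_zero_imp_AE_eq:
  assumes W: "W \<in> E" and U: "U \<in> E" and 0: "form (diff W U) (diff W U) = 0"
  shows "AE z in lborel. z \<in> cyl \<longrightarrow> W z = U z"
proof -
  have D: "diff W U \<in> E" by (rule E_linear[OF W U])
  obtain g m where e: "0 \<le> g" "0 \<le> m" "grad_energy \<alpha> cyl (diff W U) = ennreal g" "mass_energy \<alpha> cyl (diff W U) = ennreal m"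
    "(H1rho_norm \<alpha> cyl (diff W U))\<^sup>2 = g + m"
    by (rule energies_real[OF D])
  have "g + m \<le> coercivity_const * form (diff W U) (diff W U)"
    using order_trans[OF coercive_bound(3)[OF D] coercive_bound(1)[OF D]] unfolding e(5) .
  then have "m = 0" using e(1,2) unfolding 0 by simp
  then have M: "(\<integral>\<^sup>+z. ennreal (snd z powr \<alpha>) * ennreal ((diff W U z)\<^sup>2 / (rho z)\<^sup>2) * indicator cyl z \<partial>lborel) = 0"
    using e(4) unfolding mass_energy_def by simp
  have [measurable]: "(\<lambda>z. diff W U z * indicator cyl z) \<in> borel_measurable borel"
    using measurable_H1rho(1)[OF H1rho_weak_gradient[OF E_H1rho[OF D]]] by (simp add: mult.commute)
  have "(\<lambda>z. ennreal (snd z powr \<alpha>) * ennreal ((diff W U z)\<^sup>2 / (rho z)\<^sup>2) * indicator cyl z)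
      = (\<lambda>z. ennreal (snd z powr \<alpha>) * ennreal ((diff W U z * indicator cyl z)\<^sup>2 / (rho z)\<^sup>2))"
    by (rule ext) (simp add: indicator_def)
  then have "(\<integral>\<^sup>+z. ennreal (snd z powr \<alpha>) * ennreal ((diff W U z * indicator cyl z)\<^sup>2 / (rho z)\<^sup>2) \<partial>lborel) = 0"
    using M by (simp only:)
  then have "AE z in lborel. ennreal (snd z powr \<alpha>) * ennreal ((diff W U z * indicator cyl z)\<^sup>2 / (rho z)\<^sup>2) = 0"
    by (subst (asm) nn_integral_0_iff_AE) measurable
  then show ?thesis
  proof eventually_elim
    case (elim z)
    have "W z = U z" if z: "z \<in> cyl"
    proof -
      have "snd z > 0" using z I_pos by auto
      then have "ennreal (snd z powr \<alpha>) \<noteq> 0" by simp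
      then have "ennreal ((diff W U z * indicator cyl z)\<^sup>2 / (rho z)\<^sup>2) = 0" using elim by simp
      then have "(diff W U z)\<^sup>2 / (rho z)\<^sup>2 \<le> 0" using z by (simp only: indicator_simps mult_1_right ennreal_eq_0_iff)
      then show ?thesis using rho_ge_1[of z] by (simp add: divide_le_0_iff)
    qed
    then show ?case by blast
  qed
qed

text \<open>Testing the equation with the solution itself bounds the square of its energy norm by the norm of
  the load times the energy norm.\<close>

lemma unique_solution_bound:
  fixes f :: "real ^ 'd \<Rightarrow> real"
  assumes f: "f \<in> L2" and f0: "AE x in lborel. x \<notin> \<Omega> \<longrightarrow> f x = 0"
    and \<Omega>: "\<Omega> \<in> sets borel" "\<Omega> \<subseteq> ball 0 R" and R: "R > 0"
  shows "\<exists>U. unique_solution \<beta> s \<AA> cyl f U \<and>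
    energy_norm \<alpha> s cyl U \<le> coercivity_const * d_const \<beta> * trace_const R * (1 + 1 / h) * L2_norm_on \<Omega> f"
proof -
  define l where "l V = d_const \<beta> * (LINT x|lborel. f x * trace0 V x)" for V
  define K where "K = d_const \<beta> * (L2_norm_on \<Omega> f * (trace_const R * (1 + 1 / h)))"
  note load = load_bound[OF f f0 \<Omega> R]
  have N0: "0 \<le> L2_norm_on \<Omega> f"
    unfolding L2_norm_on_def set_lebesgue_integral_def
    by (intro real_sqrt_ge_zero Bochner_Integration.integral_nonneg) simp
  have K0: "0 \<le> K"
    unfolding K_def using N0 trace_const_nonneg[of R] h_pos d_const_pos by (intro mult_nonneg_nonneg) auto
  have l_le: "\<bar>l V\<bar> \<le> K * energy_norm \<alpha> s cyl V" if V: "V \<in> E" for V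
  proof -
    have "\<bar>l V\<bar> = d_const \<beta> * \<bar>LINT x|lborel. f x * trace0 V x\<bar>"
      unfolding l_def abs_mult using d_const_pos by simp
    also have "\<dots> \<le> d_const \<beta> * (L2_norm_on \<Omega> f * (trace_const R * (1 + 1 / h)) * \<bar>H1rho_norm \<alpha> cyl V\<bar>)"
      by (rule mult_left_mono[OF load(2)[OF E_H1rho[OF V]] less_imp_le[OF d_const_pos]])
    also have "\<dots> = K * \<bar>H1rho_norm \<alpha> cyl V\<bar>" by (simp add: K_def)
    also have "\<dots> \<le> K * energy_norm \<alpha> s cyl V"
      by (rule mult_left_mono[OF H1rho_norm_le_energy_norm[OF V] K0])
    finally show ?thesis .
  qed
  have "\<exists>U\<in>E. \<forall>V\<in>E. form U V = l V"
  proof (rule riesz_minimization)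
    show "E \<noteq> {}" using zero_in_E by blast
    show "(\<lambda>z. u z + t * v z) \<in> E" if "u \<in> E" "v \<in> E" for u v t by (rule E_linear[OF that])
    show "form u v = form v u" for u v by (rule form_sym)
    show "form (\<lambda>z. u z + t * v z) w = form u w + t * form v w" if "u \<in> E" "v \<in> E" "w \<in> E" for u v w t
      by (rule form_linear[OF that])
    show "0 \<le> form u u" if "u \<in> E" for u by (rule coercive_bound(2)[OF that])
    show "l (\<lambda>z. u z + t * v z) = l u + t * l v" if u: "u \<in> E" and v: "v \<in> E" for u v t
    proof -
      note i = load(1)[OF E_H1rho[OF u]] load(1)[OF E_H1rho[OF v]]
      have "(LINT x|lborel. f x * trace0 (\<lambda>z. u z + t * v z) x)
          = (LINT x|lborel. f x * trace0 u x + t * (f x * trace0 v x))"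
      proof (rule integral_cong_AE)
        show "AE x in lborel. f x * trace0 (\<lambda>z. u z + t * v z) x = f x * trace0 u x + t * (f x * trace0 v x)"
          using trace0_linear[OF E_H1rho[OF u] E_H1rho[OF v], of t] by eventually_elim (simp add: algebra_simps)
        show "(\<lambda>x. f x * trace0 (\<lambda>z. u z + t * v z) x) \<in> borel_measurable lborel"
          by (rule borel_measurable_integrable[OF load(1)[OF E_H1rho[OF E_linear[OF u v]]]])
        show "(\<lambda>x. f x * trace0 u x + t * (f x * trace0 v x)) \<in> borel_measurable lborel"
          using i by (auto intro!: borel_measurable_integrable)
      qed
      also have "\<dots> = (LINT x|lborel. f x * trace0 u x) + t * (LINT x|lborel. f x * trace0 v x)"
        using i by simp
      finally show ?thesis by (simp add: l_def distrib_left)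
    qed
    show "\<bar>l u\<bar> \<le> K * sqrt coercivity_const * sqrt (form u u)" if u: "u \<in> E" for u
    proof -
      have "energy_norm \<alpha> s cyl u \<le> sqrt (coercivity_const * form u u)"
        by (rule real_le_rsqrt[OF coercive_bound(1)[OF u]])
      from order_trans[OF l_le[OF u] mult_left_mono[OF this K0]]
      show ?thesis by (simp add: real_sqrt_mult)
    qed
  qed (rule E_complete)
  then obtain U where U: "U \<in> E" and eq: "\<forall>V\<in>E. form U V = l V" by blast
  have "AE z in lborel. z \<in> cyl \<longrightarrow> W z = U z" if W: "W \<in> E" "\<forall>V\<in>E. form W V = l V" for W
  proof (rule form_zero_imp_AE_eq[OF W(1) U])
    have D: "diff W U \<in> E" by (rule E_linear[OF W(1) U])
    show "form (diff W U) (diff W U) = 0"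
      using form_linear[OF W(1) U D, of "-1"] W(2)[rule_format, OF D] eq[rule_format, OF D] by simp
  qed
  then have "unique_solution \<beta> s \<AA> cyl f U"
    unfolding unique_solution_def is_solution_def using U eq unfolding l_def by blast
  moreover have "energy_norm \<alpha> s cyl U \<le> coercivity_const * d_const \<beta> * trace_const R * (1 + 1 / h) * L2_norm_on \<Omega> f"
  proof -
    let ?e = "energy_norm \<alpha> s cyl U"
    have "?e\<^sup>2 \<le> coercivity_const * form U U" by (rule coercive_bound(1)[OF U])
    also have "form U U = l U" using eq U by blast
    also have "coercivity_const * l U \<le> coercivity_const * (K * ?e)"
      using l_le[OF U] coercivity_const_pos by (intro mult_left_mono) auto
    finally have "?e * ?e \<le> coercivity_const * K * ?e" by (simp add: power2_eq_square)
    then have "?e \<le> coercivity_const * K"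
      using energy_norm_nonneg[OF U] K0 coercivity_const_pos
      by (cases "?e = 0") (auto simp: mult_le_cancel_right)
    also have "\<dots> = coercivity_const * d_const \<beta> * trace_const R * (1 + 1 / h) * L2_norm_on \<Omega> f"
      by (simp add: K_def)
    finally show ?thesis .
  qed
  ultimately show ?thesis by blast
qed

end

text \<open>Off the essential support every point has a neighbourhood on which \<open>f\<close> vanishes almost everywhere,
  and by the Lindelof property countably many of these neighbourhoods suffice.\<close>

lemma AE_zero_outside_ess_support:
  fixes f :: "'a::euclidean_space \<Rightarrow> real"
  shows "AE x in lborel. x \<notin> ess_support f \<longrightarrow> f x = 0"
proof -
  define F where "F = {S. open S \<and> (AE z in lborel. z \<in> S \<longrightarrow> f z = 0)}"
  obtain F' where F': "F' \<subseteq> F" "countable F'" "\<Union>F' = \<Union>F"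
    by (rule Lindelof[of F]) (auto simp: F_def)
  have "AE z in lborel. \<forall>S\<in>F'. z \<in> S \<longrightarrow> f z = 0"
    by (subst AE_ball_countable[OF F'(2)]) (use F'(1) in \<open>auto simp: F_def\<close>)
  then show ?thesis
  proof eventually_elim
    case (elim x)
    have "f x = 0" if "x \<notin> ess_support f"
    proof -
      obtain r where r: "r > 0" "AE z in lborel. z \<in> ball x r \<longrightarrow> f z = 0"
        using \<open>x \<notin> ess_support f\<close> unfolding ess_support_def by blast
      have "ball x r \<in> F" using r(2) by (simp add: F_def)
      then have "x \<in> \<Union>F'" unfolding F'(3) using centre_in_ball[of x r] r(1) by blast
      then show ?thesis using elim by blast
    qed
    then show ?case by blast
  qed
qed

theorem proposition2p3:
  fixes \<AA> :: "real ^ 'd \<Rightarrow> real ^ 'd ^ 'd"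
    and \<Omega> :: "(real ^ 'd) set"
    and \<beta> \<alpha> s \<sigma>\<^sub>0 \<AA>\<^sub>0 :: real
  assumes d: "CARD('d) \<in> {2, 3}"
    and \<beta>: "0 < \<beta>" "\<beta> < 1"
    and \<alpha>: "\<alpha> = 1 - 2 * \<beta>"
    and s: "s \<ge> 0"
    and \<sigma>: "CARD('d) = 2 \<longrightarrow> \<sigma>\<^sub>0 > 0 \<and> s \<ge> \<sigma>\<^sub>0"
    and \<Omega>: "bounded_lipschitz_domain \<Omega>"
    and \<AA>_smooth: "smooth \<AA>"
    and \<AA>_sym: "\<forall>x. transpose (\<AA> x) = \<AA> x"
    and \<AA>_pos: "\<AA>\<^sub>0 > 0" "\<forall>x \<eta>. (\<AA> x *v \<eta>) \<bullet> \<eta> \<ge> \<AA>\<^sub>0 * (norm \<eta>)\<^sup>2"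
    and \<AA>_id: "\<forall>x. x \<notin> closure \<Omega> \<longrightarrow> \<AA> x = mat 1"
    and d_or_s: "CARD('d) > 2 \<or> s > 0"
  shows
    "(\<exists>C>0. \<forall>f\<in>L2. ess_support f \<subseteq> \<Omega> \<longrightarrow>
        (\<exists>U. unique_solution \<beta> s \<AA> half_space f U \<and>
             energy_norm \<alpha> s half_space U \<le> C * min1_inv s * L2_norm_on \<Omega> f))
     \<and>
     (\<exists>C>0. \<forall>Y>0. \<forall>f\<in>L2. ess_support f \<subseteq> \<Omega> \<longrightarrow>
        (\<exists>U. unique_solution \<beta> s \<AA> (slab Y) f U \<and>
             energy_norm \<alpha> s (slab Y) U \<le> C * (1 + 1 / Y) * min1_inv s * L2_norm_on \<Omega> f))
     \<and>
     coercive \<beta> s \<AA> half_space \<and> (\<forall>Y>0. coercive \<beta> s \<AA> (slab Y))"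
proof -
  have \<Omega>': "open \<Omega>" "bounded \<Omega>" using \<Omega> by (auto simp: bounded_lipschitz_domain_def)
  have \<Omega>_borel: "\<Omega> \<in> sets borel" using \<Omega>'(1) by simp
  obtain R where R: "R > 0" and "\<forall>x\<in>\<Omega>. norm x < R" using \<Omega>'(2) bounded_pos_less by blast
  then have \<Omega>_ball: "\<Omega> \<subseteq> ball 0 R" by auto
  have cont: "continuous_on UNIV \<AA>"
    using \<AA>_smooth unfolding smooth_def by (metis Ck.simps(1))
  have "bounded (\<AA> ` closure \<Omega>)"
    using \<Omega>'(2) by (intro compact_imp_bounded compact_continuous_image continuous_on_subset[OF cont]) auto
  then obtain b where b: "\<forall>M\<in>\<AA> ` closure \<Omega>. norm M \<le> b" unfolding bounded_iff by blast
  \<comment> \<open>the coefficients are continuous on the compact closure of \<open>\<Omega>\<close> and constant off it\<close>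
  define \<Lambda> where "\<Lambda> = max 1 (max b (norm (mat 1 :: real ^ 'd ^ 'd)))"
  have \<Lambda>: "1 \<le> \<Lambda>" by (simp add: \<Lambda>_def)
  have \<AA>_le: "norm (\<AA> x) \<le> \<Lambda>" for x
    using b \<AA>_id by (cases "x \<in> closure \<Omega>") (auto simp: \<Lambda>_def le_max_iff_disj)
  have dim: "CARD('d) \<ge> 3 \<or> s > 0" using d_or_s by auto
  have problem: "extension_problem I h \<AA> \<beta> s \<AA>\<^sub>0 \<Lambda>" if "heights I h" for I h
    using that \<beta> s cont \<AA>_sym \<AA>_pos \<AA>_le \<Lambda> dim
    by (auto simp: extension_problem_def extension_problem_axioms_def)
  have half: "extension_problem {0<..} 1 \<AA> \<beta> s \<AA>\<^sub>0 \<Lambda>"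
    by (rule problem, unfold_locales) auto
  have slab: "extension_problem {0<..<Y} Y \<AA> \<beta> s \<AA>\<^sub>0 \<Lambda>" if "Y > 0" for Y
  proof (rule problem, unfold_locales)
    show "m * y \<in> {0<..<Y}" if m: "y \<in> {0<..<Y}" "0 < m" "m \<le> 1" for y m
    proof -
      have "m * y \<le> y" using m by (intro mult_left_le_one_le) auto
      also have "y < Y" using m(1) by simp
      finally show ?thesis using m by simp
    qed
  qed (use \<open>Y > 0\<close> in auto)
  define N where "N = L2_norm_on \<Omega>"
  have N: "0 \<le> N f" for f
    unfolding N_def L2_norm_on_def set_lebesgue_integral_def
    by (intro real_sqrt_ge_zero Bochner_Integration.integral_nonneg) simp
  \<comment> \<open>the summand 1 makes the constant positive, the other one being nonnegative\<close>
  define C where "C = extension_problem.coercivity_const \<beta> s \<AA>\<^sub>0 * d_const \<beta> * extension_problem.trace_const \<beta> R + 1"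
  have C: "C > 0"
    unfolding C_def
    using extension_problem.coercivity_const_pos[OF half] extension_problem.d_const_pos[OF half]
      extension_problem.trace_const_nonneg[OF half, of R]
    by (intro add_nonneg_pos mult_nonneg_nonneg) auto
  have solution: "\<exists>U. unique_solution \<beta> s \<AA> (UNIV \<times> I) f U \<and>
      energy_norm \<alpha> s (UNIV \<times> I) U \<le> C * (1 + 1 / h) * N f"
    if I: "extension_problem I h \<AA> \<beta> s \<AA>\<^sub>0 \<Lambda>" and h: "h > 0" and f: "f \<in> L2" "ess_support f \<subseteq> \<Omega>" for I h f
  proof -
    have f0: "AE x in lborel. x \<notin> \<Omega> \<longrightarrow> f x = 0"
      using AE_zero_outside_ess_support[of f] by eventually_elim (use f(2) in blast)
    obtain U where U: "unique_solution \<beta> s \<AA> (UNIV \<times> I) f U"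
      "energy_norm \<alpha> s (UNIV \<times> I) U \<le> (C - 1) * (1 + 1 / h) * N f"
      using extension_problem.unique_solution_bound[OF I f(1) f0 \<Omega>_borel \<Omega>_ball R]
      unfolding \<alpha> C_def N_def by auto
    have "(C - 1) * (1 + 1 / h) * N f \<le> C * (1 + 1 / h) * N f"
      using h N[of f] by (intro mult_right_mono) auto
    then show ?thesis using U by (meson order_trans)
  qed
  define \<mu> where "\<mu> = min1_inv s"
  have \<mu>: "\<mu> > 0" using s by (simp add: \<mu>_def min1_inv_def)
  show ?thesis
    unfolding half_space_def slab_def N_def[symmetric] \<mu>_def[symmetric]
  proof (intro conjI allI impI)
    show "\<exists>C>0. \<forall>f\<in>L2. ess_support f \<subseteq> \<Omega> \<longrightarrow> (\<exists>U. unique_solution \<beta> s \<AA> (UNIV \<times> {0<..}) f U \<and>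
        energy_norm \<alpha> s (UNIV \<times> {0<..}) U \<le> C * \<mu> * N f)"
    proof (intro exI[of _ "2 * C / \<mu>"] conjI ballI impI)
      show "0 < 2 * C / \<mu>" using C \<mu> by simp
      show "\<exists>U. unique_solution \<beta> s \<AA> (UNIV \<times> {0<..}) f U \<and>
          energy_norm \<alpha> s (UNIV \<times> {0<..}) U \<le> 2 * C / \<mu> * \<mu> * N f"
        if "f \<in> L2" "ess_support f \<subseteq> \<Omega>" for f
        using solution[OF half zero_less_one that] \<mu> by (simp add: mult.commute)
    qed
    show "\<exists>C>0. \<forall>Y>0. \<forall>f\<in>L2. ess_support f \<subseteq> \<Omega> \<longrightarrow> (\<exists>U. unique_solution \<beta> s \<AA> (UNIV \<times> {0<..<Y}) f U \<and>
        energy_norm \<alpha> s (UNIV \<times> {0<..<Y}) U \<le> C * (1 + 1 / Y) * \<mu> * N f)"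
    proof (intro exI[of _ "C / \<mu>"] conjI allI ballI impI)
      show "0 < C / \<mu>" using C \<mu> by simp
      show "\<exists>U. unique_solution \<beta> s \<AA> (UNIV \<times> {0<..<Y}) f U \<and>
          energy_norm \<alpha> s (UNIV \<times> {0<..<Y}) U \<le> C / \<mu> * (1 + 1 / Y) * \<mu> * N f"
        if Y: "Y > 0" and f: "f \<in> L2" "ess_support f \<subseteq> \<Omega>" for f and Y :: real
      proof -
        have "C / \<mu> * (1 + 1 / Y) * \<mu> * N f = C * (1 + 1 / Y) * N f" using \<mu> by simp
        then show ?thesis using solution[OF slab[OF Y] Y f] by (simp only:)
      qed
    qed
    show "coercive \<beta> s \<AA> (UNIV \<times> {0<..})" by (rule extension_problem.coercive_form[OF half])
    show "coercive \<beta> s \<AA> (UNIV \<times> {0<..<Y})" if "Y > 0" for Y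
      by (rule extension_problem.coercive_form[OF slab[OF that]])
  qed
qed

end
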